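(* Suppose Assumptions 1–4 below hold. Run Algorithm 2Direction with $$\bar L=660508\cdot\max\Big\{\frac L\alpha,\frac{Lp}{\alpha\tau},\frac{\sqrt{LL_{\max}}\,p\sqrt{\omega\tau}}{\alpha\beta\sqrt n},\frac{\sqrt{LL_{\max}}\sqrt p\sqrt{\omega\tau}}{\alpha\sqrt\beta\sqrt n},\frac{L_{\max}\omega p^2}{\beta^2n},\frac{L_{\max}\omega}{n}\Big\},$$ $\beta\le\frac1{\omega+1}$, and $\theta_{\min}=\frac14\min\{1,\frac\alpha p,\frac\tau p,\frac\beta p\}$. Then there exist constants $\kappa,\rho,\lambda\ge0$ and nonnegative reals $(\nu_t)_{t\ge0}$ such that for all $t\ge0$, writing $$\Psi_t=\mathbb E[f(z^t)-f(x^* )]+\kappa\,\mathbb E\Big[\frac1n\sum_{i=1}^n\|h_i^t-\nabla f_i(z^t)\|^2\Big]+\nu_t\,\mathbb E\|w^t-u^t\|^2+\rho\,\mathbb E\|k^t-\nabla f(z^t)\|^2+\lambda\,\mathbb E\|v^t-\nabla f(z^t)\|^2,$$ we have $$\Gamma_{t+1}\Psi_{t+1}+\frac{\bar L+\Gamma_{t+1}\mu}{2}\mathbb E\|u^{t+1}-x^*\|^2\le\Gamma_t\Psi_t+\frac{\bar L+\Gamma_t\mu}{2}\mathbb E\|u^t-x^*\|^2.$$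
   Context: Setting: $f=\frac1n\sum_{i=1}^nf_i$, $f_i:\mathbb R^d\to\mathbb R$. Assumption 1: each $f_i$ is $L_i$-smooth, $L_{\max}=\max_iL_i$, and $\widehat L>0$ satisfies $\frac1n\sum_i\|\nabla f_i(x)-\nabla f_i(y)\|^2\le\widehat L^2\|x-y\|^2$ for all $x,y$. Assumption 2: $f$ is $L$-smooth. Assumption 3: each $f_i$ is convex and $f$ is $\mu$-strongly convex ($\mu\ge0$) with minimizer $x^*$. Assumption 4: the randomness of all compressors is drawn independently (of each other, of the coins $c^t$, and of the past). Compressor classes: $\mathbb U(\omega)$ ($\omega\ge0$) = stochastic maps $\mathcal C$ with $\mathbb E\mathcal C(x)=x$, $\mathbb E\|\mathcal C(x)-x\|^2\le\omega\|x\|^2$; $\mathbb B(\alpha)$ ($\alpha\in(0,1]$) = possibly stochastic maps with $\mathbb E\|\mathcal C(x)-x\|^2\le(1-\alpha)\|x\|^2$. Algorithm 2Direction: compressors $\mathcal C_i^{D,y},\mathcal C_i^{D,z}\in\mathbb U(\omega)$ (workers), $\mathcal C^P\in\mathbb B(\alpha)$ (server); parameters $\bar L>0$, $\mu\ge0$ (the strong convexity constant), $p\in(0,1]$, $\Gamma_0\ge1$, $\tau\in(0,1]$, $x^0,h_1^0,\dots,h_n^0,k^0,v^0\in\mathbb R^d$. Set $\beta=1/(\omega+1)$, $w^0=z^0=u^0=x^0$, $h^0=\frac1n\sum_ih_i^0$. For $t=0,1,\dots$: let $\bar\theta_{t+1}$ be the largest root of $p\bar L\Gamma_t\theta^2+p(\bar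 L+\Gamma_t\mu)\theta-(\bar L+\Gamma_t\mu)=0$, $\theta_{t+1}=\min\{\bar\theta_{t+1},\theta_{\min}\}$, $\gamma_{t+1}=p\theta_{t+1}\Gamma_t/(1-p\theta_{t+1})$, $\Gamma_{t+1}=\Gamma_t+\gamma_{t+1}$; $y^{t+1}=\theta_{t+1}w^t+(1-\theta_{t+1})z^t$; $m_i^{t,y}=\mathcal C_i^{D,y}(\nabla f_i(y^{t+1})-h_i^t)$; $g^{t+1}=h^t+\frac1n\sum_im_i^{t,y}$; $u^{t+1}=\arg\min_x\{\langle g^{t+1},x\rangle+\frac{\bar L+\Gamma_t\mu}{2\gamma_{t+1}}\|x-u^t\|^2+\frac\mu2\|x-y^{t+1}\|^2\}$; $q^{t+1}=\arg\min_x\{\langle k^t,x\rangle+\frac{\bar L+\Gamma_t\mu}{2\gamma_{t+1}}\|x-w^t\|^2+\frac\mu2\|x-y^{t+1}\|^2\}$; $w^{t+1}=q^{t+1}+\mathcal C^P(u^{t+1}-q^{t+1})$; $x^{t+1}=\theta_{t+1}u^{t+1}+(1-\theta_{t+1})z^t$; draw $c^t\sim\mathrm{Bernoulli}(p)$, and set $(k^{t+1},z^{t+1})=(v^t,x^{t+1})$ if $c^t=1$, $(k^{t+1},z^{t+1})=(k^t,z^t)$ if $c^t=0$; $m_i^{t,z}=\mathcal C_i^{D,z}(\nabla f_i(z^{t+1})-h_i^t)$; $h_i^{t+1}=h_i^t+\beta m_i^{t,z}$; $v^{t+1}=(1-\tau)v^t+\tau(h^t+\frac1n\sum_im_i^{t,z})$;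 $h^{t+1}=h^t+\frac\beta n\sum_im_i^{t,z}$. $\mathbb E$ is full expectation. *)

theory Defs
  imports "HOL-Probability.Probability"
begin

text \<open>A stochastic map x \<mapsto> C(x) is represented by a seed law P (a probability
measure on a seed space) and a jointly measurable map C :: seed \<Rightarrow> vector \<Rightarrow> vector;
each call of the compressor draws a fresh seed s ~ P and outputs C s x.\<close>

definition unbiased_compressor ::
  "'s measure \<Rightarrow> ('s \<Rightarrow> 'a::euclidean_space \<Rightarrow> 'a) \<Rightarrow> real \<Rightarrow> bool" where
  "unbiased_compressor P C \<omega> \<longleftrightarrow>
     prob_space P \<and> (\<lambda>(s, x). C s x) \<in> borel_measurable (P \<Otimes>\<^sub>M borel) \<and>
     (\<forall>x. integrable P (\<lambda>s. C s x) \<and> (\<integral>s. C s x \<partial>P) = x \<and>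
          (\<integral>\<^sup>+ s. ennreal ((norm (C s x - x))\<^sup>2) \<partial>P) \<le> ennreal (\<omega> * (norm x)\<^sup>2))"

definition biased_compressor ::
  "'s measure \<Rightarrow> ('s \<Rightarrow> 'a::euclidean_space \<Rightarrow> 'a) \<Rightarrow> real \<Rightarrow> bool" where
  "biased_compressor P C \<alpha> \<longleftrightarrow>
     prob_space P \<and> (\<lambda>(s, x). C s x) \<in> borel_measurable (P \<Otimes>\<^sub>M borel) \<and>
     (\<forall>x. (\<integral>\<^sup>+ s. ennreal ((norm (C s x - x))\<^sup>2) \<partial>P) \<le> ennreal ((1 - \<alpha>) * (norm x)\<^sup>2))"

definition strongly_convex_grad :: "('a::real_inner \<Rightarrow> real) \<Rightarrow> ('a \<Rightarrow> 'a) \<Rightarrow> real \<Rightarrow> bool" where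
  "strongly_convex_grad f gf \<mu> \<longleftrightarrow>
     (\<forall>x y. f y \<ge> f x + gf x \<bullet> (y - x) + \<mu> / 2 * (norm (y - x))\<^sup>2)"

definition theta_next :: "real \<Rightarrow> real \<Rightarrow> real \<Rightarrow> real \<Rightarrow> real \<Rightarrow> real" where
  "theta_next Lbar mu p thmin G =
     min (Max {th. p * Lbar * G * th\<^sup>2 + p * (Lbar + G * mu) * th - (Lbar + G * mu) = 0}) thmin"

definition gamma_next :: "real \<Rightarrow> real \<Rightarrow> real \<Rightarrow> real \<Rightarrow> real \<Rightarrow> real" where
  "gamma_next Lbar mu p thmin G =
     (let th = theta_next Lbar mu p thmin G in p * th * G / (1 - p * th))"

primrec gam_seq :: "real \<Rightarrow> real \<Rightarrow> real \<Rightarrow> real \<Rightarrow> real \<Rightarrow> nat \<Rightarrow> real" where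
  "gam_seq Lbar mu p thmin G0 0 = G0"
| "gam_seq Lbar mu p thmin G0 (Suc t) =
     gam_seq Lbar mu p thmin G0 t + gamma_next Lbar mu p thmin (gam_seq Lbar mu p thmin G0 t)"

record 'a alg_state =
  st_x :: 'a
  st_w :: 'a
  st_z :: 'a
  st_u :: 'a
  st_k :: 'a
  st_v :: 'a
  st_h :: "nat \<Rightarrow> 'a"
  st_hb :: 'a

text \<open>One iteration t \<rightarrow> t+1; th = theta_{t+1}, gm = gamma_{t+1}, G = Gamma_t;
 ay i / az i / aP are the fresh seeds of the compressors, c the coin c^t.\<close>
definition alg_step ::
  "nat \<Rightarrow> (nat \<Rightarrow> 'a::euclidean_space \<Rightarrow> 'a) \<Rightarrow> (nat \<Rightarrow> 's \<Rightarrow> 'a \<Rightarrow> 'a) \<Rightarrow> (nat \<Rightarrow> 's \<Rightarrow> 'a \<Rightarrow> 'a)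
   \<Rightarrow> ('s \<Rightarrow> 'a \<Rightarrow> 'a) \<Rightarrow> real \<Rightarrow> real \<Rightarrow> real \<Rightarrow> real \<Rightarrow> real \<Rightarrow> real \<Rightarrow> real
   \<Rightarrow> 'a alg_state \<Rightarrow> (nat \<Rightarrow> 's) \<Rightarrow> (nat \<Rightarrow> 's) \<Rightarrow> 's \<Rightarrow> bool \<Rightarrow> 'a alg_state" where
  "alg_step n g CY CZ CP Lbar mu tau beta th gm G s ay az aP c =
    (let y = th *\<^sub>R st_w s + (1 - th) *\<^sub>R st_z s;
         my = (\<lambda>i. CY i (ay i) (g i y - st_h s i));
         gg = st_hb s + (1 / real n) *\<^sub>R (\<Sum>i<n. my i);
         A = (Lbar + G * mu) / gm;
         u' = arg_min (\<lambda>x. gg \<bullet> x + A / 2 * (norm (x - st_u s))\<^sup>2 + mu / 2 * (norm (x - y))\<^sup>2)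
                      (\<lambda>_. True);
         q' = arg_min (\<lambda>x. st_k s \<bullet> x + A / 2 * (norm (x - st_w s))\<^sup>2 + mu / 2 * (norm (x - y))\<^sup>2)
                      (\<lambda>_. True);
         w' = q' + CP aP (u' - q');
         x' = th *\<^sub>R u' + (1 - th) *\<^sub>R st_z s;
         k' = (if c then st_v s else st_k s);
         z' = (if c then x' else st_z s);
         mz = (\<lambda>i. CZ i (az i) (g i z' - st_h s i));
         h' = (\<lambda>i. st_h s i + beta *\<^sub>R mz i);
         v' = (1 - tau) *\<^sub>R st_v s + tau *\<^sub>R (st_hb s + (1 / real n) *\<^sub>R (\<Sum>i<n. mz i));
         hb' = st_hb s + (beta / real n) *\<^sub>R (\<Sum>i<n. mz i)
     in \<lparr>st_x = x', st_w = w', st_z = z', st_u = u', st_k = k', st_v = v', st_h = h', st_hb = hb'\<rparr>)"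

primrec alg_run ::
  "nat \<Rightarrow> (nat \<Rightarrow> 'a::euclidean_space \<Rightarrow> 'a) \<Rightarrow> (nat \<Rightarrow> 's \<Rightarrow> 'a \<Rightarrow> 'a) \<Rightarrow> (nat \<Rightarrow> 's \<Rightarrow> 'a \<Rightarrow> 'a)
   \<Rightarrow> ('s \<Rightarrow> 'a \<Rightarrow> 'a) \<Rightarrow> real \<Rightarrow> real \<Rightarrow> real \<Rightarrow> real \<Rightarrow> real \<Rightarrow> real \<Rightarrow> real
   \<Rightarrow> 'a \<Rightarrow> (nat \<Rightarrow> 'a) \<Rightarrow> 'a \<Rightarrow> 'a
   \<Rightarrow> (nat \<Rightarrow> nat \<Rightarrow> 'm \<Rightarrow> 's) \<Rightarrow> (nat \<Rightarrow> nat \<Rightarrow> 'm \<Rightarrow> 's) \<Rightarrow> (nat \<Rightarrow> 'm \<Rightarrow> 's) \<Rightarrow> (nat \<Rightarrow> 'm \<Rightarrow> bool)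
   \<Rightarrow> nat \<Rightarrow> 'm \<Rightarrow> 'a alg_state" where
  "alg_run n g CY CZ CP Lbar mu p tau beta thmin G0 x0 h0 k0 v0 sy sz sP coin 0 \<omega> =
     \<lparr>st_x = x0, st_w = x0, st_z = x0, st_u = x0, st_k = k0, st_v = v0, st_h = h0,
      st_hb = (1 / real n) *\<^sub>R (\<Sum>i<n. h0 i)\<rparr>"
| "alg_run n g CY CZ CP Lbar mu p tau beta thmin G0 x0 h0 k0 v0 sy sz sP coin (Suc t) \<omega> =
     alg_step n g CY CZ CP Lbar mu tau beta
       (theta_next Lbar mu p thmin (gam_seq Lbar mu p thmin G0 t))
       (gamma_next Lbar mu p thmin (gam_seq Lbar mu p thmin G0 t))
       (gam_seq Lbar mu p thmin G0 t)
       (alg_run n g CY CZ CP Lbar mu p tau beta thmin G0 x0 h0 k0 v0 sy sz sP coin t \<omega>)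
       (\<lambda>i. sy t i \<omega>) (\<lambda>i. sz t i \<omega>) (sP t \<omega>) (coin t \<omega>)"

datatype src = SrcY nat nat | SrcZ nat nat | SrcP nat | SrcC nat

definition rel_srcs :: "nat \<Rightarrow> src set" where
  "rel_srcs n = {SrcY t i | t i. i < n} \<union> {SrcZ t i | t i. i < n} \<union> range SrcP \<union> range SrcC"

definition src_events ::
  "'m measure \<Rightarrow> (nat \<Rightarrow> 's measure) \<Rightarrow> (nat \<Rightarrow> 's measure) \<Rightarrow> 's measure
   \<Rightarrow> (nat \<Rightarrow> nat \<Rightarrow> 'm \<Rightarrow> 's) \<Rightarrow> (nat \<Rightarrow> nat \<Rightarrow> 'm \<Rightarrow> 's) \<Rightarrow> (nat \<Rightarrow> 'm \<Rightarrow> 's) \<Rightarrow> (nat \<Rightarrow> 'm \<Rightarrow> bool)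
   \<Rightarrow> src \<Rightarrow> 'm set set" where
  "src_events M PY PZ PP sy sz sP coin s = (case s of
      SrcY t i \<Rightarrow> {sy t i -` A \<inter> space M | A. A \<in> sets (PY i)}
    | SrcZ t i \<Rightarrow> {sz t i -` A \<inter> space M | A. A \<in> sets (PZ i)}
    | SrcP t \<Rightarrow> {sP t -` A \<inter> space M | A. A \<in> sets PP}
    | SrcC t \<Rightarrow> {coin t -` A \<inter> space M | A. A \<in> sets (count_space (UNIV :: bool set))})"

end

theory Submission
  imports Defs
begin

text \<open>
One step of the method bounds \<open>f(x\<^sup>+) - f(s)\<close>, where \<open>x\<^sup>+\<close> is the extrapolated point and \<open>s\<close> the
minimizer, by the accelerated estimate minus the Bregman divergence of \<open>f\<close> between \<open>z\<close> and \<open>y\<close> and minus a multiple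
of \<open>|u\<^sup>+ - u|\<^sup>2\<close>, plus the variance of the compressed gradient. The four auxiliary potentials (shift error,
server error \<open>|w - u|\<^sup>2\<close>, and the errors of \<open>k\<close> and \<open>v\<close>) each contract up to terms in gradient differences.
By cocoercivity, each gradient difference between \<open>z\<close>, \<open>y\<close> and \<open>x\<^sup>+\<close> is at most a multiple of the Bregman
divergence plus \<open>|u\<^sup>+ - w|\<^sup>2\<close>, and the size of \<open>Lbar\<close> makes these multiples so small that the two
negative terms absorb them. Since a jump of \<open>z\<close> only happens with probability \<open>p\<close>, Young's inequality is
applied to the jump alone with parameter of order \<open>beta / p\<close> or \<open>tau / p\<close>; this is what produces \<open>p\<^sup>2\<close>
in \<open>Lbar\<close>. The weight \<open>nu\<close> scales with the square of the step size \<open>theta\<close>, which is nonincreasing.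
\<close>

subsection \<open>Smooth convex functions and the step-size equation\<close>

text \<open>The expectations in the statement are Bochner integrals, which default to 0 for a
  nonintegrable integrand. No inequality between them is available before every iterate is known to
  be square integrable, so integrability and measurability with respect to the noise drawn so far
  are carried along by induction. Conditional expectations are avoided: a fresh seed is integrated
  out by Fubini, with everything drawn before it frozen.

  The step-size equation enters the energy estimate as \<open>A \<ge> Lbar * th\<close>, where
  \<open>A\<close> is the prox coefficient (Lbar + Gamma mu) / gamma. Hence th / (A + mu) is at most
  1 / Lbar, so the variance of the gradient estimate costs at most 1 / Lbar in the objective.

  The factor 1/4 in the bound on theta comes from bookkeeping. The errors of w, h and v contract by
  1 - alpha/2, 1 - beta/2 and 1 - tau/2; half of each gain pays for incoming errors, and the other
  half pays for the growth of Gamma, whose relative rate is p theta. The constant 660508 leaves much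
  slack: the gradient differences only have to end up with a total coefficient of at most
  1/8.\<close>

definition bregman :: "('a::real_inner \<Rightarrow> real) \<Rightarrow> ('a \<Rightarrow> 'a) \<Rightarrow> 'a \<Rightarrow> 'a \<Rightarrow> real" where
  "bregman f g x y = f x - f y - g y \<bullet> (x - y)"

lemma has_derivative_imp_line_derivative:
  fixes f :: "'a::real_inner \<Rightarrow> real"
  assumes "\<And>x. (f has_derivative (\<lambda>h. g x \<bullet> h)) (at x)"
  shows "((\<lambda>t. f (x + t *\<^sub>R d)) has_real_derivative g (x + t *\<^sub>R d) \<bullet> d) (at t)"
proof -
  have "((\<lambda>t. x + t *\<^sub>R d) has_derivative (\<lambda>h. h *\<^sub>R d)) (at t)"
    by (auto intro!: derivative_eq_intros)
  from has_derivative_compose[OF this assms]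
  show ?thesis
    by (rule has_derivative_imp_has_field_derivative) simp
qed

text \<open>Instead of integrating the gradient along the segment, the claimed bound is subtracted
  from \<open>f\<close>; the Lipschitz condition makes the derivative of the difference nonpositive
  on [0, 1].\<close>

lemma bregman_le_quadratic:
  fixes f :: "'a::real_inner \<Rightarrow> real"
  assumes d: "\<And>x. (f has_derivative (\<lambda>h. g x \<bullet> h)) (at x)"
    and l: "\<And>x y. norm (g x - g y) \<le> L * norm (x - y)"
  shows "bregman f g x y \<le> L / 2 * (norm (x - y))\<^sup>2"
proof -
  let ?d = "x - y"
  let ?phi = "\<lambda>t. f (y + t *\<^sub>R ?d) - t * (g y \<bullet> ?d) - L / 2 * t\<^sup>2 * (norm ?d)\<^sup>2"
  let ?phi' = "\<lambda>t. g (y + t *\<^sub>R ?d) \<bullet> ?d - g y \<bullet> ?d - L * t * (norm ?d)\<^sup>2"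
  have "?phi 1 \<le> ?phi 0"
  proof (rule DERIV_nonpos_imp_nonincreasing[where f = ?phi and a = 0 and b = 1])
    fix t :: real assume t: "0 \<le> t" "t \<le> 1"
    have "(?phi has_real_derivative ?phi' t) (at t)"
      by (auto intro!: derivative_eq_intros has_derivative_imp_line_derivative d simp: power2_eq_square)
    moreover have "?phi' t \<le> 0"
    proof -
      have "(g (y + t *\<^sub>R ?d) - g y) \<bullet> ?d \<le> norm (g (y + t *\<^sub>R ?d) - g y) * norm ?d"
        by (rule norm_cauchy_schwarz)
      also have "\<dots> \<le> (L * norm ((y + t *\<^sub>R ?d) - y)) * norm ?d"
        by (intro mult_right_mono l) simp
      also have "\<dots> = L * t * (norm ?d)\<^sup>2" using t by (simp add: power2_eq_square)
      finally show ?thesis by (simp add: inner_diff_left)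
    qed
    ultimately show "\<exists>D. (?phi has_real_derivative D) (at t) \<and> D \<le> 0" by blast
  qed simp
  thus ?thesis by (simp add: bregman_def)
qed

text \<open>Restriction to the line through the two points reduces this to the tangent inequality
  for convex functions of one real variable.\<close>

lemma convex_on_imp_bregman_nonneg:
  fixes f :: "'a::real_inner \<Rightarrow> real"
  assumes d: "\<And>x. (f has_derivative (\<lambda>h. g x \<bullet> h)) (at x)"
    and c: "convex_on UNIV f"
  shows "0 \<le> bregman f g x y"
proof -
  let ?phi = "\<lambda>t. f (y + t *\<^sub>R (x - y))"
  have cv: "convex_on UNIV ?phi"
  proof (rule convex_onI)
    fix t a b :: real assume t: "0 < t" "t < 1"
    have e: "y + ((1 - t) *\<^sub>R a + t *\<^sub>R b) *\<^sub>R (x - y)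
        = (1 - t) *\<^sub>R (y + a *\<^sub>R (x - y)) + t *\<^sub>R (y + b *\<^sub>R (x - y))"
      by (simp add: algebra_simps)
    show "?phi ((1 - t) *\<^sub>R a + t *\<^sub>R b) \<le> (1 - t) * ?phi a + t * ?phi b"
      unfolding e using t by (intro convex_onD[OF c]) auto
  qed simp
  have "?phi 1 - ?phi 0 \<ge> (g (y + 0 *\<^sub>R (x - y)) \<bullet> (x - y)) * (1 - 0)"
    by (rule convex_on_imp_above_tangent[OF cv])
       (use has_derivative_imp_line_derivative[OF d, of y "x - y" 0] in auto)
  thus ?thesis by (simp add: bregman_def)
qed

text \<open>The smoothness hypotheses state no sign for their constants. Comparing a basis vector
  with 0 forces it.\<close>

lemma lipschitz_const_nonneg:
  fixes g :: "'a::euclidean_space \<Rightarrow> 'a"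
  assumes "\<And>x y. norm (g x - g y) \<le> L * norm (x - y)"
  shows "0 \<le> L"
proof -
  obtain b :: 'a where b: "b \<in> Basis" using nonempty_Basis by blast
  have "0 \<le> norm (g b - g 0)" by simp
  also have "\<dots> \<le> L * norm (b - 0)" by (rule assms)
  finally show ?thesis using b by simp
qed

text \<open>The function \<open>z \<mapsto> f z - g y \<bullet> z\<close> is minimal at \<open>y\<close>; compare this with a gradient step from \<open>x\<close>.\<close>
lemma norm_grad_diff_le_bregman:
  fixes f :: "'a::euclidean_space \<Rightarrow> real"
  assumes d: "\<And>x. (f has_derivative (\<lambda>h. g x \<bullet> h)) (at x)"
    and l: "\<And>x y. norm (g x - g y) \<le> L * norm (x - y)"
    and c: "\<And>x y. 0 \<le> bregman f g x y"
  shows "(norm (g x - g y))\<^sup>2 \<le> 2 * L * bregman f g x y"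
proof (cases "L = 0")
  case True
  with l[of x y] show ?thesis by simp
next
  case False
  with lipschitz_const_nonneg[OF l] have L: "L > 0" by simp
  let ?e = "g x - g y"
  let ?z = "x - (1 / L) *\<^sub>R ?e"
  have "bregman f g ?z x \<le> L / 2 * (norm (?z - x))\<^sup>2"
    by (rule bregman_le_quadratic[OF d l])
  moreover have "0 \<le> bregman f g ?z y" by (rule c)
  moreover have "L / 2 * (norm (?z - x))\<^sup>2 = (norm ?e)\<^sup>2 / (2 * L)"
    using L by (simp add: power_divide) (simp add: power2_eq_square)
  moreover have "bregman f g ?z y = bregman f g x y + bregman f g ?z x + ?e \<bullet> (?z - x)"
    by (simp add: bregman_def inner_diff_right inner_diff_left algebra_simps)
  moreover have "?e \<bullet> (?z - x) = - (?e \<bullet> ?e / L)" by simp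
  ultimately have "?e \<bullet> ?e / L \<le> bregman f g x y + (norm ?e)\<^sup>2 / (2 * L)" by linarith
  thus ?thesis using L by (simp add: power2_norm_eq_inner field_simps)
qed

text \<open>Young's inequality, from expanding |s a - b|^2. The parameter stays free: it is later
  taken as 1, alpha / 2, beta / (2 p) or tau / (2 p).\<close>

lemma norm_add_sq_le:
  fixes a b :: "'a::real_inner"
  assumes "s > 0"
  shows "(norm (a + b))\<^sup>2 \<le> (1 + s) * (norm a)\<^sup>2 + (1 + 1 / s) * (norm b)\<^sup>2"
proof -
  have "0 \<le> (norm (s *\<^sub>R a - b))\<^sup>2" by simp
  also have "\<dots> = s\<^sup>2 * (a \<bullet> a) - 2 * s * (a \<bullet> b) + b \<bullet> b"
    by (simp only: power2_norm_eq_inner) (simp add: inner_diff_left inner_diff_right inner_commute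
        power2_eq_square algebra_simps)
  finally have "2 * (a \<bullet> b) \<le> s * (a \<bullet> a) + (b \<bullet> b) / s"
    using assms by (simp add: field_simps power2_eq_square)
  thus ?thesis
    by (simp add: power2_norm_eq_inner inner_add_left inner_add_right inner_commute algebra_simps)
qed

lemma norm_add_sq_le2:
  fixes a b :: "'a::real_inner"
  shows "(norm (a + b))\<^sup>2 \<le> 2 * (norm a)\<^sup>2 + 2 * (norm b)\<^sup>2"
  using norm_add_sq_le[of 1 a b] by simp

text \<open>\<open>m\<close> is the stationary point of a quadratic with leading coefficient (A +
  mu) / 2, so the expansion around it is exact. It serves twice: it identifies the minimizer, and
  evaluated at the solution it gives the three-point identity of the descent estimate.\<close>

lemma prox_complete_square:
  fixes g u y x :: "'a::real_inner"
  assumes "A + mu > 0"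
  defines "m \<equiv> (1 / (A + mu)) *\<^sub>R (A *\<^sub>R u + mu *\<^sub>R y - g)"
  shows "g \<bullet> x + A / 2 * (norm (x - u))\<^sup>2 + mu / 2 * (norm (x - y))\<^sup>2
       = (g \<bullet> m + A / 2 * (norm (m - u))\<^sup>2 + mu / 2 * (norm (m - y))\<^sup>2)
         + (A + mu) / 2 * (norm (x - m))\<^sup>2"
proof -
  define d where "d = x - m"
  have "(A + mu) *\<^sub>R m = A *\<^sub>R u + mu *\<^sub>R y - g"
    using assms(1) by (simp add: m_def)
  hence "g + A *\<^sub>R (m - u) + mu *\<^sub>R (m - y) = 0" by (simp add: algebra_simps)
  hence "(g + A *\<^sub>R (m - u) + mu *\<^sub>R (m - y)) \<bullet> d = 0" by simp
  hence 0: "g \<bullet> d + A * ((m - u) \<bullet> d) + mu * ((m - y) \<bullet> d) = 0"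
    by (simp add: inner_add_left)
  have e: "(norm (m + d - v))\<^sup>2 = (norm (m - v))\<^sup>2 + 2 * ((m - v) \<bullet> d) + (norm d)\<^sup>2" for v
  proof -
    have "m + d - v = (m - v) + d" by simp
    thus ?thesis by (simp only: power2_norm_eq_inner inner_add_left inner_add_right)
        (simp add: inner_commute)
  qed
  have x: "x = m + d" by (simp add: d_def)
  show ?thesis unfolding x e using 0 by (simp add: inner_add_right algebra_simps add_divide_distrib)
qed

lemma arg_min_prox:
  fixes g u y :: "'a::real_inner"
  assumes "A + mu > 0"
  shows "arg_min (\<lambda>x. g \<bullet> x + A / 2 * (norm (x - u))\<^sup>2 + mu / 2 * (norm (x - y))\<^sup>2) (\<lambda>_. True)
       = (1 / (A + mu)) *\<^sub>R (A *\<^sub>R u + mu *\<^sub>R y - g)" (is "arg_min ?f _ = ?m")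
proof -
  have le: "?f ?m + (A + mu) / 2 * (norm (x - ?m))\<^sup>2 = ?f x" for x
    using prox_complete_square[OF assms, of g x u y] by simp
  have min: "?f ?m \<le> ?f x" for x
    unfolding le[of x, symmetric] using assms by simp
  hence "is_arg_min ?f (\<lambda>_. True) ?m" by (auto simp: is_arg_min_linorder)
  \<comment> \<open>\<open>arg_min\<close> picks some minimizer by choice. Since one exists, the
    chosen point is a minimizer too, and the exact quadratic growth around \<open>?m\<close> leaves
    no other.\<close>
  hence "is_arg_min ?f (\<lambda>_. True) (arg_min ?f (\<lambda>_. True))"
    unfolding arg_min_def by (rule someI)
  hence "?f (arg_min ?f (\<lambda>_. True)) \<le> ?f ?m" unfolding is_arg_min_linorder by blast
  hence "(A + mu) / 2 * (norm (arg_min ?f (\<lambda>_. True) - ?m))\<^sup>2 \<le> 0"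
    unfolding le[of "arg_min ?f (\<lambda>_. True)", symmetric] by linarith
  thus ?thesis using assms by (simp add: mult_le_0_iff)
qed

text \<open>The larger root of the quadratic equation defining \<open>theta_next\<close>.\<close>
definition step_root :: "real \<Rightarrow> real \<Rightarrow> real \<Rightarrow> real \<Rightarrow> real" where
  "step_root Lbar mu p G = (let b = p * (Lbar + G * mu) in
     (- b + sqrt (b\<^sup>2 + 4 * (p * Lbar * G) * (Lbar + G * mu))) / (2 * (p * Lbar * G)))"

context
  fixes Lbar mu p :: real
  assumes pos: "Lbar > 0" "mu \<ge> 0" "p > 0"
begin

text \<open>With \<open>s\<close> the square root of the discriminant, 4 a times the quadratic
  factors into (2 a x + b - s)(2 a x + b + s). For x \<ge> 0 the second factor is positive, so the
  first decides the sign.\<close>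

lemma step_quadratic_le_iff:
  assumes G: "G > 0" and th: "th \<ge> 0"
  shows "p * Lbar * G * th\<^sup>2 + p * (Lbar + G * mu) * th \<le> Lbar + G * mu \<longleftrightarrow> th \<le> step_root Lbar mu p G"
    and "step_root Lbar mu p G > 0"
    and "Max {th. p * Lbar * G * th\<^sup>2 + p * (Lbar + G * mu) * th - (Lbar + G * mu) = 0} = step_root Lbar mu p G"
proof -
  define c where "c = Lbar + G * mu"
  define a where "a = p * Lbar * G"
  define b where "b = p * c"
  define s where "s = sqrt (b\<^sup>2 + 4 * a * c)"
  have c: "c > 0" using pos G unfolding c_def by (simp add: add_pos_nonneg)
  have a: "a > 0" using pos G by (simp add: a_def)
  have b: "b > 0" using pos c by (simp add: b_def)
  have "b = sqrt (b\<^sup>2)" using b by simp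
  also have "\<dots> < s" unfolding s_def using a c by (intro real_sqrt_less_mono) simp
  finally have s: "s > b" .
  have s2: "s\<^sup>2 = b\<^sup>2 + 4 * a * c" unfolding s_def using a c by simp
  have r: "step_root Lbar mu p G = (s - b) / (2 * a)"
    by (simp add: step_root_def Let_def s_def a_def b_def c_def)
  show "step_root Lbar mu p G > 0" unfolding r using s a by simp
  have f: "4 * a * (a * x\<^sup>2 + b * x - c) = (2 * a * x + b - s) * (2 * a * x + b + s)" for x
    using s2 by (simp add: algebra_simps power2_eq_square)
  have "a * th\<^sup>2 + b * th \<le> c \<longleftrightarrow> 4 * a * (a * th\<^sup>2 + b * th - c) \<le> 0"
    using a by (simp add: mult_le_0_iff)
  also have "\<dots> \<longleftrightarrow> 2 * a * th + b - s \<le> 0"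
  proof -
    have "2 * a * th + b + s > 0" using a b s th by (simp add: add_nonneg_pos)
    thus ?thesis unfolding f by (simp add: mult_le_0_iff)
  qed
  also have "\<dots> \<longleftrightarrow> th \<le> step_root Lbar mu p G"
    unfolding r using a by (simp add: field_simps)
  finally show "p * Lbar * G * th\<^sup>2 + p * (Lbar + G * mu) * th \<le> Lbar + G * mu
      \<longleftrightarrow> th \<le> step_root Lbar mu p G"
    by (simp add: a_def b_def c_def)
  \<comment> \<open>\<open>Max\<close> is informative only on a finite nonempty set, so the set of
    roots is written out explicitly.\<close>
  have "{x. a * x\<^sup>2 + b * x - c = 0} = {(s - b) / (2 * a), (- s - b) / (2 * a)}"
  proof -
    have "a * x\<^sup>2 + b * x - c = 0 \<longleftrightarrow> x = (s - b) / (2 * a) \<or> x = (- s - b) / (2 * a)" for x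
    proof -
      have "a * x\<^sup>2 + b * x - c = 0 \<longleftrightarrow> 4 * a * (a * x\<^sup>2 + b * x - c) = 0" using a by simp
      also have "\<dots> \<longleftrightarrow> x = (s - b) / (2 * a) \<or> x = (- s - b) / (2 * a)"
        unfolding f mult_eq_0_iff using a by (simp add: eq_divide_eq) argo
      finally show ?thesis .
    qed
    thus ?thesis by blast
  qed
  moreover have "(- s - b) / (2 * a) \<le> (s - b) / (2 * a)"
    using a s b by (intro divide_right_mono) auto
  ultimately have "Max {x. a * x\<^sup>2 + b * x - c = 0} = (s - b) / (2 * a)"
    by (simp add: max_def)
  thus "Max {th. p * Lbar * G * th\<^sup>2 + p * (Lbar + G * mu) * th - (Lbar + G * mu) = 0} = step_root Lbar mu p G"
    unfolding r by (simp add: a_def b_def c_def)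
qed

lemma theta_next_eq: "G > 0 \<Longrightarrow> theta_next Lbar mu p thmin G = min (step_root Lbar mu p G) thmin"
  unfolding theta_next_def using step_quadratic_le_iff(3)[of G 0] by simp

text \<open>For a fixed step r the defining inequality is linear in \<open>G\<close>: it reads G X
  \<le> Lbar (1 - p r). If X \<ge> 0, decreasing \<open>G\<close> preserves it; if X < 0, the left
  side is negative while p r \<le> 1 makes the right side nonnegative. So the root for the larger
  value satisfies the inequality for the smaller one.\<close>

lemma step_root_antimono:
  assumes G: "0 < G" "G \<le> G'"
  shows "step_root Lbar mu p G' \<le> step_root Lbar mu p G"
proof -
  define r where "r = step_root Lbar mu p G'"
  have G': "G' > 0" using G by simp
  have r: "r > 0" unfolding r_def using step_quadratic_le_iff(2)[OF G', of 0] by simp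
  have q: "p * Lbar * G' * r\<^sup>2 + p * (Lbar + G' * mu) * r \<le> Lbar + G' * mu"
    using step_quadratic_le_iff(1)[OF G', of r] r unfolding r_def by simp
  hence q': "G' * (p * Lbar * r\<^sup>2 - mu * (1 - p * r)) \<le> Lbar * (1 - p * r)"
    by (simp add: algebra_simps)
  have "0 \<le> p * Lbar * G' * r\<^sup>2" using pos G' by simp
  with q have "0 \<le> (Lbar + G' * mu) * (1 - p * r)" by (simp add: algebra_simps)
  moreover have "Lbar + G' * mu > 0" using pos G' by (simp add: add_pos_nonneg)
  ultimately have pr: "0 \<le> 1 - p * r" by (simp add: zero_le_mult_iff)
  have "G * (p * Lbar * r\<^sup>2 - mu * (1 - p * r)) \<le> Lbar * (1 - p * r)"
  proof (cases "p * Lbar * r\<^sup>2 - mu * (1 - p * r) \<ge> 0")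
    case True
    hence "G * (p * Lbar * r\<^sup>2 - mu * (1 - p * r)) \<le> G' * (p * Lbar * r\<^sup>2 - mu * (1 - p * r))"
      using G by (intro mult_right_mono) auto
    with q' show ?thesis by linarith
  next
    case False
    hence "G * (p * Lbar * r\<^sup>2 - mu * (1 - p * r)) \<le> 0" using G by (simp add: mult_le_0_iff)
    also have "0 \<le> Lbar * (1 - p * r)" using pos pr by simp
    finally show ?thesis .
  qed
  hence "p * Lbar * G * r\<^sup>2 + p * (Lbar + G * mu) * r \<le> Lbar + G * mu"
    by (simp add: algebra_simps)
  thus ?thesis using step_quadratic_le_iff(1)[OF G(1), of r] r unfolding r_def by simp
qed

end

subsection \<open>Independent sources of noise and square-integrable histories\<close>

locale noise_sources = prob_space M for M :: "'m measure" +
  fixes E :: "'j \<Rightarrow> 'm set set" and K :: "'j set"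
  assumes indep_E: "indep_sets E K"
    and Int_stable_E: "\<And>j. j \<in> K \<Longrightarrow> Int_stable (E j)"
begin

text \<open>Histories are indexed by sets of sources and not by time, because the seeds of a single
  iteration are revealed in several stages.\<close>

definition hist :: "'j set \<Rightarrow> 'm measure" where
  "hist J = sigma (space M) (\<Union>j\<in>J. E j)"

definition source :: "'j \<Rightarrow> ('m \<Rightarrow> 's) \<Rightarrow> 's measure \<Rightarrow> bool" where
  "source j s P \<longleftrightarrow> s \<in> measurable M P \<and> (\<forall>A\<in>sets P. s -` A \<inter> space M \<in> E j)"

text \<open>Measurability with respect to a history and square integrability are bundled, so that
  one family of closure rules propagates both. Sources outside \<open>K\<close> are excluded because
  their generators need not be events.\<close>

definition L2 :: "'j set \<Rightarrow> ('m \<Rightarrow> 'b::euclidean_space) \<Rightarrow> bool" where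
  "L2 J X \<longleftrightarrow> J \<subseteq> K \<and> X \<in> borel_measurable (hist J) \<and> integrable M (\<lambda>\<omega>. (norm (X \<omega>))\<^sup>2)"

abbreviation msq :: "('m \<Rightarrow> 'b::euclidean_space) \<Rightarrow> real" where
  "msq X \<equiv> expectation (\<lambda>\<omega>. (norm (X \<omega>))\<^sup>2)"

lemma E_events: "j \<in> K \<Longrightarrow> E j \<subseteq> events"
  using indep_E by (auto simp: indep_sets_def)

lemma space_hist [simp]: "space (hist J) = space M"
  by (simp only: hist_def space_measure_of_conv)

lemma sets_hist: "J \<subseteq> K \<Longrightarrow> sets (hist J) = sigma_sets (space M) (\<Union>j\<in>J. E j)"
  unfolding hist_def using E_events sets.space_closed by (intro sets_measure_of) blast

lemma subalgebra_hist: "J \<subseteq> K \<Longrightarrow> subalgebra M (hist J)"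
  unfolding subalgebra_def using E_events by (auto simp: sets_hist intro!: sets.sigma_sets_subset)

lemma subalgebra_hist_mono: "J \<subseteq> J' \<Longrightarrow> J' \<subseteq> K \<Longrightarrow> subalgebra (hist J') (hist J)"
  unfolding subalgebra_def by (auto simp: sets_hist intro!: sigma_sets_mono')

lemma measurable_hist: "J \<subseteq> K \<Longrightarrow> X \<in> measurable (hist J) N \<Longrightarrow> X \<in> measurable M N"
  by (rule measurable_from_subalg[OF subalgebra_hist])

lemma measurable_hist_mono:
  "X \<in> measurable (hist J) N \<Longrightarrow> J \<subseteq> J' \<Longrightarrow> J' \<subseteq> K \<Longrightarrow> X \<in> measurable (hist J') N"
  by (rule measurable_from_subalg[OF subalgebra_hist_mono])

lemma measurable_source:
  assumes "source j s P" "j \<in> J" "J \<subseteq> K"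
  shows "s \<in> measurable (hist J) P"
proof (rule measurableI)
  fix x assume "x \<in> space (hist J)"
  with assms show "s x \<in> space P" by (auto simp: source_def dest: measurable_space)
next
  fix A assume "A \<in> sets P"
  with assms(1) have "s -` A \<inter> space M \<in> E j" by (auto simp: source_def)
  with assms show "s -` A \<inter> space (hist J) \<in> sets (hist J)"
    by (auto simp: sets_hist intro!: sigma_sets.Basic)
qed

text \<open>Grouping the sources into the blocks \<open>J\<close> and \<open>{j}\<close> yields two
  independent sigma-algebras, because every generating family is intersection stable. Agreement on
  rectangles then identifies the joint law as a product.\<close>

lemma fresh_distr:
  assumes X: "X \<in> measurable (hist J) N" and J: "J \<subseteq> K" and j: "j \<in> K" "j \<notin> J"
    and s: "source j s P"
  shows "distr M (N \<Otimes>\<^sub>M P) (\<lambda>\<omega>. (X \<omega>, s \<omega>)) = distr M N X \<Otimes>\<^sub>M distr M P s"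
proof -
  have [measurable]: "X \<in> measurable M N" "s \<in> measurable M P"
    using measurable_hist[OF J X] s by (auto simp: source_def)
  interpret X: prob_space "distr M N X" by (rule prob_space_distr) measurable
  interpret S: prob_space "distr M P s" by (rule prob_space_distr) measurable
  define I where "I = (\<lambda>b. if b then J else {j})"
  have "indep_sets (\<lambda>b. sigma_sets (space M) (\<Union>i\<in>I b. E i)) UNIV"
  proof (rule indep_sets_collect_sigma)
    show "indep_sets E (\<Union>b\<in>UNIV. I b)"
      by (rule indep_sets_mono_index[OF _ indep_E]) (use J j in \<open>auto simp: I_def split: if_splits\<close>)
    show "Int_stable (E i)" if "i \<in> I b" for i b
      using that J j by (auto simp: I_def split: if_splits intro: Int_stable_E)
    show "disjoint_family I"
      using j by (auto simp: disjoint_family_on_def I_def)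
  qed
  hence ind: "indep_set (sigma_sets (space M) (\<Union>i\<in>J. E i)) (sigma_sets (space M) (E j))"
    unfolding indep_set_def
    by (rule indep_sets_mono_sets) (auto simp: I_def split: bool.split)
  show ?thesis
  proof (rule pair_measure_eqI[symmetric])
    fix A B assume A: "A \<in> sets (distr M N X)" and B: "B \<in> sets (distr M P s)"
    have a: "X -` A \<inter> space M \<in> sigma_sets (space M) (\<Union>i\<in>J. E i)"
      using measurable_sets[OF X, of A] A J by (simp add: sets_hist)
    have b: "s -` B \<inter> space M \<in> sigma_sets (space M) (E j)"
      using s B by (auto simp: source_def)
    have "prob ((X -` A \<inter> space M) \<inter> (s -` B \<inter> space M))
        = prob (X -` A \<inter> space M) * prob (s -` B \<inter> space M)"
      by (rule indep_setD[OF ind a b])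
    also have "(X -` A \<inter> space M) \<inter> (s -` B \<inter> space M) = (\<lambda>\<omega>. (X \<omega>, s \<omega>)) -` (A \<times> B) \<inter> space M"
      by auto
    finally show "emeasure (distr M N X) A * emeasure (distr M P s) B
        = emeasure (distr M (N \<Otimes>\<^sub>M P) (\<lambda>\<omega>. (X \<omega>, s \<omega>))) (A \<times> B)"
      using A B by (simp add: emeasure_distr emeasure_eq_measure ennreal_mult)
  qed (auto intro: X.sigma_finite_measure_axioms S.sigma_finite_measure_axioms)
qed

text \<open>This version needs no integrability and can therefore be used to prove it, namely for
  the second moment of the compression noise. Signed integrands, such as inner products, use
  \<open>fresh_integral\<close> afterwards.\<close>

lemma fresh_nn_integral:
  assumes X: "X \<in> measurable (hist J) N" and J: "J \<subseteq> K" and j: "j \<in> K" "j \<notin> J"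
    and s: "source j s P" and \<phi>: "\<phi> \<in> borel_measurable (N \<Otimes>\<^sub>M P)"
  shows "(\<integral>\<^sup>+ \<omega>. \<phi> (X \<omega>, s \<omega>) \<partial>M) = (\<integral>\<^sup>+ \<omega>. (\<integral>\<^sup>+ a. \<phi> (X \<omega>, a) \<partial>distr M P s) \<partial>M)"
proof -
  have [measurable]: "X \<in> measurable M N" "s \<in> measurable M P"
    using measurable_hist[OF J X] s by (auto simp: source_def)
  interpret S: prob_space "distr M P s" by (rule prob_space_distr) measurable
  have [measurable]: "\<phi> \<in> borel_measurable (N \<Otimes>\<^sub>M distr M P s)"
    using \<phi> by simp
  have "(\<integral>\<^sup>+ \<omega>. \<phi> (X \<omega>, s \<omega>) \<partial>M) = (\<integral>\<^sup>+ q. \<phi> q \<partial>distr M (N \<Otimes>\<^sub>M P) (\<lambda>\<omega>. (X \<omega>, s \<omega>)))"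
    using \<phi> by (subst nn_integral_distr) auto
  also have "\<dots> = (\<integral>\<^sup>+ q. \<phi> q \<partial>(distr M N X \<Otimes>\<^sub>M distr M P s))"
    by (simp add: fresh_distr[OF X J j s])
  also have "\<dots> = (\<integral>\<^sup>+ x. (\<integral>\<^sup>+ a. \<phi> (x, a) \<partial>distr M P s) \<partial>distr M N X)"
    using \<phi> by (subst S.nn_integral_fst[symmetric]) auto
  also have "\<dots> = (\<integral>\<^sup>+ \<omega>. (\<integral>\<^sup>+ a. \<phi> (X \<omega>, a) \<partial>distr M P s) \<partial>M)"
    by (subst nn_integral_distr) (auto intro!: S.borel_measurable_nn_integral_fst)
  finally show ?thesis .
qed

lemma fresh_integral:
  fixes \<phi> :: "_ \<Rightarrow> real"
  assumes X: "X \<in> measurable (hist J) N" and J: "J \<subseteq> K" and j: "j \<in> K" "j \<notin> J"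
    and s: "source j s P" and \<phi>: "\<phi> \<in> borel_measurable (N \<Otimes>\<^sub>M P)"
    and int: "integrable M (\<lambda>\<omega>. \<phi> (X \<omega>, s \<omega>))"
  shows "expectation (\<lambda>\<omega>. \<phi> (X \<omega>, s \<omega>)) = expectation (\<lambda>\<omega>. \<integral>a. \<phi> (X \<omega>, a) \<partial>distr M P s)"
proof -
  have [measurable]: "X \<in> measurable M N" "s \<in> measurable M P"
    using measurable_hist[OF J X] s by (auto simp: source_def)
  interpret X: prob_space "distr M N X" by (rule prob_space_distr) measurable
  interpret S: prob_space "distr M P s" by (rule prob_space_distr) measurable
  interpret XS: pair_sigma_finite "distr M N X" "distr M P s" ..
  have [measurable]: "\<phi> \<in> borel_measurable (N \<Otimes>\<^sub>M distr M P s)"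
    using \<phi> by simp
  have i: "integrable (distr M N X \<Otimes>\<^sub>M distr M P s) \<phi>"
    unfolding fresh_distr[OF X J j s, symmetric] using \<phi> int by (subst integrable_distr_eq) auto
  have "expectation (\<lambda>\<omega>. \<phi> (X \<omega>, s \<omega>)) = (\<integral>q. \<phi> q \<partial>distr M (N \<Otimes>\<^sub>M P) (\<lambda>\<omega>. (X \<omega>, s \<omega>)))"
    using \<phi> by (subst integral_distr) auto
  also have "\<dots> = (\<integral>q. \<phi> q \<partial>(distr M N X \<Otimes>\<^sub>M distr M P s))"
    by (simp add: fresh_distr[OF X J j s])
  also have "\<dots> = (\<integral>x. (\<integral>a. \<phi> (x, a) \<partial>distr M P s) \<partial>distr M N X)"
    by (rule XS.integral_fst'[OF i, symmetric])
  also have "\<dots> = expectation (\<lambda>\<omega>. \<integral>a. \<phi> (X \<omega>, a) \<partial>distr M P s)"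
    by (subst integral_distr) (auto intro!: S.borel_measurable_lebesgue_integral)
  finally show ?thesis .
qed

section \<open>Closure properties of square-integrable variables on a history\<close>

lemma L2D:
  assumes "L2 J X"
  shows "J \<subseteq> K" "X \<in> borel_measurable (hist J)" "X \<in> borel_measurable M"
    "integrable M (\<lambda>\<omega>. (norm (X \<omega>))\<^sup>2)"
  using assms measurable_hist by (auto simp: L2_def)

lemma L2_mono: "L2 J X \<Longrightarrow> J \<subseteq> J' \<Longrightarrow> J' \<subseteq> K \<Longrightarrow> L2 J' X"
  by (auto simp: L2_def intro: measurable_hist_mono)

lemma L2_dominated:
  assumes X: "X \<in> borel_measurable (hist J)" and J: "J \<subseteq> K"
    and Y: "integrable M Y" and le: "\<And>\<omega>. \<omega> \<in> space M \<Longrightarrow> (norm (X \<omega>))\<^sup>2 \<le> Y \<omega>"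
  shows "L2 J X"
proof -
  have [measurable]: "X \<in> borel_measurable M" by (rule measurable_hist[OF J X])
  have "integrable M (\<lambda>\<omega>. (norm (X \<omega>))\<^sup>2)"
    by (rule Bochner_Integration.integrable_bound[OF Y]) (use le in \<open>fastforce+\<close>)
  with X J show ?thesis by (simp add: L2_def)
qed

lemma L2_const: "J \<subseteq> K \<Longrightarrow> L2 J (\<lambda>_. c)"
  by (simp add: L2_def)

lemma L2_add: "L2 J X \<Longrightarrow> L2 J Y \<Longrightarrow> L2 J (\<lambda>\<omega>. X \<omega> + Y \<omega>)"
  by (rule L2_dominated[where Y = "\<lambda>\<omega>. 2 * (norm (X \<omega>))\<^sup>2 + 2 * (norm (Y \<omega>))\<^sup>2"])
     (auto simp: L2_def intro: norm_add_sq_le2)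

lemma L2_scaleR: "L2 J X \<Longrightarrow> L2 J (\<lambda>\<omega>. c *\<^sub>R X \<omega>)"
  by (auto simp: L2_def power_mult_distrib)

lemma L2_diff: "L2 J X \<Longrightarrow> L2 J Y \<Longrightarrow> L2 J (\<lambda>\<omega>. X \<omega> - Y \<omega>)"
  using L2_add[OF _ L2_scaleR[of J Y "-1"], of X] by simp

lemma L2_sum:
  assumes "\<And>i. i \<in> I \<Longrightarrow> L2 J (X i)" "J \<subseteq> K"
  shows "L2 J (\<lambda>\<omega>. \<Sum>i\<in>I. X i \<omega>)"
  using assms(1)
proof (induction I rule: infinite_finite_induct)
  case (insert i I)
  thus ?case using L2_add[of J "X i" "\<lambda>\<omega>. \<Sum>i\<in>I. X i \<omega>"] by simp
qed (simp_all add: L2_const[OF assms(2), of 0])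

text \<open>A Lipschitz map is continuous, hence Borel, and grows at most linearly away from its
  value at 0.\<close>

lemma L2_lipschitz:
  fixes h :: "'b::euclidean_space \<Rightarrow> 'b"
  assumes X: "L2 J X" and h: "\<And>x y. norm (h x - h y) \<le> L * norm (x - y)"
  shows "L2 J (\<lambda>\<omega>. h (X \<omega>))"
proof -
  have L: "0 \<le> L" by (rule lipschitz_const_nonneg[OF h])
  have "continuous_on UNIV h"
    by (rule lipschitz_on_continuous_on[of L]) (auto simp: lipschitz_on_def dist_norm h L)
  hence m: "h \<in> borel_measurable borel" by (rule borel_measurable_continuous_onI)
  show ?thesis
  proof (rule L2_dominated[where Y = "\<lambda>\<omega>. 2 * (L\<^sup>2 * (norm (X \<omega>))\<^sup>2) + 2 * (norm (h 0))\<^sup>2"])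
    show "(\<lambda>\<omega>. h (X \<omega>)) \<in> borel_measurable (hist J)"
      using measurable_compose[OF L2D(2)[OF X] m] .
    fix \<omega>
    have "(norm ((h (X \<omega>) - h 0) + h 0))\<^sup>2 \<le> 2 * (norm (h (X \<omega>) - h 0))\<^sup>2 + 2 * (norm (h 0))\<^sup>2"
      by (rule norm_add_sq_le2)
    moreover have "(norm (h (X \<omega>) - h 0))\<^sup>2 \<le> (L * norm (X \<omega> - 0))\<^sup>2"
      by (rule power_mono[OF h]) simp
    ultimately show "(norm (h (X \<omega>)))\<^sup>2 \<le> 2 * (L\<^sup>2 * (norm (X \<omega>))\<^sup>2) + 2 * (norm (h 0))\<^sup>2"
      by (simp add: power_mult_distrib)
  qed (use L2D[OF X] in auto)
qed

lemma L2_integrable_inner: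
  fixes X Y :: "'m \<Rightarrow> 'b::euclidean_space"
  assumes X: "L2 J X" and Y: "L2 J' Y"
  shows "integrable M (\<lambda>\<omega>. X \<omega> \<bullet> Y \<omega>)"
proof (rule Bochner_Integration.integrable_bound)
  show "integrable M (\<lambda>\<omega>. (norm (X \<omega>))\<^sup>2 + (norm (Y \<omega>))\<^sup>2)"
    using L2D(4)[OF X] L2D(4)[OF Y] by simp
  have [measurable]: "X \<in> borel_measurable M" "Y \<in> borel_measurable M"
    using L2D(3)[OF X] L2D(3)[OF Y] by auto
  show "(\<lambda>\<omega>. X \<omega> \<bullet> Y \<omega>) \<in> borel_measurable M" by measurable
  have "norm (x \<bullet> y) \<le> norm ((norm x)\<^sup>2 + (norm y)\<^sup>2)" for x y :: 'b
  proof -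
    have "norm (x \<bullet> y) \<le> norm x * norm y" using Cauchy_Schwarz_ineq2[of x y] by simp
    also have "\<dots> \<le> 2 * (norm x * norm y)" by simp
    also have "\<dots> \<le> (norm x)\<^sup>2 + (norm y)\<^sup>2" using sum_squares_bound[of "norm x" "norm y"] by simp
    finally show ?thesis by simp
  qed
  thus "AE \<omega> in M. norm (X \<omega> \<bullet> Y \<omega>) \<le> norm ((norm (X \<omega>))\<^sup>2 + (norm (Y \<omega>))\<^sup>2)" by simp
qed

lemma msq_add:
  assumes X: "L2 J X" and Y: "L2 J' Y"
  shows "msq (\<lambda>\<omega>. X \<omega> + Y \<omega>) = msq X + 2 * expectation (\<lambda>\<omega>. X \<omega> \<bullet> Y \<omega>) + msq Y"
proof -
  have "(norm (X \<omega> + Y \<omega>))\<^sup>2 = (norm (X \<omega>))\<^sup>2 + 2 * (X \<omega> \<bullet> Y \<omega>) + (norm (Y \<omega>))\<^sup>2" for \<omega>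
    by (simp only: power2_norm_eq_inner inner_add_left inner_add_right) (simp add: inner_commute)
  thus ?thesis using L2D(4)[OF X] L2D(4)[OF Y] L2_integrable_inner[OF X Y] by simp
qed

lemma msq_scaleR: "msq (\<lambda>\<omega>. c *\<^sub>R X \<omega>) = c\<^sup>2 * msq X"
  by (simp add: power_mult_distrib)

lemma msq_add_le:
  assumes X: "L2 J X" and Y: "L2 J' Y" and s: "s > 0"
  shows "msq (\<lambda>\<omega>. X \<omega> + Y \<omega>) \<le> (1 + s) * msq X + (1 + 1 / s) * msq Y"
proof -
  have [measurable]: "X \<in> borel_measurable M" "Y \<in> borel_measurable M"
    using L2D(3)[OF X] L2D(3)[OF Y] by auto
  have i: "integrable M (\<lambda>\<omega>. (1 + s) * (norm (X \<omega>))\<^sup>2 + (1 + 1 / s) * (norm (Y \<omega>))\<^sup>2)"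
    using L2D(4)[OF X] L2D(4)[OF Y] by simp
  have "msq (\<lambda>\<omega>. X \<omega> + Y \<omega>) \<le> expectation (\<lambda>\<omega>. (1 + s) * (norm (X \<omega>))\<^sup>2 + (1 + 1 / s) * (norm (Y \<omega>))\<^sup>2)"
    by (rule integral_mono'[OF i norm_add_sq_le[OF s]]) (use s in auto)
  also have "\<dots> = (1 + s) * msq X + (1 + 1 / s) * msq Y"
    using L2D(4)[OF X] L2D(4)[OF Y] by simp
  finally show ?thesis .
qed

text \<open>Only the second-moment bound is assumed, not the mean, so that the result covers both
  compressor classes: \<open>w\<close> is omega for the workers and 1 - alpha for the
  server.\<close>

lemma compressed_L2:
  fixes C :: "'s \<Rightarrow> 'b::euclidean_space \<Rightarrow> 'b"
  assumes X: "L2 J X" and j: "j \<in> K" "j \<notin> J" and s: "source j s P" and dP: "distr M P s = P"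
    and C: "(\<lambda>(a, x). C a x) \<in> borel_measurable (P \<Otimes>\<^sub>M borel)" and w: "w \<ge> 0"
    and var: "\<And>x. (\<integral>\<^sup>+ a. ennreal ((norm (C a x - x))\<^sup>2) \<partial>P) \<le> ennreal (w * (norm x)\<^sup>2)"
  shows "L2 (insert j J) (\<lambda>\<omega>. C (s \<omega>) (X \<omega>) - X \<omega>)"
    and "msq (\<lambda>\<omega>. C (s \<omega>) (X \<omega>) - X \<omega>) \<le> w * msq X"
proof -
  note J = L2D(1)[OF X] and Xm = L2D(2)[OF X]
  have jJ: "insert j J \<subseteq> K" using J j by auto
  have [measurable]: "s \<in> measurable (hist (insert j J)) P"
    by (rule measurable_source[OF s _ jJ]) simp
  have [measurable]: "X \<in> borel_measurable (hist (insert j J))"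
    by (rule measurable_hist_mono[OF Xm _ jJ]) auto
  have "(\<lambda>\<omega>. C (s \<omega>) (X \<omega>)) \<in> borel_measurable (hist (insert j J))"
    using measurable_compose[OF measurable_Pair C, of s "hist (insert j J)" X] by simp
  hence m: "(\<lambda>\<omega>. C (s \<omega>) (X \<omega>) - X \<omega>) \<in> borel_measurable (hist (insert j J))"
    by measurable
  have mM: "(\<lambda>\<omega>. C (s \<omega>) (X \<omega>) - X \<omega>) \<in> borel_measurable M"
    by (rule measurable_hist[OF jJ m])
  let ?phi = "\<lambda>(x, a). ennreal ((norm (C a x - x))\<^sup>2)"
  have "(\<lambda>q. C (snd q) (fst q)) \<in> borel_measurable (borel \<Otimes>\<^sub>M P)"
    using measurable_compose[OF measurable_Pair C, of snd "borel \<Otimes>\<^sub>M P" fst] by simp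
  hence phi: "?phi \<in> borel_measurable (borel \<Otimes>\<^sub>M P)"
    unfolding case_prod_beta by measurable
  have "(\<integral>\<^sup>+ \<omega>. ennreal ((norm (C (s \<omega>) (X \<omega>) - X \<omega>))\<^sup>2) \<partial>M)
      = (\<integral>\<^sup>+ \<omega>. (\<integral>\<^sup>+ a. ennreal ((norm (C a (X \<omega>) - X \<omega>))\<^sup>2) \<partial>P) \<partial>M)"
    using fresh_nn_integral[OF Xm J j s phi] by (simp add: dP)
  also have "\<dots> \<le> (\<integral>\<^sup>+ \<omega>. ennreal (w * (norm (X \<omega>))\<^sup>2) \<partial>M)"
    by (intro nn_integral_mono var)
  also have "\<dots> = ennreal (w * msq X)"
    using L2D(4)[OF X] w by (subst nn_integral_eq_integral) auto
  finally have le: "(\<integral>\<^sup>+ \<omega>. ennreal ((norm (C (s \<omega>) (X \<omega>) - X \<omega>))\<^sup>2) \<partial>M) \<le> ennreal (w * msq X)" .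
  have i: "integrable M (\<lambda>\<omega>. (norm (C (s \<omega>) (X \<omega>) - X \<omega>))\<^sup>2)"
  proof (rule integrableI_bounded)
    show "(\<lambda>\<omega>. (norm (C (s \<omega>) (X \<omega>) - X \<omega>))\<^sup>2) \<in> borel_measurable M" using mM by measurable
    have "ennreal (w * msq X) < \<infinity>" by simp
    with le have "(\<integral>\<^sup>+ \<omega>. ennreal ((norm (C (s \<omega>) (X \<omega>) - X \<omega>))\<^sup>2) \<partial>M) < \<infinity>"
      by (rule le_less_trans)
    thus "(\<integral>\<^sup>+ \<omega>. ennreal (norm ((norm (C (s \<omega>) (X \<omega>) - X \<omega>))\<^sup>2)) \<partial>M) < \<infinity>"
      by simp
  qed
  with jJ m show "L2 (insert j J) (\<lambda>\<omega>. C (s \<omega>) (X \<omega>) - X \<omega>)" by (simp add: L2_def)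
  have "ennreal (msq (\<lambda>\<omega>. C (s \<omega>) (X \<omega>) - X \<omega>)) \<le> ennreal (w * msq X)"
    using le i by (subst (asm) nn_integral_eq_integral) auto
  moreover have "0 \<le> w * msq X" using w by simp
  ultimately show "msq (\<lambda>\<omega>. C (s \<omega>) (X \<omega>) - X \<omega>) \<le> w * msq X" by simp
qed

text \<open>Freezing \<open>X\<close> and \<open>Y\<close> together as a pair leaves an inner
  integral that vanishes by unbiasedness. \<open>Y\<close> may be correlated with \<open>X\<close>;
  it only has to be known before the seed.\<close>

lemma unbiased_noise_orthogonal:
  fixes C :: "'s \<Rightarrow> 'b::euclidean_space \<Rightarrow> 'b"
  assumes X: "L2 J X" and Y: "L2 J Y" and j: "j \<in> K" "j \<notin> J" and s: "source j s P"
    and dP: "distr M P s = P" and C: "unbiased_compressor P C w" and w: "w \<ge> 0"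
  shows "expectation (\<lambda>\<omega>. (C (s \<omega>) (X \<omega>) - X \<omega>) \<bullet> Y \<omega>) = 0"
proof -
  have Cm: "(\<lambda>(a, x). C a x) \<in> borel_measurable (P \<Otimes>\<^sub>M borel)"
    and mean: "\<And>x. integrable P (\<lambda>a. C a x)" "\<And>x. (\<integral>a. C a x \<partial>P) = x" and P: "prob_space P"
    and var: "\<And>x. (\<integral>\<^sup>+ a. ennreal ((norm (C a x - x))\<^sup>2) \<partial>P) \<le> ennreal (w * (norm x)\<^sup>2)"
    using C by (auto simp: unbiased_compressor_def)
  interpret P: prob_space P by fact
  let ?phi = "\<lambda>(q, a). (C a (fst q) - fst q) \<bullet> snd q"
  have "(\<lambda>q. C (snd q) (fst (fst q))) \<in> borel_measurable ((borel \<Otimes>\<^sub>M borel) \<Otimes>\<^sub>M P)"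
    using measurable_compose[OF measurable_Pair Cm, of snd "(borel \<Otimes>\<^sub>M borel) \<Otimes>\<^sub>M P" "\<lambda>q. fst (fst q)"]
    by simp
  hence phi: "?phi \<in> borel_measurable ((borel \<Otimes>\<^sub>M borel) \<Otimes>\<^sub>M P)"
    unfolding case_prod_beta by measurable
  have XY: "(\<lambda>\<omega>. (X \<omega>, Y \<omega>)) \<in> measurable (hist J) (borel \<Otimes>\<^sub>M borel)"
    using L2D(2)[OF X] L2D(2)[OF Y] by measurable
  have int: "integrable M (\<lambda>\<omega>. ?phi ((X \<omega>, Y \<omega>), s \<omega>))"
    using L2_integrable_inner[OF compressed_L2(1)[OF X j s dP Cm w var] Y] by simp
  have z: "(\<integral>a. (C a x - x) \<bullet> y \<partial>P) = 0" for x y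
    using mean[of x] by (simp add: P.prob_space)
  show ?thesis
    using fresh_integral[OF XY L2D(1)[OF X] j s phi int] by (simp add: dP z)
qed

text \<open>Both branches are frozen as a pair, so they may depend on each other and on the whole
  history; only the choice between them is averaged.\<close>

lemma fresh_coin:
  fixes \<phi> \<psi> :: "'m \<Rightarrow> real"
  assumes \<phi>: "\<phi> \<in> borel_measurable (hist J)" "integrable M \<phi>"
    and \<psi>: "\<psi> \<in> borel_measurable (hist J)" "integrable M \<psi>"
    and J: "J \<subseteq> K" and j: "j \<in> K" "j \<notin> J" and c: "source j c (count_space UNIV)"
    and p: "prob {\<omega> \<in> space M. c \<omega>} = p"
  shows "integrable M (\<lambda>\<omega>. if c \<omega> then \<phi> \<omega> else \<psi> \<omega>)"
    and "expectation (\<lambda>\<omega>. if c \<omega> then \<phi> \<omega> else \<psi> \<omega>) = p * expectation \<phi> + (1 - p) * expectation \<psi>"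
proof -
  have [measurable]: "c \<in> measurable M (count_space UNIV)" using c by (simp add: source_def)
  have [measurable]: "\<phi> \<in> borel_measurable M" "\<psi> \<in> borel_measurable M"
    using measurable_hist[OF J] \<phi> \<psi> by auto
  show i: "integrable M (\<lambda>\<omega>. if c \<omega> then \<phi> \<omega> else \<psi> \<omega>)"
    by (rule Bochner_Integration.integrable_bound[of M "\<lambda>\<omega>. \<bar>\<phi> \<omega>\<bar> + \<bar>\<psi> \<omega>\<bar>"])
       (use \<phi> \<psi> in auto)
  let ?phi = "\<lambda>(q, b). if b then fst q else snd q :: real"
  have XY: "(\<lambda>\<omega>. (\<phi> \<omega>, \<psi> \<omega>)) \<in> measurable (hist J) (borel \<Otimes>\<^sub>M borel)"
    using \<phi> \<psi> by measurable
  have phi: "?phi \<in> borel_measurable ((borel \<Otimes>\<^sub>M borel) \<Otimes>\<^sub>M count_space UNIV)"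
    unfolding case_prod_beta by measurable
  have e: "(\<integral>b. (if b then x else y) \<partial>distr M (count_space UNIV) c) = p * x + (1 - p) * y" for x y :: real
  proof -
    have "(\<integral>b. (if b then x else y) \<partial>distr M (count_space UNIV) c)
        = expectation (\<lambda>\<omega>. if c \<omega> then x else y)"
      by (subst integral_distr) auto
    also have "\<dots> = expectation (\<lambda>\<omega>. y + (x - y) * indicator {\<omega> \<in> space M. c \<omega>} \<omega>)"
      by (intro Bochner_Integration.integral_cong) (auto simp: indicator_def)
    also have "\<dots> = y + (x - y) * p"
      using p by (subst Bochner_Integration.integral_add) (auto simp: prob_space less_top[symmetric])
    finally show ?thesis by (simp add: algebra_simps)
  qed
  have "integrable M (\<lambda>\<omega>. ?phi ((\<phi> \<omega>, \<psi> \<omega>), c \<omega>))" using i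
    by (simp cong: if_cong)
  from fresh_integral[OF XY J j c phi this]
  show "expectation (\<lambda>\<omega>. if c \<omega> then \<phi> \<omega> else \<psi> \<omega>) = p * expectation \<phi> + (1 - p) * expectation \<psi>"
    using \<phi> \<psi> by (simp add: e cong: if_cong)
qed

lemma L2_coin:
  assumes X: "L2 J X" and Y: "L2 J Y" and j: "j \<in> K" and c: "source j c (count_space UNIV)"
  shows "L2 (insert j J) (\<lambda>\<omega>. if c \<omega> then X \<omega> else Y \<omega>)"
proof (rule L2_dominated[where Y = "\<lambda>\<omega>. (norm (X \<omega>))\<^sup>2 + (norm (Y \<omega>))\<^sup>2"])
  show jJ: "insert j J \<subseteq> K" using L2D(1)[OF X] j by auto
  have [measurable]: "c \<in> measurable (hist (insert j J)) (count_space UNIV)"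
    by (rule measurable_source[OF c _ jJ]) simp
  have [measurable]: "X \<in> borel_measurable (hist (insert j J))" "Y \<in> borel_measurable (hist (insert j J))"
    using L2D(2)[OF L2_mono[OF X _ jJ]] L2D(2)[OF L2_mono[OF Y _ jJ]] by auto
  show "(\<lambda>\<omega>. if c \<omega> then X \<omega> else Y \<omega>) \<in> borel_measurable (hist (insert j J))" by measurable
qed (use L2D(4)[OF X] L2D(4)[OF Y] in auto)

lemma msq_coin:
  assumes X: "L2 J X" and Y: "L2 J Y" and j: "j \<in> K" "j \<notin> J" and c: "source j c (count_space UNIV)"
    and p: "prob {\<omega> \<in> space M. c \<omega>} = p"
  shows "msq (\<lambda>\<omega>. if c \<omega> then X \<omega> else Y \<omega>) = p * msq X + (1 - p) * msq Y"
proof -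
  have [measurable]: "X \<in> borel_measurable (hist J)" "Y \<in> borel_measurable (hist J)"
    using L2D(2)[OF X] L2D(2)[OF Y] by auto
  have "msq (\<lambda>\<omega>. if c \<omega> then X \<omega> else Y \<omega>)
      = expectation (\<lambda>\<omega>. if c \<omega> then (norm (X \<omega>))\<^sup>2 else (norm (Y \<omega>))\<^sup>2)"
    by (intro Bochner_Integration.integral_cong) auto
  also have "\<dots> = p * msq X + (1 - p) * msq Y"
    using L2D(4)[OF X] L2D(4)[OF Y]
    by (intro fresh_coin(2)[OF _ _ _ _ L2D(1)[OF X] j c p]) auto
  finally show ?thesis .
qed

text \<open>The seeds are revealed one after another, so that each new noise term is orthogonal to the sum of the earlier ones.\<close>
lemma unbiased_noise_sum:
  fixes C :: "nat \<Rightarrow> 's \<Rightarrow> 'b::euclidean_space \<Rightarrow> 'b" and j :: "nat \<Rightarrow> 'j"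
  assumes J: "J \<subseteq> K" and X: "\<And>i. i < n \<Longrightarrow> L2 J (X i)"
    and j: "\<And>i. i < n \<Longrightarrow> j i \<in> K - J" "inj_on j {..<n}"
    and s: "\<And>i. i < n \<Longrightarrow> source (j i) (s i) (P i)" "\<And>i. i < n \<Longrightarrow> distr M (P i) (s i) = P i"
    and C: "\<And>i. i < n \<Longrightarrow> unbiased_compressor (P i) (C i) w" and w: "w \<ge> 0"
  defines "N \<equiv> \<lambda>i \<omega>. C i (s i \<omega>) (X i \<omega>) - X i \<omega>"
  shows "\<And>i. i < n \<Longrightarrow> L2 (J \<union> j ` {..<n}) (N i)"
    and "\<And>i. i < n \<Longrightarrow> msq (N i) \<le> w * msq (X i)"
    and "\<And>i Y. i < n \<Longrightarrow> L2 J Y \<Longrightarrow> expectation (\<lambda>\<omega>. N i \<omega> \<bullet> Y \<omega>) = 0"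
    and "L2 (J \<union> j ` {..<n}) (\<lambda>\<omega>. \<Sum>i<n. N i \<omega>)"
    and "\<And>Y. L2 J Y \<Longrightarrow> expectation (\<lambda>\<omega>. (\<Sum>i<n. N i \<omega>) \<bullet> Y \<omega>) = 0"
    and "msq (\<lambda>\<omega>. \<Sum>i<n. N i \<omega>) \<le> w * (\<Sum>i<n. msq (X i))"
proof -
  have Jn: "J \<union> j ` A \<subseteq> K" if "A \<subseteq> {..<n}" for A using J j that by auto
  have Cm: "(\<lambda>(a, x). C i a x) \<in> borel_measurable (P i \<Otimes>\<^sub>M borel)"
    and var: "(\<integral>\<^sup>+ a. ennreal ((norm (C i a x - x))\<^sup>2) \<partial>P i) \<le> ennreal (w * (norm x)\<^sup>2)"
    if "i < n" for i x
    using C[OF that] by (auto simp: unbiased_compressor_def)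
  have N1: "L2 (insert (j i) J) (N i)" and N2: "msq (N i) \<le> w * msq (X i)" if i: "i < n" for i
    using compressed_L2[OF X[OF i] _ _ s(1)[OF i] s(2)[OF i] Cm[OF i] w var[OF i]] j(1)[OF i]
    by (auto simp: N_def)
  show "msq (N i) \<le> w * msq (X i)" if "i < n" for i by (rule N2[OF that])
  have N: "L2 (J \<union> j ` A) (N i)" if "i \<in> A" "A \<subseteq> {..<n}" for A i
    by (rule L2_mono[OF N1]) (use that Jn[OF that(2)] in auto)
  show NL: "L2 (J \<union> j ` {..<n}) (N i)" if "i < n" for i using N[of i "{..<n}"] that by simp
  have ortho: "expectation (\<lambda>\<omega>. N i \<omega> \<bullet> Y \<omega>) = 0"
    if i: "i < n" and Y: "L2 (J \<union> j ` A) Y" and A: "A \<subseteq> {..<n}" "i \<notin> A" for i Y A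
  proof -
    have "j i \<notin> J \<union> j ` A" using j(1)[OF i] inj_onD[OF j(2)] i A by auto
    thus ?thesis unfolding N_def
      using unbiased_noise_orthogonal[OF L2_mono[OF X[OF i]] Y _ _ s(1)[OF i] s(2)[OF i] C[OF i] w]
        Jn[OF A(1)] j(1)[OF i] by auto
  qed
  show o1: "expectation (\<lambda>\<omega>. N i \<omega> \<bullet> Y \<omega>) = 0" if "i < n" "L2 J Y" for i Y
    using ortho[of i "{}" Y] that by simp
  show S: "L2 (J \<union> j ` {..<n}) (\<lambda>\<omega>. \<Sum>i<n. N i \<omega>)"
    by (rule L2_sum) (use NL Jn[of "{..<n}"] in auto)
  show "expectation (\<lambda>\<omega>. (\<Sum>i<n. N i \<omega>) \<bullet> Y \<omega>) = 0" if Y: "L2 J Y" for Y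
    unfolding inner_sum_left
    by (subst Bochner_Integration.integral_sum) (auto simp: L2_integrable_inner[OF NL Y] o1[OF _ Y])
  have "msq (\<lambda>\<omega>. \<Sum>i<k. N i \<omega>) \<le> w * (\<Sum>i<k. msq (X i))" if "k \<le> n" for k
    using that
  proof (induction k)
    case (Suc k)
    have Sk: "L2 (J \<union> j ` {..<k}) (\<lambda>\<omega>. \<Sum>i<k. N i \<omega>)"
      by (rule L2_sum) (use N[of _ "{..<k}"] Jn[of "{..<k}"] Suc.prems in auto)
    have k: "k < n" using Suc.prems by simp
    have "msq (\<lambda>\<omega>. N k \<omega> + (\<Sum>i<k. N i \<omega>))
        = msq (N k) + 2 * expectation (\<lambda>\<omega>. N k \<omega> \<bullet> (\<Sum>i<k. N i \<omega>)) + msq (\<lambda>\<omega>. \<Sum>i<k. N i \<omega>)"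
      by (rule msq_add[OF NL[OF k] Sk])
    moreover have "expectation (\<lambda>\<omega>. N k \<omega> \<bullet> (\<Sum>i<k. N i \<omega>)) = 0"
      by (rule ortho[OF k Sk]) (use k in auto)
    ultimately show ?case using Suc N2[OF k] by (simp add: add.commute distrib_left)
  qed simp
  thus "msq (\<lambda>\<omega>. \<Sum>i<n. N i \<omega>) \<le> w * (\<Sum>i<n. msq (X i))" by blast
qed

end

subsection \<open>Weights of the Lyapunov function\<close>

text \<open>The six smallness conditions are the entries of the maximum defining
  \<open>Lbar\<close>, divided by \<open>Lbar\<close>. The two entries with square roots are
  squared, so that all later arithmetic is rational.\<close>

locale step_constants =
  fixes L Lmax Lbar omega alpha beta tau p n :: real
  assumes nonneg: "L \<ge> 0" "Lmax \<ge> 0" "omega \<ge> 0" and pos: "Lbar > 0" "n > 0" "p > 0"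
    and alpha: "0 < alpha" "alpha \<le> 1" and beta: "0 < beta" "beta \<le> 1" and tau: "0 < tau" "tau \<le> 1"
    and small_L: "L / (alpha * Lbar) \<le> 1 / 660508" "L * p / (alpha * tau * Lbar) \<le> 1 / 660508"
    and small_LL: "L * Lmax * p\<^sup>2 * omega * tau / (alpha\<^sup>2 * beta\<^sup>2 * n * Lbar\<^sup>2) \<le> (1 / 660508)\<^sup>2"
      "L * Lmax * p * omega * tau / (alpha\<^sup>2 * beta * n * Lbar\<^sup>2) \<le> (1 / 660508)\<^sup>2"
    and small_Lmax: "Lmax * omega * p\<^sup>2 / (beta\<^sup>2 * n * Lbar) \<le> 1 / 660508"
      "Lmax * omega / (n * Lbar) \<le> 1 / 660508"
begin

text \<open>The weights are solved for backwards from the one-step estimate. With \<open>nu\<close>,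
  the part alpha / 4 of the contraction of |w - u|^2 pays for 2 p L th^2 |w - u|^2; with
  \<open>rho\<close>, the part p / 2 pays for the error of k inside |w - u|^2; with
  \<open>lam\<close>, the part tau / 4 pays for 2 p rho times the error of v; with
  \<open>kappa\<close>, the part beta / 4 pays for the shift error in the noise. \<open>cH\<close>
  is the weight with which that noise enters through v. The products \<open>p * cB\<close> and
  \<open>p * cG\<close> are the total coefficients of the gradient jumps \<open>B1\<close> and
  \<open>G\<close> below.\<close>

definition rho :: real where "rho = 64 * L / (alpha\<^sup>2 * Lbar\<^sup>2)"
definition lam :: real where "lam = 8 * p * rho / tau"
definition cH :: real where "cH = lam * tau\<^sup>2 * omega / n"
definition kappa :: real where "kappa = 4 / beta * (3 * omega * p / (n * Lbar) + 2 * cH)"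
definition nu :: "real \<Rightarrow> real" where "nu th = 8 * p * L / alpha * th\<^sup>2"
definition cB :: real where "cB = 2 * rho + lam * (1 + 2 * p / tau)"
definition cG :: real where "cG = 2 * cH + kappa * (1 + 2 * p / beta)"

lemma weights_nonneg: "rho \<ge> 0" "lam \<ge> 0" "cH \<ge> 0" "kappa \<ge> 0" "nu th \<ge> 0" "cB \<ge> 0" "cG \<ge> 0"
proof -
  show r: "rho \<ge> 0" unfolding rho_def using nonneg by simp
  show l: "lam \<ge> 0" unfolding lam_def using r pos tau by simp
  show c: "cH \<ge> 0" unfolding cH_def using l nonneg pos by simp
  show k: "kappa \<ge> 0" unfolding kappa_def using c nonneg pos beta by simp
  show "nu th \<ge> 0" unfolding nu_def using nonneg pos alpha by simp
  show "cB \<ge> 0" unfolding cB_def using r l pos tau by simp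
  show "cG \<ge> 0" unfolding cG_def using c k pos beta by simp
qed

lemma rho_L_le: "rho * L \<le> 1 / 100000"
proof -
  define a where "a = L / (alpha * Lbar)"
  have a: "0 \<le> a" "a \<le> 1 / 660508"
    using small_L(1) nonneg pos alpha by (auto simp: a_def)
  have "rho * L = 64 * a\<^sup>2" by (simp add: rho_def a_def power_divide power_mult_distrib) (simp add: power2_eq_square)
  also have "a\<^sup>2 \<le> (1 / 660508)\<^sup>2" using a by (intro power_mono) auto
  finally show ?thesis by (simp add: power2_eq_square)
qed

text \<open>Expanding the weights turns the left side into a combination of products of the
  normalized entries of the maximum: \<open>a\<close> and \<open>b\<close> enter quadratically,
  \<open>r1\<close> and \<open>r2\<close> are already squares, and \<open>s1\<close> and
  \<open>s2\<close> enter linearly.\<close>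

lemma gradient_difference_weight_le: "cB * (4 * L) + cG * (4 * Lmax) \<le> 1 / 8"
proof -
  define a where "a = L / (alpha * Lbar)"
  define b where "b = L * p / (alpha * tau * Lbar)"
  define r1 where "r1 = L * Lmax * p\<^sup>2 * omega * tau / (alpha\<^sup>2 * beta\<^sup>2 * n * Lbar\<^sup>2)"
  define r2 where "r2 = L * Lmax * p * omega * tau / (alpha\<^sup>2 * beta * n * Lbar\<^sup>2)"
  define s1 where "s1 = Lmax * omega * p\<^sup>2 / (beta\<^sup>2 * n * Lbar)"
  define s2 where "s2 = Lmax * omega / (n * Lbar)"
  have a: "0 \<le> a" "a \<le> 1 / 660508" and b: "0 \<le> b" "b \<le> 1 / 660508"
    using small_L nonneg pos alpha tau by (auto simp: a_def b_def)
  have r: "0 \<le> r1" "r1 \<le> (1 / 660508)\<^sup>2" "0 \<le> r2" "r2 \<le> (1 / 660508)\<^sup>2"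
    using small_LL nonneg pos alpha tau beta by (auto simp: r1_def r2_def)
  have s: "s1 \<le> 1 / 660508" "s2 \<le> 1 / 660508" "0 \<le> s2"
    using small_Lmax nonneg pos by (auto simp: s1_def s2_def)
  have B: "cB * (4 * L) = 512 * (a * a) + 2048 * (a * b) + 4096 * (b * b)"
    unfolding cB_def lam_def rho_def a_def b_def using pos alpha tau
    by (simp add: field_simps power2_eq_square)
  have H: "cH * (8 * Lmax) = 4096 * (beta * r2)"
    unfolding cH_def lam_def rho_def r2_def using pos alpha tau beta
    by (simp add: field_simps power2_eq_square)
  have K: "kappa * (1 + 2 * p / beta) * (4 * Lmax)
      = 48 * (s2 * (p / beta)) + 96 * s1 + 16384 * r2 + 32768 * r1"
    unfolding kappa_def cH_def lam_def rho_def r1_def r2_def s1_def s2_def using pos alpha tau beta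
    by (simp add: field_simps power2_eq_square)
  have s12: "s2 * (p / beta)\<^sup>2 = s1" unfolding s1_def s2_def by (simp add: power_divide)
  \<comment> \<open>The mixed term with p / beta to the first power is not an entry of the maximum.
    It is the geometric mean of \<open>s1\<close> and \<open>s2\<close>, hence at most their
    arithmetic mean.\<close>
  have "s2 * (2 * (p / beta)) \<le> s2 * (1 + (p / beta)\<^sup>2)"
    using sum_squares_bound[of 1 "p / beta"] s(3) by (intro mult_left_mono) auto
  hence "s2 * (p / beta) \<le> (s2 + s1) / 2" using s12 by (simp add: algebra_simps)
  moreover have "a * a \<le> (1 / 660508) * (1 / 660508)" "a * b \<le> (1 / 660508) * (1 / 660508)"
    "b * b \<le> (1 / 660508) * (1 / 660508)"
    by (intro mult_mono a b; simp)+
  moreover have "beta * r2 \<le> 1 * r2" using beta r by (intro mult_right_mono) auto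
  moreover have "cB * (4 * L) + cG * (4 * Lmax)
      = cB * (4 * L) + cH * (8 * Lmax) + kappa * (1 + 2 * p / beta) * (4 * Lmax)"
    by (simp add: cG_def algebra_simps)
  ultimately show ?thesis unfolding B H K using r s by (simp add: power2_eq_square)
qed

text \<open>Pure arithmetic, free of probability. \<open>f\<close>, \<open>H\<close>,
  \<open>W\<close>, \<open>Kk\<close>, \<open>Nv\<close> stand for the potentials and
  \<open>U\<close> for the squared distance to the minimizer, primes for the next iteration.
  \<open>D\<close> is the Bregman divergence between z and y, \<open>Xi\<close> the variance of the
  gradient estimate, \<open>V\<close> is |u' - u|^2, \<open>Q\<close> is |u' - w|^2, and
  \<open>B1\<close>, \<open>G\<close> are the gradient jumps. The proof adds the weighted recursions
  and compares the coefficients one quantity at a time.\<close>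

lemma lyapunov_step:
  fixes mu A th th' :: real
  assumes mu: "mu \<ge> 0" and th: "0 < th" "th \<le> 1 / 4" "0 \<le> th'" "th' \<le> th"
    and pth: "p * th \<le> alpha / 4" "p * th \<le> tau / 4" "p * th \<le> beta / 4"
    and A: "A \<ge> Lbar * th"
    and ge0: "D \<ge> 0" "H \<ge> 0" "W \<ge> 0" "Kk \<ge> 0" "Nv \<ge> 0" "V \<ge> 0" "Q \<ge> 0" "Xi \<ge> 0" "W' \<ge> 0"
    and f': "f' = p * fx + (1 - p) * f"
    and fx: "fx \<le> (1 - th) * (f - D) + th * (A / 2 * U - (A + mu) / 2 * U' - A / 2 * V)
        + th * Xi / (A + mu) + L / 2 * th\<^sup>2 * Q"
    and Xi: "Xi \<le> 2 * omega / n * H + 4 * omega * Lmax / n * D"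
    and Q: "Q \<le> 2 * V + 2 * W"
    and W': "W' \<le> (1 - alpha / 2) * W + 2 / alpha / (A + mu)\<^sup>2 * (2 * Kk + 4 * L * D) + Xi / (A + mu)\<^sup>2"
    and K': "K' \<le> (1 - p) * Kk + p * (2 * Nv + 2 * B1)"
    and B1: "B1 \<le> 2 * L\<^sup>2 * th\<^sup>2 * Q + 4 * L * D"
    and N': "N' \<le> (1 - tau / 2) * Nv + p * (1 + 2 * p / tau) * B1 + tau\<^sup>2 * omega / n * (2 * H + 2 * p * G)"
    and H': "H' \<le> (1 - beta / 2) * H + p * (1 + 2 * p / beta) * G"
    and G: "G \<le> 2 * Lmax * L * th\<^sup>2 * Q + 4 * Lmax * D"
  shows "f' + kappa * H' + nu th' * W' + rho * K' + lam * N' + p * th * ((A + mu) / 2) * U'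
     \<le> (1 - p * th) * (f + kappa * H + nu th * W + rho * Kk + lam * Nv) + p * th * (A / 2) * U"
proof -
  define a where "a = L / (alpha * Lbar)"
  define s2 where "s2 = Lmax * omega / (n * Lbar)"
  define T where "T = L * th\<^sup>2 * Q / 2"
  define R where "R = D + L * th\<^sup>2 * Q / 2"
  have a: "0 \<le> a" "a \<le> 1 / 660508" using small_L(1) nonneg pos alpha by (auto simp: a_def)
  have s2: "0 \<le> s2" "s2 \<le> 1 / 660508" using small_Lmax nonneg pos by (auto simp: s2_def)
  have Am: "A + mu \<ge> Lbar * th" "Lbar * th > 0" using A mu pos th by auto
  hence Am0: "A + mu > 0" by linarith
  have thA: "th / (A + mu) \<le> 1 / Lbar"
    using Am Am0 pos by (simp add: field_simps)
  have thA2: "th\<^sup>2 / (A + mu)\<^sup>2 \<le> 1 / Lbar\<^sup>2"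
  proof -
    have "(th / (A + mu))\<^sup>2 \<le> (1 / Lbar)\<^sup>2" using thA th Am0 by (intro power_mono) auto
    thus ?thesis by (simp add: power_divide)
  qed
  have R0: "R \<ge> 0" using ge0 nonneg by (simp add: R_def)
  have t2: "p * fx \<le> p * (1 - th) * (f - D) + p * th * (A / 2) * U - p * th * ((A + mu) / 2) * U'
      - p * th * (A / 2) * V + p * (Xi / Lbar) + p * (L * th\<^sup>2 * Q / 2)"
  proof -
    have "th * Xi / (A + mu) \<le> Xi / Lbar"
      using mult_right_mono[OF thA ge0(8)] by simp
    hence "p * fx \<le> p * ((1 - th) * (f - D) + th * (A / 2 * U - (A + mu) / 2 * U' - A / 2 * V)
        + Xi / Lbar + L / 2 * th\<^sup>2 * Q)"
      using fx pos by (intro mult_left_mono) auto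
    thus ?thesis by (simp add: algebra_simps)
  qed
  \<comment> \<open>The factor th^2 in \<open>nu\<close> cancels 1 / (A + mu)^2 up to 1 / Lbar^2.
    This is why the incoming terms have coefficients independent of the iteration and
    \<open>rho\<close> can be a constant.\<close>
  have t3: "nu th' * W' \<le> nu th * ((1 - alpha / 2) * W) + p * (rho / 2) * Kk + p * (rho * L) * D
      + 8 * p * a * (Xi / Lbar)"
  proof -
    have e: "2 / alpha / (A + mu)\<^sup>2 * (2 * Kk + 4 * L * D) + Xi / (A + mu)\<^sup>2
        = (2 / alpha * (2 * Kk + 4 * L * D) + Xi) / (A + mu)\<^sup>2"
      by (simp add: add_divide_distrib)
    define y where "y = 2 / alpha * (2 * Kk + 4 * L * D) + Xi"
    have y: "y \<ge> 0" using ge0 nonneg alpha by (simp add: y_def)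
    have "nu th' \<le> nu th" unfolding nu_def
      using th nonneg pos alpha by (intro mult_left_mono power_mono) auto
    hence "nu th' * W' \<le> nu th * W'" using ge0 by (intro mult_right_mono)
    also have "\<dots> \<le> nu th * ((1 - alpha / 2) * W + y / (A + mu)\<^sup>2)"
      using W' weights_nonneg(5)[of th] e unfolding y_def[symmetric]
      by (intro mult_left_mono) auto
    also have "\<dots> = nu th * ((1 - alpha / 2) * W) + 8 * p * L / alpha * y * (th\<^sup>2 / (A + mu)\<^sup>2)"
      by (simp add: nu_def distrib_left)
    also have "8 * p * L / alpha * y * (th\<^sup>2 / (A + mu)\<^sup>2) \<le> 8 * p * L / alpha * y * (1 / Lbar\<^sup>2)"
      using thA2 y pos nonneg alpha by (intro mult_left_mono) auto
    also have "\<dots> = p * (rho / 2) * Kk + p * (rho * L) * D + 8 * p * a * (Xi / Lbar)"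
      unfolding y_def rho_def a_def using pos alpha by (simp add: field_simps power2_eq_square)
    finally show ?thesis by (simp add: algebra_simps)
  qed
  \<comment> \<open>The noise enters twice, through the objective with weight 1 and through |w -
    u|^2 with weight 8 a; the second is negligible, and 3/2 bounds both.\<close>
  have t4: "(1 + 8 * a) * (Xi / Lbar) \<le> 3 * omega / (n * Lbar) * H + 6 * s2 * D"
  proof -
    have "(1 + 8 * a) * (Xi / Lbar) \<le> 3 / 2 * (Xi / Lbar)"
      using a ge0 pos by (intro mult_right_mono) auto
    also have "\<dots> \<le> 3 / 2 * ((2 * omega / n * H + 4 * omega * Lmax / n * D) / Lbar)"
      using Xi pos by (intro mult_left_mono divide_right_mono) auto
    also have "\<dots> = 3 * omega / (n * Lbar) * H + 6 * s2 * D"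
      using pos by (simp add: s2_def field_simps)
    finally show ?thesis .
  qed
  have t4': "p * ((1 + 8 * a) * (Xi / Lbar)) \<le> p * (3 * omega / (n * Lbar) * H + 6 * s2 * D)"
    using t4 pos by (intro mult_left_mono) auto
  have t5: "rho * K' \<le> rho * ((1 - p) * Kk + p * (2 * Nv + 2 * B1))"
    using K' weights_nonneg by (intro mult_left_mono)
  have t6: "lam * N' \<le> lam * ((1 - tau / 2) * Nv) + p * (lam * (1 + 2 * p / tau)) * B1 + cH * (2 * H + 2 * p * G)"
  proof -
    have "lam * N' \<le> lam * ((1 - tau / 2) * Nv + p * (1 + 2 * p / tau) * B1 + tau\<^sup>2 * omega / n * (2 * H + 2 * p * G))"
      using N' weights_nonneg by (intro mult_left_mono)
    also have "\<dots> = lam * ((1 - tau / 2) * Nv) + p * (lam * (1 + 2 * p / tau)) * B1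
        + (lam * tau\<^sup>2 * omega / n) * (2 * H + 2 * p * G)"
      by (simp add: algebra_simps add_divide_distrib)
    finally show ?thesis by (simp only: cH_def)
  qed
  have t7: "kappa * H' \<le> kappa * ((1 - beta / 2) * H + p * (1 + 2 * p / beta) * G)"
    using H' weights_nonneg by (intro mult_left_mono)
  \<comment> \<open>\<open>R\<close> is the common factor of both jump bounds: they are exactly 4 L
    R and 4 Lmax R, so a single bound on the combined weights handles them.\<close>
  have BG: "p * (cB * B1 + cG * G) \<le> p * (R / 8)"
  proof (rule mult_left_mono)
    have "cB * B1 \<le> cB * (4 * L * R)"
      by (rule mult_left_mono) (use B1 weights_nonneg in \<open>auto simp: R_def algebra_simps power2_eq_square\<close>)
    moreover have "cG * G \<le> cG * (4 * Lmax * R)"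
      by (rule mult_left_mono) (use G weights_nonneg in \<open>auto simp: R_def algebra_simps power2_eq_square\<close>)
    moreover have "(cB * (4 * L) + cG * (4 * Lmax)) * R \<le> 1 / 8 * R"
      using gradient_difference_weight_le R0 by (rule mult_right_mono)
    ultimately show "cB * B1 + cG * G \<le> R / 8" by (simp add: algebra_simps)
  qed (use pos in simp)
  have cK: "(rho * (1 - p) + p * (rho / 2)) * Kk \<le> (1 - p * th) * rho * Kk"
  proof (rule mult_right_mono)
    have "rho * p * th \<le> rho * p * (1 / 2)"
      using th pos weights_nonneg by (intro mult_left_mono) auto
    thus "rho * (1 - p) + p * (rho / 2) \<le> (1 - p * th) * rho" by (simp add: algebra_simps)
  qed (rule ge0)
  have cN: "(lam * (1 - tau / 2) + 2 * p * rho) * Nv \<le> (1 - p * th) * lam * Nv"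
  proof (rule mult_right_mono)
    have "2 * p * rho = lam * (tau / 4)" using tau by (simp add: lam_def)
    moreover have "lam * (p * th) \<le> lam * (tau / 4)"
      using pth weights_nonneg by (intro mult_left_mono) auto
    ultimately show "lam * (1 - tau / 2) + 2 * p * rho \<le> (1 - p * th) * lam"
      by (simp add: algebra_simps)
  qed (rule ge0)
  have cH': "(kappa * (1 - beta / 2) + 2 * cH + p * (3 * omega / (n * Lbar))) * H \<le> (1 - p * th) * kappa * H"
  proof (rule mult_right_mono)
    have "2 * cH + p * (3 * omega / (n * Lbar)) = kappa * (beta / 4)"
      using beta by (simp add: kappa_def field_simps)
    moreover have "kappa * (p * th) \<le> kappa * (beta / 4)"
      using pth weights_nonneg by (intro mult_left_mono) auto
    ultimately show "kappa * (1 - beta / 2) + 2 * cH + p * (3 * omega / (n * Lbar)) \<le> (1 - p * th) * kappa"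
      by (simp add: algebra_simps)
  qed (rule ge0)
  \<comment> \<open>The factor 9/8 collects 1 from smoothness and 1/8 from \<open>R\<close>. After
    splitting \<open>Q\<close>, the \<open>V\<close> part is absorbed by the negative prox term,
    since 4 L th is at most \<open>A\<close>, and the \<open>W\<close> part by a quarter of alpha in
    the contraction of \<open>W\<close>.\<close>
  have cQ: "9 / 8 * p * (L * th\<^sup>2 * Q / 2) \<le> nu th * (alpha / 4) * W + p * th * (A / 2) * V"
  proof -
    have "9 / 8 * p * (L * th\<^sup>2 * Q / 2) \<le> p * (L * th\<^sup>2) * Q"
      using pos nonneg ge0 by (simp add: field_simps)
    also have "\<dots> \<le> p * (L * th\<^sup>2) * (2 * V + 2 * W)"
      using Q pos nonneg by (intro mult_left_mono) auto
    also have "\<dots> = 2 * p * L * th\<^sup>2 * W + p * th * (2 * L * th) * V"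
      by (simp add: algebra_simps power2_eq_square)
    also have "2 * p * L * th\<^sup>2 * W = nu th * (alpha / 4) * W"
      using alpha by (simp add: nu_def)
    also have "p * th * (2 * L * th) * V \<le> p * th * (A / 2) * V"
    proof (intro mult_right_mono mult_left_mono)
      have "L \<le> Lbar * (alpha * (1 / 660508))" using small_L(1) alpha pos by (simp add: field_simps)
      also have "\<dots> \<le> Lbar * (1 / 4)" using alpha pos by (intro mult_left_mono) auto
      finally have "2 * L * th \<le> Lbar / 2 * th" using th by (intro mult_right_mono) auto
      thus "2 * L * th \<le> A / 2" using A by simp
    qed (use pos th ge0 in auto)
    finally show ?thesis by simp
  qed
  have cW: "nu th * (1 - alpha / 2) * W + nu th * (alpha / 4) * W \<le> (1 - p * th) * nu th * W"
  proof -
    have "nu th * (p * th) * W \<le> nu th * (alpha / 4) * W"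
      using pth weights_nonneg ge0 by (intro mult_left_mono mult_right_mono) auto
    thus ?thesis by (simp add: algebra_simps)
  qed
  \<comment> \<open>The divergence arrives from the server error, from the noise and from the
    gradient jumps; the negative term offers 1 - th, which is at least 3/4.\<close>
  have cD: "p * (rho * L + 6 * s2 + 1 / 8) * D \<le> p * (1 - th) * D"
    using rho_L_le s2 th pos ge0 by (intro mult_right_mono mult_left_mono) auto
  have "f' + kappa * H' + nu th' * W' + rho * K' + lam * N' + p * th * ((A + mu) / 2) * U'
     \<le> (1 - p * th) * f + p * th * (A / 2) * U - p * (1 - th) * D - p * th * (A / 2) * V + p * (L * th\<^sup>2 * Q / 2)
       + p * ((1 + 8 * a) * (Xi / Lbar)) + nu th * (1 - alpha / 2) * W + p * (rho / 2) * Kk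
       + p * (rho * L) * D + rho * (1 - p) * Kk + 2 * p * rho * Nv
       + lam * (1 - tau / 2) * Nv + 2 * cH * H + kappa * (1 - beta / 2) * H
       + p * (cB * B1 + cG * G)"
    using f' t2 t3 t5 t6 t7 unfolding cB_def cG_def by (simp add: algebra_simps)
  also have "\<dots> \<le> (1 - p * th) * f + p * th * (A / 2) * U - p * (1 - th) * D - p * th * (A / 2) * V + p * (L * th\<^sup>2 * Q / 2)
       + p * (3 * omega / (n * Lbar) * H + 6 * s2 * D) + nu th * (1 - alpha / 2) * W + p * (rho / 2) * Kk
       + p * (rho * L) * D + rho * (1 - p) * Kk + 2 * p * rho * Nv
       + lam * (1 - tau / 2) * Nv + 2 * cH * H + kappa * (1 - beta / 2) * H
       + p * (R / 8)"
    using t4' BG by linarith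
  also have "\<dots> = (1 - p * th) * f + p * th * (A / 2) * U
       + (p * (rho * L + 6 * s2 + 1 / 8) * D - p * (1 - th) * D)
       + (9 / 8 * p * (L * th\<^sup>2 * Q / 2) - p * th * (A / 2) * V) + nu th * (1 - alpha / 2) * W
       + (rho * (1 - p) + p * (rho / 2)) * Kk
       + (lam * (1 - tau / 2) + 2 * p * rho) * Nv
       + (kappa * (1 - beta / 2) + 2 * cH + p * (3 * omega / (n * Lbar))) * H"
    unfolding R_def T_def[symmetric] by (simp add: algebra_simps add_divide_distrib)
  also have "\<dots> \<le> (1 - p * th) * f + p * th * (A / 2) * U + (1 - p * th) * nu th * W
      + (1 - p * th) * rho * Kk + (1 - p * th) * lam * Nv + (1 - p * th) * kappa * H"
    using cK cN cH' cQ cW cD by linarith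
  also have "\<dots> = (1 - p * th) * (f + kappa * H + nu th * W + rho * Kk + lam * Nv) + p * th * (A / 2) * U"
    by (simp add: distrib_left mult.assoc)
  finally show ?thesis .
qed

end

subsection \<open>The algorithm\<close>

text \<open>\<open>y\<close> and \<open>x'\<close> combine with the same \<open>z\<close> and the
  same weight, so x' - y = th (u' - w) and the smoothness error is quadratic in \<open>th\<close>.
  At \<open>z\<close> the exact identity with the Bregman divergence is used instead of convexity,
  which keeps the divergence as a negative term. The term mu/2 |s - y|^2 from the prox step cancels
  against strong convexity. The error \<open>xi\<close> is arbitrary here.\<close>

lemma accelerated_descent:
  fixes f :: "'a::real_inner \<Rightarrow> real"
  assumes sc: "strongly_convex_grad f g mu"
    and br: "bregman f g x' y \<le> L / 2 * (norm (x' - y))\<^sup>2"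
    and th: "0 \<le> th" "th \<le> 1" and mu: "mu \<ge> 0" and A: "A + mu > 0"
    and y: "y = th *\<^sub>R w + (1 - th) *\<^sub>R z"
    and u': "u' = (1 / (A + mu)) *\<^sub>R (A *\<^sub>R u + mu *\<^sub>R y - (g y + xi))"
    and x': "x' = th *\<^sub>R u' + (1 - th) *\<^sub>R z"
  shows "f x' - f s \<le> (1 - th) * ((f z - f s) - bregman f g z y)
      + th * (A / 2 * (norm (u - s))\<^sup>2 - (A + mu) / 2 * (norm (u' - s))\<^sup>2 - A / 2 * (norm (u' - u))\<^sup>2)
      - th * (xi \<bullet> (u' - s)) + L / 2 * th\<^sup>2 * (norm (u' - w))\<^sup>2"
proof -
  have "x' - y = th *\<^sub>R (u' - w)" by (simp add: x' y algebra_simps)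
  hence n: "(norm (x' - y))\<^sup>2 = th\<^sup>2 * (norm (u' - w))\<^sup>2" by (simp add: power_mult_distrib)
  have s: "f y + g y \<bullet> (s - y) + mu / 2 * (norm (s - y))\<^sup>2 \<le> f s"
    using sc by (simp add: strongly_convex_grad_def)
  have "(g y + xi) \<bullet> s + A / 2 * (norm (s - u))\<^sup>2 + mu / 2 * (norm (s - y))\<^sup>2
      = ((g y + xi) \<bullet> u' + A / 2 * (norm (u' - u))\<^sup>2 + mu / 2 * (norm (u' - y))\<^sup>2)
        + (A + mu) / 2 * (norm (s - u'))\<^sup>2"
    unfolding u' by (rule prox_complete_square[OF A])
  moreover have "0 \<le> mu / 2 * (norm (u' - y))\<^sup>2" using mu by simp
  ultimately have pr: "g y \<bullet> (u' - s) \<le> A / 2 * (norm (u - s))\<^sup>2 + mu / 2 * (norm (s - y))\<^sup>2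
      - A / 2 * (norm (u' - u))\<^sup>2 - (A + mu) / 2 * (norm (u' - s))\<^sup>2 - xi \<bullet> (u' - s)"
    by (simp add: inner_add_left inner_diff_right norm_minus_commute)
  \<comment> \<open>A second decomposition of the same vector, routed through \<open>s\<close>: the
    weight \<open>th\<close> meets strong convexity and the prox inequality, the weight 1 - th meets
    the value at \<open>z\<close>.\<close>
  have e: "x' - y = th *\<^sub>R ((s - y) + (u' - s)) + (1 - th) *\<^sub>R (z - y)"
    by (simp add: x' algebra_simps)
  have "f x' = f y + g y \<bullet> (x' - y) + bregman f g x' y" by (simp add: bregman_def)
  also have "g y \<bullet> (x' - y) = th * (g y \<bullet> (s - y) + g y \<bullet> (u' - s)) + (1 - th) * (g y \<bullet> (z - y))"
    unfolding e by (simp only: inner_add_right inner_scaleR_right)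
  also have "g y \<bullet> (z - y) = f z - f y - bregman f g z y" by (simp add: bregman_def)
  finally have eq: "f x' = th * (f y + g y \<bullet> (s - y) + g y \<bullet> (u' - s))
      + (1 - th) * (f z - bregman f g z y) + bregman f g x' y"
    by (simp add: algebra_simps)
  have "f y + g y \<bullet> (s - y) + g y \<bullet> (u' - s) \<le> f s + (A / 2 * (norm (u - s))\<^sup>2
      - (A + mu) / 2 * (norm (u' - s))\<^sup>2 - A / 2 * (norm (u' - u))\<^sup>2) - xi \<bullet> (u' - s)"
    using pr s by linarith
  from mult_left_mono[OF this th(1)] show ?thesis
    using eq br unfolding n by (simp add: algebra_simps)
qed

primrec src_time :: "src \<Rightarrow> nat" where
  "src_time (SrcY t i) = t" | "src_time (SrcZ t i) = t" | "src_time (SrcP t) = t" | "src_time (SrcC t) = t"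

locale two_direction =
  fixes n :: nat
    and fs :: "nat \<Rightarrow> 'a::euclidean_space \<Rightarrow> real" and g :: "nat \<Rightarrow> 'a \<Rightarrow> 'a"
    and Li :: "nat \<Rightarrow> real" and Lmax Lbar thmin L mu omega alpha p tau beta Gam0 :: real
    and xstar x0 k0 v0 :: 'a and h0 :: "nat \<Rightarrow> 'a"
    and M :: "'m measure"
    and PY PZ :: "nat \<Rightarrow> 's measure" and PP :: "'s measure"
    and CY CZ :: "nat \<Rightarrow> 's \<Rightarrow> 'a \<Rightarrow> 'a" and CP :: "'s \<Rightarrow> 'a \<Rightarrow> 'a"
    and sy sz :: "nat \<Rightarrow> nat \<Rightarrow> 'm \<Rightarrow> 's" and sP :: "nat \<Rightarrow> 'm \<Rightarrow> 's"
    and coin :: "nat \<Rightarrow> 'm \<Rightarrow> bool" and F :: "'a \<Rightarrow> real" and gF :: "'a \<Rightarrow> 'a"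
  assumes F_def: "F = (\<lambda>x. (1 / real n) * (\<Sum>i<n. fs i x))"
    and gF_def: "gF = (\<lambda>x. (1 / real n) *\<^sub>R (\<Sum>i<n. g i x))"
    and Lmax_def: "Lmax = Max (Li ` {..<n})"
    and Lbar_def: "Lbar = 660508 * Max {L / alpha, L * p / (alpha * tau),
                 sqrt (L * Lmax) * p * sqrt (omega * tau) / (alpha * beta * sqrt (real n)),
                 sqrt (L * Lmax) * sqrt p * sqrt (omega * tau) / (alpha * sqrt beta * sqrt (real n)),
                 Lmax * omega * p\<^sup>2 / (beta\<^sup>2 * real n),
                 Lmax * omega / real n}"
    and thmin_def: "thmin = 1 / 4 * Min {1, alpha / p, tau / p, beta / p}"
    and n_pos: "n \<ge> 1"
    and grad: "\<And>i x. i < n \<Longrightarrow> (fs i has_derivative (\<lambda>h. g i x \<bullet> h)) (at x)"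
    and smooth_i: "\<And>i x y. i < n \<Longrightarrow> norm (g i x - g i y) \<le> Li i * norm (x - y)"
    and smooth: "\<And>x y. norm (gF x - gF y) \<le> L * norm (x - y)"
    and convex_i: "\<And>i. i < n \<Longrightarrow> convex_on UNIV (fs i)"
    and mu_nonneg: "mu \<ge> 0"
    and strong: "strongly_convex_grad F gF mu"
    and omega_nonneg: "omega \<ge> 0"
    and CY_U: "\<And>i. i < n \<Longrightarrow> unbiased_compressor (PY i) (CY i) omega"
    and CZ_U: "\<And>i. i < n \<Longrightarrow> unbiased_compressor (PZ i) (CZ i) omega"
    and alpha: "0 < alpha" "alpha \<le> 1"
    and CP_B: "biased_compressor PP CP alpha"
    and p: "0 < p" "p \<le> 1"
    and Gam0: "Gam0 \<ge> 1"
    and tau: "0 < tau" "tau \<le> 1"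
    and beta: "0 < beta" "beta \<le> 1 / (omega + 1)"
    and Lbar_pos: "Lbar > 0"
    and M: "prob_space M"
    and sy_law: "\<And>t i. i < n \<Longrightarrow> sy t i \<in> measurable M (PY i) \<and> distr M (PY i) (sy t i) = PY i"
    and sz_law: "\<And>t i. i < n \<Longrightarrow> sz t i \<in> measurable M (PZ i) \<and> distr M (PZ i) (sz t i) = PZ i"
    and sP_law: "\<And>t. sP t \<in> measurable M PP \<and> distr M PP (sP t) = PP"
    and coin_law: "\<And>t. coin t \<in> measurable M (count_space UNIV) \<and>
                        measure M {\<omega> \<in> space M. coin t \<omega>} = p"
    and indep: "prob_space.indep_sets M (src_events M PY PZ PP sy sz sP coin) (rel_srcs n)"
begin

lemma beta_le1: "beta \<le> 1"
proof -
  have "1 / (omega + 1) \<le> 1" using omega_nonneg by simp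
  with beta show ?thesis by linarith
qed

lemma L_nonneg: "L \<ge> 0" by (rule lipschitz_const_nonneg[OF smooth])

lemma Li_le: "i < n \<Longrightarrow> Li i \<le> Lmax" unfolding Lmax_def by (intro Max_ge) auto

lemma Lmax_nonneg: "Lmax \<ge> 0"
proof -
  have "0 \<le> Li 0" using n_pos by (intro lipschitz_const_nonneg[OF smooth_i]) auto
  also have "\<dots> \<le> Lmax" using n_pos by (intro Li_le) auto
  finally show ?thesis .
qed

sublocale sc: step_constants L Lmax Lbar omega alpha beta tau p "real n"
proof unfold_locales
  let ?T = "{L / alpha, L * p / (alpha * tau),
                 sqrt (L * Lmax) * p * sqrt (omega * tau) / (alpha * beta * sqrt (real n)),
                 sqrt (L * Lmax) * sqrt p * sqrt (omega * tau) / (alpha * sqrt beta * sqrt (real n)),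
                 Lmax * omega * p\<^sup>2 / (beta\<^sup>2 * real n),
                 Lmax * omega / real n}"
  define m where "m = Max ?T"
  have m: "Lbar = 660508 * m" unfolding m_def by (rule Lbar_def)
  have le: "x / Lbar \<le> 1 / 660508" if "x \<in> ?T" for x
  proof -
    have "x \<le> m" unfolding m_def using that by (intro Max_ge) auto
    with m show ?thesis using Lbar_pos by (simp add: field_simps)
  qed
  have sq: "x\<^sup>2 / Lbar\<^sup>2 \<le> (1 / 660508)\<^sup>2" if "x \<in> ?T" "x \<ge> 0" for x
    using power_mono[OF le[OF that(1)], of 2] that(2) Lbar_pos by (simp add: power_divide)
  show "L / (alpha * Lbar) \<le> 1 / 660508" using le[of "L / alpha"] by simp
  show "L * p / (alpha * tau * Lbar) \<le> 1 / 660508" using le[of "L * p / (alpha * tau)"] by simp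
  show "Lmax * omega * p\<^sup>2 / (beta\<^sup>2 * real n * Lbar) \<le> 1 / 660508"
    using le[of "Lmax * omega * p\<^sup>2 / (beta\<^sup>2 * real n)"] by simp
  show "Lmax * omega / (real n * Lbar) \<le> 1 / 660508"
    using le[of "Lmax * omega / real n"] by simp
  have "(sqrt (L * Lmax) * p * sqrt (omega * tau) / (alpha * beta * sqrt (real n)))\<^sup>2
      = L * Lmax * p\<^sup>2 * omega * tau / (alpha\<^sup>2 * beta\<^sup>2 * real n)"
    using L_nonneg Lmax_nonneg omega_nonneg tau by (simp add: power_divide power_mult_distrib)
  with sq[of "sqrt (L * Lmax) * p * sqrt (omega * tau) / (alpha * beta * sqrt (real n))"]
  show "L * Lmax * p\<^sup>2 * omega * tau / (alpha\<^sup>2 * beta\<^sup>2 * real n * Lbar\<^sup>2) \<le> (1 / 660508)\<^sup>2"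
    using L_nonneg Lmax_nonneg omega_nonneg tau p alpha beta by simp
  have "(sqrt (L * Lmax) * sqrt p * sqrt (omega * tau) / (alpha * sqrt beta * sqrt (real n)))\<^sup>2
      = L * Lmax * p * omega * tau / (alpha\<^sup>2 * beta * real n)"
    using L_nonneg Lmax_nonneg omega_nonneg tau p beta by (simp add: power_divide power_mult_distrib)
  with sq[of "sqrt (L * Lmax) * sqrt p * sqrt (omega * tau) / (alpha * sqrt beta * sqrt (real n))"]
  show "L * Lmax * p * omega * tau / (alpha\<^sup>2 * beta * real n * Lbar\<^sup>2) \<le> (1 / 660508)\<^sup>2"
    using L_nonneg Lmax_nonneg omega_nonneg tau p alpha beta by simp
qed (use L_nonneg Lmax_nonneg omega_nonneg Lbar_pos n_pos p alpha beta beta_le1 tau in auto)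

lemma thmin: "thmin > 0" "thmin \<le> 1 / 4" "p * thmin \<le> alpha / 4" "p * thmin \<le> tau / 4" "p * thmin \<le> beta / 4"
proof -
  let ?m = "Min {1, alpha / p, tau / p, beta / p}"
  have "?m > 0" using alpha tau beta p by (subst Min_gr_iff) auto
  thus "thmin > 0" by (simp add: thmin_def)
  have m: "?m \<le> x" if "x \<in> {1, alpha / p, tau / p, beta / p}" for x
    using that by (intro Min_le) auto
  show "thmin \<le> 1 / 4" using m[of 1] by (simp add: thmin_def)
  have "p * thmin \<le> x / 4" if "x / p \<in> {1, alpha / p, tau / p, beta / p}" for x
    using m[OF that] p by (simp add: thmin_def field_simps)
  thus "p * thmin \<le> alpha / 4" "p * thmin \<le> tau / 4" "p * thmin \<le> beta / 4" by auto
qed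

section \<open>Step sizes along the run\<close>

definition G :: "nat \<Rightarrow> real" where "G t = gam_seq Lbar mu p thmin Gam0 t"
text \<open>Note the index shift: \<open>th t\<close> and \<open>gm t\<close> are theta and gamma
  with index t + 1, while \<open>G t\<close> is Gamma with index t. \<open>A t\<close> is the prox
  coefficient of iteration t.\<close>

definition th :: "nat \<Rightarrow> real" where "th t = theta_next Lbar mu p thmin (G t)"
definition gm :: "nat \<Rightarrow> real" where "gm t = gamma_next Lbar mu p thmin (G t)"
definition A :: "nat \<Rightarrow> real" where "A t = (Lbar + G t * mu) / gm t"

lemma theta_next_bounds:
  assumes "x > 0"
  shows "0 < theta_next Lbar mu p thmin x" "theta_next Lbar mu p thmin x \<le> thmin"
  using theta_next_eq[OF Lbar_pos mu_nonneg p(1) assms, of thmin]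
    step_quadratic_le_iff(2)[OF Lbar_pos mu_nonneg p(1) assms, of 0] thmin(1) by auto

lemma p_theta_next:
  assumes "x > 0"
  shows "0 < p * theta_next Lbar mu p thmin x" "p * theta_next Lbar mu p thmin x \<le> p * thmin"
    "p * theta_next Lbar mu p thmin x \<le> 1 / 4"
proof -
  show "0 < p * theta_next Lbar mu p thmin x" using theta_next_bounds[OF assms] p by simp
  show le: "p * theta_next Lbar mu p thmin x \<le> p * thmin"
    using theta_next_bounds[OF assms] p by (intro mult_left_mono) auto
  show "p * theta_next Lbar mu p thmin x \<le> 1 / 4" using le thmin(3) alpha by linarith
qed

lemma gamma_next_pos: "x > 0 \<Longrightarrow> gamma_next Lbar mu p thmin x > 0"
  using p_theta_next[of x] by (simp add: gamma_next_def Let_def)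

lemma G_pos: "G t > 0"
proof (induction t)
  case 0
  show ?case using Gam0 by (simp add: G_def)
next
  case (Suc t)
  thus ?case using gamma_next_pos[of "G t"] by (simp add: G_def)
qed

lemma G_Suc: "G (Suc t) = G t + gm t" by (simp add: G_def gm_def)

lemma gm_pos: "gm t > 0" using gamma_next_pos[OF G_pos] by (simp add: gm_def)

lemma th: "0 < th t" "th t \<le> 1 / 4" "p * th t \<le> alpha / 4" "p * th t \<le> tau / 4"
    "p * th t \<le> beta / 4" "p * th t \<le> 1 / 4"
  using theta_next_bounds[OF G_pos[of t]] p_theta_next[OF G_pos[of t]] thmin by (auto simp: th_def)

lemma gm_eq: "gm t = p * th t * G t / (1 - p * th t)"
  by (simp add: gm_def gamma_next_def th_def Let_def)

text \<open>These identities explain the choice of gamma: multiplying a one-step bound by the new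
  Gamma turns the contraction factor 1 - p theta into the old Gamma, and p theta into gamma.\<close>

lemma G_Suc_mult: "G (Suc t) * (1 - p * th t) = G t" "G (Suc t) * (p * th t) = gm t"
proof -
  have "1 - p * th t > 0" using th(6)[of t] by linarith
  thus "G (Suc t) * (1 - p * th t) = G t" unfolding G_Suc gm_eq by (simp add: field_simps)
  thus "G (Suc t) * (p * th t) = gm t" by (simp add: G_Suc algebra_simps)
qed

lemma th_antimono: "th (Suc t) \<le> th t"
proof -
  have "step_root Lbar mu p (G (Suc t)) \<le> step_root Lbar mu p (G t)"
    using gm_pos[of t] by (intro step_root_antimono Lbar_pos mu_nonneg p G_pos) (simp add: G_Suc)
  thus ?thesis unfolding th_def
    by (simp add: theta_next_eq[OF Lbar_pos mu_nonneg p(1) G_pos] min_le_iff_disj)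
qed

text \<open>This is what the quadratic equation is made for: after division by 1 - p th, being below
  its root means Lbar th gm \<le> Lbar + G mu.\<close>

lemma A_ge: "A t \<ge> Lbar * th t"
proof -
  have "th t \<le> step_root Lbar mu p (G t)"
    unfolding th_def by (simp add: theta_next_eq[OF Lbar_pos mu_nonneg p(1) G_pos])
  hence "p * Lbar * G t * (th t)\<^sup>2 + p * (Lbar + G t * mu) * th t \<le> Lbar + G t * mu"
    using step_quadratic_le_iff(1)[OF Lbar_pos mu_nonneg p(1) G_pos, of "th t"] th(1)[of t] by simp
  hence "Lbar * th t * (p * th t * G t) \<le> (Lbar + G t * mu) * (1 - p * th t)"
    by (simp add: algebra_simps power2_eq_square)
  moreover have "1 - p * th t > 0" using th(6)[of t] by linarith
  ultimately have "Lbar * th t * gm t \<le> Lbar + G t * mu"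
    unfolding gm_eq by (simp add: field_simps)
  thus ?thesis unfolding A_def using gm_pos[of t] by (simp add: field_simps)
qed

lemma A_pos: "A t > 0"
proof -
  have "0 < Lbar * th t" using Lbar_pos th(1) by simp
  with A_ge show ?thesis by (rule less_le_trans[rotated])
qed

lemma A_mu_pos: "A t + mu > 0" using A_pos[of t] mu_nonneg by simp

lemma A_mult: "gm t * A t = Lbar + G t * mu" "gm t * (A t + mu) = Lbar + G (Suc t) * mu"
  using gm_pos[of t] by (auto simp: A_def G_Suc field_simps)

section \<open>Smoothness and convexity of the average\<close>

lemma grad_F: "(F has_derivative (\<lambda>h. gF x \<bullet> h)) (at x)"
proof -
  have "((\<lambda>x. (1 / real n) * (\<Sum>i<n. fs i x)) has_derivative (\<lambda>h. (1 / real n) * (\<Sum>i<n. g i x \<bullet> h))) (at x)"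
    by (intro has_derivative_mult_right has_derivative_sum grad) auto
  thus ?thesis by (simp add: F_def gF_def inner_sum_left)
qed

lemma bregman_F: "bregman F gF x y = (1 / real n) * (\<Sum>i<n. bregman (fs i) (g i) x y)"
  by (simp add: bregman_def F_def gF_def inner_sum_left sum_subtractf right_diff_distrib)

lemma bregman_i_nonneg: "i < n \<Longrightarrow> 0 \<le> bregman (fs i) (g i) x y"
  by (rule convex_on_imp_bregman_nonneg[OF grad convex_i])

lemma bregman_F_nonneg: "0 \<le> bregman F gF x y"
  unfolding bregman_F by (auto intro!: divide_nonneg_nonneg sum_nonneg bregman_i_nonneg)

lemma bregman_F_le: "bregman F gF x y \<le> L / 2 * (norm (x - y))\<^sup>2"
  by (rule bregman_le_quadratic[OF grad_F smooth])

lemma gF_diff_le: "(norm (gF x - gF y))\<^sup>2 \<le> 2 * L * bregman F gF x y"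
  by (rule norm_grad_diff_le_bregman[OF grad_F smooth bregman_F_nonneg])

text \<open>Cocoercivity is applied to each convex summand with its own constant. The divergence is
  linear in the function, so averaging gives back the divergence of \<open>F\<close>.\<close>

lemma avg_g_diff_le: "(1 / real n) * (\<Sum>i<n. (norm (g i x - g i y))\<^sup>2) \<le> 2 * Lmax * bregman F gF x y"
proof -
  have "(norm (g i x - g i y))\<^sup>2 \<le> 2 * Lmax * bregman (fs i) (g i) x y" if i: "i < n" for i
  proof -
    have "(norm (g i x - g i y))\<^sup>2 \<le> 2 * Li i * bregman (fs i) (g i) x y"
      by (rule norm_grad_diff_le_bregman[OF grad[OF i] smooth_i[OF i] bregman_i_nonneg[OF i]])
    also have "\<dots> \<le> 2 * Lmax * bregman (fs i) (g i) x y"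
      using Li_le[OF i] bregman_i_nonneg[OF i] by (intro mult_right_mono) auto
    finally show ?thesis .
  qed
  hence "(1 / real n) * (\<Sum>i<n. (norm (g i x - g i y))\<^sup>2)
      \<le> (1 / real n) * (\<Sum>i<n. 2 * Lmax * bregman (fs i) (g i) x y)"
    by (intro mult_left_mono sum_mono) auto
  also have "\<dots> = 2 * Lmax * bregman F gF x y" by (simp add: bregman_F sum_distrib_left)
  finally show ?thesis .
qed

section \<open>Sources of randomness and the stages of one iteration\<close>

sublocale prob_space M by (rule M)

sublocale noise_sources M "src_events M PY PZ PP sy sz sP coin" "rel_srcs n"
proof
  show "indep_sets (src_events M PY PZ PP sy sz sP coin) (rel_srcs n)" by (rule indep)
  have *: "Int_stable {X -` B \<inter> space M | B. B \<in> sets N}" for X :: "'m \<Rightarrow> 'x" and N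
  proof (rule Int_stableI)
    fix a b assume "a \<in> {X -` B \<inter> space M | B. B \<in> sets N}" "b \<in> {X -` B \<inter> space M | B. B \<in> sets N}"
    then obtain B C where "B \<in> sets N" "C \<in> sets N" "a = X -` B \<inter> space M" "b = X -` C \<inter> space M" by blast
    hence "a \<inter> b = X -` (B \<inter> C) \<inter> space M" "B \<inter> C \<in> sets N" by auto
    thus "a \<inter> b \<in> {X -` B \<inter> space M | B. B \<in> sets N}" by blast
  qed
  show "Int_stable (src_events M PY PZ PP sy sz sP coin j)" for j
    unfolding src_events_def by (cases j) (simp_all only: src.case *)
qed

lemma source_Y: "i < n \<Longrightarrow> source (SrcY t i) (sy t i) (PY i)"
  and source_Z: "i < n \<Longrightarrow> source (SrcZ t i) (sz t i) (PZ i)"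
  and source_P: "source (SrcP t) (sP t) PP"
  and source_C: "source (SrcC t) (coin t) (count_space UNIV)"
  using sy_law sz_law sP_law coin_law by (auto simp: source_def src_events_def)

text \<open>What is known before iteration \<open>t\<close>, and then after the worker seeds \<open>SrcY\<close>, the server seed and the coin of that iteration.\<close>
definition past :: "nat \<Rightarrow> src set" where "past t = {s \<in> rel_srcs n. src_time s < t}"
definition pastY :: "nat \<Rightarrow> src set" where "pastY t = past t \<union> SrcY t ` {..<n}"
definition pastP :: "nat \<Rightarrow> src set" where "pastP t = insert (SrcP t) (pastY t)"
definition pastC :: "nat \<Rightarrow> src set" where "pastC t = insert (SrcC t) (pastP t)"

lemma rel_srcs_mem: "i < n \<Longrightarrow> SrcY t i \<in> rel_srcs n" "i < n \<Longrightarrow> SrcZ t i \<in> rel_srcs n"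
    "SrcP t \<in> rel_srcs n" "SrcC t \<in> rel_srcs n"
  by (auto simp: rel_srcs_def)

lemma past_subset: "past t \<subseteq> rel_srcs n" "pastY t \<subseteq> rel_srcs n" "pastP t \<subseteq> rel_srcs n" "pastC t \<subseteq> rel_srcs n"
  by (auto simp: past_def pastY_def pastP_def pastC_def rel_srcs_mem)

lemma past_mono: "past t \<subseteq> pastY t" "pastY t \<subseteq> pastP t" "pastP t \<subseteq> pastC t" "past t \<subseteq> pastC t"
    "pastY t \<subseteq> pastC t" "past t \<subseteq> pastP t"
    "pastY t \<subseteq> past (Suc t)" "pastP t \<subseteq> past (Suc t)" "pastC t \<subseteq> past (Suc t)" "past t \<subseteq> past (Suc t)"
    "pastC t \<union> SrcZ t ` {..<n} \<subseteq> past (Suc t)"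
  by (auto simp: past_def pastY_def pastP_def pastC_def rel_srcs_mem)

lemma fresh: "SrcY t i \<notin> past t" "SrcP t \<notin> pastY t" "SrcC t \<notin> pastP t" "SrcZ t i \<notin> pastC t"
  by (auto simp: past_def pastY_def pastP_def pastC_def)

end

section \<open>The iterates as square-integrable random variables\<close>

context two_direction
begin

definition St :: "nat \<Rightarrow> 'm \<Rightarrow> 'a alg_state" where
  "St = alg_run n g CY CZ CP Lbar mu p tau beta thmin Gam0 x0 h0 k0 v0 sy sz sP coin"

definition wt :: "nat \<Rightarrow> 'm \<Rightarrow> 'a" where "wt t \<omega> = st_w (St t \<omega>)"
definition zt :: "nat \<Rightarrow> 'm \<Rightarrow> 'a" where "zt t \<omega> = st_z (St t \<omega>)"
definition ut :: "nat \<Rightarrow> 'm \<Rightarrow> 'a" where "ut t \<omega> = st_u (St t \<omega>)"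
definition kt :: "nat \<Rightarrow> 'm \<Rightarrow> 'a" where "kt t \<omega> = st_k (St t \<omega>)"
definition vt :: "nat \<Rightarrow> 'm \<Rightarrow> 'a" where "vt t \<omega> = st_v (St t \<omega>)"
definition ht :: "nat \<Rightarrow> nat \<Rightarrow> 'm \<Rightarrow> 'a" where "ht t i \<omega> = st_h (St t \<omega>) i"

definition yt :: "nat \<Rightarrow> 'm \<Rightarrow> 'a" where
  "yt t \<omega> = th t *\<^sub>R wt t \<omega> + (1 - th t) *\<^sub>R zt t \<omega>"
text \<open>The vector that worker \<open>i\<close> compresses, the compression noise (\<open>NY\<close>), and the resulting error \<open>xi\<close> of \<open>g\<close>; \<open>dZ\<close>, \<open>NZ\<close>, \<open>zeta\<close> are the analogues at \<open>z\<close>. The prox point \<open>un\<close> is written as \<open>ubar\<close>, which is known before the seeds are drawn, minus a multiple of \<open>xi\<close>.\<close>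
definition dY :: "nat \<Rightarrow> nat \<Rightarrow> 'm \<Rightarrow> 'a" where
  "dY t i \<omega> = g i (yt t \<omega>) - ht t i \<omega>"
definition NY :: "nat \<Rightarrow> nat \<Rightarrow> 'm \<Rightarrow> 'a" where
  "NY t i \<omega> = CY i (sy t i \<omega>) (dY t i \<omega>) - dY t i \<omega>"
definition xi :: "nat \<Rightarrow> 'm \<Rightarrow> 'a" where
  "xi t \<omega> = (1 / real n) *\<^sub>R (\<Sum>i<n. NY t i \<omega>)"
definition ubar :: "nat \<Rightarrow> 'm \<Rightarrow> 'a" where
  "ubar t \<omega> = (1 / (A t + mu)) *\<^sub>R (A t *\<^sub>R ut t \<omega> + mu *\<^sub>R yt t \<omega> - gF (yt t \<omega>))"
definition qt :: "nat \<Rightarrow> 'm \<Rightarrow> 'a" where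
  "qt t \<omega> = (1 / (A t + mu)) *\<^sub>R (A t *\<^sub>R wt t \<omega> + mu *\<^sub>R yt t \<omega> - kt t \<omega>)"
definition un :: "nat \<Rightarrow> 'm \<Rightarrow> 'a" where
  "un t \<omega> = ubar t \<omega> - (1 / (A t + mu)) *\<^sub>R xi t \<omega>"
definition xn :: "nat \<Rightarrow> 'm \<Rightarrow> 'a" where
  "xn t \<omega> = th t *\<^sub>R un t \<omega> + (1 - th t) *\<^sub>R zt t \<omega>"
definition dZ :: "nat \<Rightarrow> nat \<Rightarrow> 'm \<Rightarrow> 'a" where
  "dZ t i \<omega> = g i (zt (Suc t) \<omega>) - ht t i \<omega>"
definition NZ :: "nat \<Rightarrow> nat \<Rightarrow> 'm \<Rightarrow> 'a" where
  "NZ t i \<omega> = CZ i (sz t i \<omega>) (dZ t i \<omega>) - dZ t i \<omega>"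
definition zeta :: "nat \<Rightarrow> 'm \<Rightarrow> 'a" where
  "zeta t \<omega> = (1 / real n) *\<^sub>R (\<Sum>i<n. NZ t i \<omega>)"

lemmas state_defs = wt_def zt_def ut_def kt_def vt_def ht_def

lemma St_Suc: "St (Suc t) \<omega> = alg_step n g CY CZ CP Lbar mu tau beta (th t) (gm t) (G t) (St t \<omega>)
       (\<lambda>i. sy t i \<omega>) (\<lambda>i. sz t i \<omega>) (sP t \<omega>) (coin t \<omega>)"
  by (simp add: St_def th_def gm_def G_def)

text \<open>The server updates its own copy of the average shift. It stays equal to the mean of the
  worker shifts because both use the same messages and the same \<open>beta\<close>.\<close>

lemma st_hb: "st_hb (St t \<omega>) = (1 / real n) *\<^sub>R (\<Sum>i<n. ht t i \<omega>)"
proof (induction t)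
  case 0
  show ?case by (simp add: St_def ht_def)
next
  case (Suc t)
  thus ?case unfolding ht_def St_Suc
    by (simp add: alg_step_def Let_def sum.distrib scaleR_sum_right scaleR_add_right)
qed

text \<open>The shifts cancel from the mean of the estimator, leaving the exact gradient plus
  averaged compression noise. It is used at y with the first batch of messages and at z with the
  second.\<close>

lemma avg_estimate:
  "st_hb (St t \<omega>) + (1 / real n) *\<^sub>R (\<Sum>i<n. C i)
     = gF x + (1 / real n) *\<^sub>R (\<Sum>i<n. C i - (g i x - ht t i \<omega>))"
  by (simp add: st_hb gF_def sum_subtractf scaleR_diff_right)

lemma ut_Suc: "ut (Suc t) \<omega> = un t \<omega>"
proof -
  have e: "st_hb (St t \<omega>) + (1 / real n) *\<^sub>R (\<Sum>i<n. CY i (sy t i \<omega>) (dY t i \<omega>))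
      = gF (yt t \<omega>) + xi t \<omega>"
    unfolding avg_estimate[where x = "yt t \<omega>"] by (simp add: xi_def NY_def dY_def)
  have "ut (Suc t) \<omega> = arg_min (\<lambda>x. (st_hb (St t \<omega>) + (1 / real n) *\<^sub>R (\<Sum>i<n. CY i (sy t i \<omega>) (dY t i \<omega>))) \<bullet> x
      + A t / 2 * (norm (x - ut t \<omega>))\<^sup>2 + mu / 2 * (norm (x - yt t \<omega>))\<^sup>2) (\<lambda>_. True)"
    unfolding ut_def St_Suc by (simp add: alg_step_def Let_def A_def yt_def dY_def wt_def zt_def ht_def)
  also have "\<dots> = un t \<omega>"
    unfolding arg_min_prox[OF A_mu_pos] e un_def ubar_def by (simp add: scaleR_diff_right scaleR_add_right)
  finally show ?thesis .
qed

lemma wt_Suc: "wt (Suc t) \<omega> = qt t \<omega> + CP (sP t \<omega>) (un t \<omega> - qt t \<omega>)"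
proof -
  have q: "arg_min (\<lambda>x. kt t \<omega> \<bullet> x + A t / 2 * (norm (x - wt t \<omega>))\<^sup>2 + mu / 2 * (norm (x - yt t \<omega>))\<^sup>2) (\<lambda>_. True) = qt t \<omega>"
    unfolding arg_min_prox[OF A_mu_pos] qt_def ..
  show ?thesis unfolding q[symmetric] ut_Suc[symmetric]
    unfolding wt_def ut_def St_Suc
    by (simp add: alg_step_def Let_def A_def yt_def dY_def wt_def zt_def ht_def kt_def)
qed

lemma zt_Suc: "zt (Suc t) \<omega> = (if coin t \<omega> then xn t \<omega> else zt t \<omega>)"
  unfolding xn_def ut_Suc[symmetric] unfolding zt_def ut_def St_Suc
  by (simp add: alg_step_def Let_def)

lemma kt_Suc: "kt (Suc t) \<omega> = (if coin t \<omega> then vt t \<omega> else kt t \<omega>)"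
  unfolding kt_def vt_def St_Suc by (simp add: alg_step_def Let_def)

lemma ht_Suc: "ht (Suc t) i \<omega> = ht t i \<omega> + beta *\<^sub>R (dZ t i \<omega> + NZ t i \<omega>)"
  unfolding NZ_def dZ_def unfolding ht_def zt_def St_Suc
  by (simp add: alg_step_def Let_def)

lemma vt_Suc: "vt (Suc t) \<omega> = (1 - tau) *\<^sub>R vt t \<omega> + tau *\<^sub>R (gF (zt (Suc t) \<omega>) + zeta t \<omega>)"
proof -
  have e: "gF (zt (Suc t) \<omega>) + zeta t \<omega> = st_hb (St t \<omega>) + (1 / real n) *\<^sub>R (\<Sum>i<n. CZ i (sz t i \<omega>) (dZ t i \<omega>))"
    unfolding avg_estimate[where x = "zt (Suc t) \<omega>"] by (simp add: zeta_def NZ_def dZ_def)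
  show ?thesis unfolding e unfolding dZ_def vt_def zt_def ht_def St_Suc
    by (simp add: alg_step_def Let_def)
qed

definition state_L2 :: "nat \<Rightarrow> bool" where
  "state_L2 t \<longleftrightarrow> L2 (past t) (wt t) \<and> L2 (past t) (zt t) \<and> L2 (past t) (ut t) \<and> L2 (past t) (kt t)
     \<and> L2 (past t) (vt t) \<and> (\<forall>i<n. L2 (past t) (ht t i))"

lemma L2_gF: "L2 J X \<Longrightarrow> L2 J (\<lambda>\<omega>. gF (X \<omega>))"
  by (rule L2_lipschitz[OF _ smooth])

lemma L2_g: "i < n \<Longrightarrow> L2 J X \<Longrightarrow> L2 J (\<lambda>\<omega>. g i (X \<omega>))"
  by (rule L2_lipschitz[OF _ smooth_i])

lemmas L2_past = L2_mono[OF _ past_mono(1) past_subset(2)] L2_mono[OF _ past_mono(2) past_subset(3)]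
  L2_mono[OF _ past_mono(3) past_subset(4)] L2_mono[OF _ past_mono(4) past_subset(4)]
  L2_mono[OF _ past_mono(5) past_subset(4)] L2_mono[OF _ past_mono(6) past_subset(3)]
  L2_mono[OF _ past_mono(7) past_subset(1)] L2_mono[OF _ past_mono(8) past_subset(1)]
  L2_mono[OF _ past_mono(9) past_subset(1)] L2_mono[OF _ past_mono(10) past_subset(1)]
  L2_mono[OF _ past_mono(11) past_subset(1)]

text \<open>All consequences of square integrability at time t are collected here, since the last of
  them closes the induction. Every variable is placed in an early enough stage of the iteration that
  the seeds applied to it later are still fresh.\<close>

lemma step_L2:
  assumes "state_L2 t"
  shows L2_wt: "L2 (past t) (wt t)" and L2_zt: "L2 (past t) (zt t)" and L2_ut: "L2 (past t) (ut t)"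
    and L2_kt: "L2 (past t) (kt t)" and L2_vt: "L2 (past t) (vt t)"
    and L2_ht: "\<And>i. i < n \<Longrightarrow> L2 (past t) (ht t i)"
    and L2_yt: "L2 (past t) (yt t)"
    and L2_ubar: "L2 (past t) (ubar t)" and L2_qt: "L2 (past t) (qt t)"
    and L2_xi: "L2 (pastY t) (xi t)"
    and xi_orthogonal: "\<And>Y. L2 (past t) Y \<Longrightarrow> expectation (\<lambda>\<omega>. xi t \<omega> \<bullet> Y \<omega>) = 0"
    and msq_xi: "msq (xi t) \<le> omega / (real n)\<^sup>2 * (\<Sum>i<n. msq (dY t i))"
    and L2_un: "L2 (pastY t) (un t)" and L2_xn: "L2 (pastY t) (xn t)"
    and msq_wt_Suc: "msq (\<lambda>\<omega>. wt (Suc t) \<omega> - ut (Suc t) \<omega>) \<le> (1 - alpha) * msq (\<lambda>\<omega>. un t \<omega> - qt t \<omega>)"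
    and L2_zt_Suc: "L2 (pastC t) (zt (Suc t))"
    and L2_dZ: "\<And>i. i < n \<Longrightarrow> L2 (pastC t) (dZ t i)"
    and L2_NZ: "\<And>i. i < n \<Longrightarrow> L2 (past (Suc t)) (NZ t i)"
    and msq_NZ: "\<And>i. i < n \<Longrightarrow> msq (NZ t i) \<le> omega * msq (dZ t i)"
    and NZ_orthogonal: "\<And>i Y. i < n \<Longrightarrow> L2 (pastC t) Y \<Longrightarrow> expectation (\<lambda>\<omega>. NZ t i \<omega> \<bullet> Y \<omega>) = 0"
    and L2_zeta: "L2 (past (Suc t)) (zeta t)"
    and zeta_orthogonal: "\<And>Y. L2 (pastC t) Y \<Longrightarrow> expectation (\<lambda>\<omega>. zeta t \<omega> \<bullet> Y \<omega>) = 0"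
    and msq_zeta: "msq (zeta t) \<le> omega / (real n)\<^sup>2 * (\<Sum>i<n. msq (dZ t i))"
    and state_L2_Suc: "state_L2 (Suc t)"
proof -
  show w: "L2 (past t) (wt t)" and z: "L2 (past t) (zt t)" and u: "L2 (past t) (ut t)"
    and k: "L2 (past t) (kt t)" and v: "L2 (past t) (vt t)"
    and h: "\<And>i. i < n \<Longrightarrow> L2 (past t) (ht t i)"
    using assms by (auto simp: state_L2_def)
  show y: "L2 (past t) (yt t)" unfolding yt_def by (intro L2_add L2_scaleR w z)
  have dY: "L2 (past t) (dY t i)" if "i < n" for i
    unfolding dY_def using that by (intro L2_diff L2_g y h)
  show ub: "L2 (past t) (ubar t)" unfolding ubar_def by (intro L2_scaleR L2_diff L2_add u y L2_gF)
  show q: "L2 (past t) (qt t)" unfolding qt_def by (intro L2_scaleR L2_diff L2_add w y k)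
  have jY: "\<And>i. i < n \<Longrightarrow> SrcY t i \<in> rel_srcs n - past t" "inj_on (SrcY t) {..<n}"
    by (auto simp: rel_srcs_mem fresh inj_on_def)
  have lawY: "\<And>i. i < n \<Longrightarrow> distr M (PY i) (sy t i) = PY i" using sy_law by blast
  note NYs = unbiased_noise_sum[where X = "dY t" and C = CY and s = "sy t" and P = PY and j = "SrcY t",
      OF past_subset(1) dY jY source_Y lawY CY_U omega_nonneg, folded NY_def pastY_def]
  show x: "L2 (pastY t) (xi t)" unfolding xi_def by (intro L2_scaleR NYs(4))
  show "expectation (\<lambda>\<omega>. xi t \<omega> \<bullet> Y \<omega>) = 0" if "L2 (past t) Y" for Y
  proof -
    have "expectation (\<lambda>\<omega>. (\<Sum>i<n. NY t i \<omega>) \<bullet> Y \<omega>) = 0" using that by (intro NYs(5))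
    thus ?thesis by (simp add: xi_def)
  qed
  show "msq (xi t) \<le> omega / (real n)\<^sup>2 * (\<Sum>i<n. msq (dY t i))"
  proof -
    have "msq (\<lambda>\<omega>. \<Sum>i<n. NY t i \<omega>) \<le> omega * (\<Sum>i<n. msq (dY t i))" by (rule NYs(6))
    thus ?thesis unfolding xi_def msq_scaleR by (simp add: power_divide divide_right_mono)
  qed
  show un: "L2 (pastY t) (un t)" unfolding un_def by (intro L2_diff L2_scaleR x L2_past(1) ub)
  show xn: "L2 (pastY t) (xn t)" unfolding xn_def by (intro L2_add L2_scaleR un L2_past(1) z)
  have uq: "L2 (pastY t) (\<lambda>\<omega>. un t \<omega> - qt t \<omega>)" by (intro L2_diff un L2_past(1) q)
  have CPm: "(\<lambda>(a, x). CP a x) \<in> borel_measurable (PP \<Otimes>\<^sub>M borel)"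
    and var: "(\<integral>\<^sup>+ a. ennreal ((norm (CP a x - x))\<^sup>2) \<partial>PP) \<le> ennreal ((1 - alpha) * (norm x)\<^sup>2)" for x
    using CP_B by (auto simp: biased_compressor_def)
  have lawP: "distr M PP (sP t) = PP" using sP_law by blast
  have "0 \<le> 1 - alpha" using alpha by simp
  note cp = compressed_L2[OF uq rel_srcs_mem(3) fresh(2) source_P lawP CPm this var, folded pastP_def]
  \<comment> \<open>The auxiliary point q cancels: w - u is exactly the error of compressing u - q.
    Hence a contraction in mean square is enough, and no unbiasedness of the server compressor is
    used.\<close>
  have wu: "wt (Suc t) \<omega> - ut (Suc t) \<omega> = CP (sP t \<omega>) (un t \<omega> - qt t \<omega>) - (un t \<omega> - qt t \<omega>)" for \<omega>
    by (simp add: wt_Suc ut_Suc)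
  show "msq (\<lambda>\<omega>. wt (Suc t) \<omega> - ut (Suc t) \<omega>) \<le> (1 - alpha) * msq (\<lambda>\<omega>. un t \<omega> - qt t \<omega>)"
    unfolding wu by (rule cp(2))
  have we: "wt (Suc t) = (\<lambda>\<omega>. (CP (sP t \<omega>) (un t \<omega> - qt t \<omega>) - (un t \<omega> - qt t \<omega>)) + un t \<omega>)"
    by (simp add: wt_Suc fun_eq_iff)
  have w': "L2 (pastP t) (wt (Suc t))" unfolding we by (intro L2_add cp(1) L2_past(2) un)
  have ze: "zt (Suc t) = (\<lambda>\<omega>. if coin t \<omega> then xn t \<omega> else zt t \<omega>)" by (simp add: zt_Suc fun_eq_iff)
  show z': "L2 (pastC t) (zt (Suc t))" unfolding ze pastC_def
    by (intro L2_coin rel_srcs_mem source_C L2_past(2,6) xn z)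
  have ke: "kt (Suc t) = (\<lambda>\<omega>. if coin t \<omega> then vt t \<omega> else kt t \<omega>)" by (simp add: kt_Suc fun_eq_iff)
  have k': "L2 (pastC t) (kt (Suc t))" unfolding ke pastC_def
    by (intro L2_coin rel_srcs_mem source_C L2_past(6) v k)
  show dZ: "L2 (pastC t) (dZ t i)" if "i < n" for i
    unfolding dZ_def using that by (intro L2_diff L2_g z' L2_past(4) h)
  have jZ: "\<And>i. i < n \<Longrightarrow> SrcZ t i \<in> rel_srcs n - pastC t" "inj_on (SrcZ t) {..<n}"
    by (auto simp: rel_srcs_mem fresh inj_on_def)
  have lawZ: "\<And>i. i < n \<Longrightarrow> distr M (PZ i) (sz t i) = PZ i" using sz_law by blast
  note NZs = unbiased_noise_sum[where X = "dZ t" and C = CZ and s = "sz t" and P = PZ and j = "SrcZ t",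
      OF past_subset(4) dZ jZ source_Z lawZ CZ_U omega_nonneg, folded NZ_def]
  show NZ: "L2 (past (Suc t)) (NZ t i)" if "i < n" for i using that by (intro L2_past(11) NZs(1))
  show "msq (NZ t i) \<le> omega * msq (dZ t i)" if "i < n" for i using that by (intro NZs(2))
  show "expectation (\<lambda>\<omega>. NZ t i \<omega> \<bullet> Y \<omega>) = 0" if "i < n" "L2 (pastC t) Y" for i Y
    using that by (intro NZs(3))
  show zeta: "L2 (past (Suc t)) (zeta t)" unfolding zeta_def by (intro L2_scaleR L2_past(11) NZs(4))
  show "expectation (\<lambda>\<omega>. zeta t \<omega> \<bullet> Y \<omega>) = 0" if "L2 (pastC t) Y" for Y
  proof -
    have "expectation (\<lambda>\<omega>. (\<Sum>i<n. NZ t i \<omega>) \<bullet> Y \<omega>) = 0" using that by (intro NZs(5))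
    thus ?thesis by (simp add: zeta_def)
  qed
  show "msq (zeta t) \<le> omega / (real n)\<^sup>2 * (\<Sum>i<n. msq (dZ t i))"
  proof -
    have "msq (\<lambda>\<omega>. \<Sum>i<n. NZ t i \<omega>) \<le> omega * (\<Sum>i<n. msq (dZ t i))" by (rule NZs(6))
    thus ?thesis unfolding zeta_def msq_scaleR by (simp add: power_divide divide_right_mono)
  qed
  have "L2 (past (Suc t)) (wt (Suc t))" by (rule L2_past(8)[OF w'])
  moreover have z'': "L2 (past (Suc t)) (zt (Suc t))" by (rule L2_past(9)[OF z'])
  moreover have "L2 (past (Suc t)) (ut (Suc t))"
    using L2_past(7)[OF un] by (simp add: ut_Suc[abs_def])
  moreover have "L2 (past (Suc t)) (kt (Suc t))" by (rule L2_past(9)[OF k'])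
  moreover have "L2 (past (Suc t)) (vt (Suc t))"
    unfolding vt_Suc[abs_def] by (intro L2_add L2_scaleR L2_gF z'' zeta L2_past(10) v)
  moreover have "L2 (past (Suc t)) (ht (Suc t) i)" if "i < n" for i
    unfolding ht_Suc[abs_def] using that by (intro L2_add L2_scaleR NZ L2_past(9) dZ L2_past(10) h)
  ultimately show "state_L2 (Suc t)" by (simp add: state_L2_def)
qed

lemma state_L2: "state_L2 t"
proof (induction t)
  case 0
  have "past 0 \<subseteq> rel_srcs n" by (rule past_subset)
  thus ?case unfolding state_L2_def state_defs[abs_def] St_def by (simp add: L2_const)
qed (rule state_L2_Suc)

end

context noise_sources
begin

lemma msq_commute: "msq (\<lambda>\<omega>. X \<omega> - Y \<omega>) = msq (\<lambda>\<omega>. Y \<omega> - X \<omega>)"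
  by (simp add: norm_minus_commute)

lemma msq_triangle:
  assumes "L2 J X" "L2 J Y" "L2 J Z" "s > 0"
  shows "msq (\<lambda>\<omega>. X \<omega> - Z \<omega>) \<le> (1 + s) * msq (\<lambda>\<omega>. X \<omega> - Y \<omega>) + (1 + 1 / s) * msq (\<lambda>\<omega>. Z \<omega> - Y \<omega>)"
  using msq_add_le[OF L2_diff[OF assms(1,2)] L2_diff[OF assms(2,3)] assms(4)]
  by (simp add: msq_commute[of Z Y])

lemma msq_nonneg: "msq X \<ge> 0"
  by simp

lemma expectation_avg_msq:
  assumes "\<And>i. i < n \<Longrightarrow> L2 J (X i)"
  shows "expectation (\<lambda>\<omega>. (1 / real n) * (\<Sum>i<n. (norm (X i \<omega>))\<^sup>2)) = (1 / real n) * (\<Sum>i<n. msq (X i))"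
    and "integrable M (\<lambda>\<omega>. (1 / real n) * (\<Sum>i<n. (norm (X i \<omega>))\<^sup>2))"
proof -
  have i: "integrable M (\<lambda>\<omega>. (norm (X i \<omega>))\<^sup>2)" if "i < n" for i using L2D(4)[OF assms[OF that]] .
  have "expectation (\<lambda>\<omega>. \<Sum>i<n. (norm (X i \<omega>))\<^sup>2) = (\<Sum>i<n. msq (X i))"
    by (rule Bochner_Integration.integral_sum) (use i in auto)
  thus "expectation (\<lambda>\<omega>. (1 / real n) * (\<Sum>i<n. (norm (X i \<omega>))\<^sup>2)) = (1 / real n) * (\<Sum>i<n. msq (X i))"
    by simp
  show "integrable M (\<lambda>\<omega>. (1 / real n) * (\<Sum>i<n. (norm (X i \<omega>))\<^sup>2))"
    by (intro integrable_mult_right Bochner_Integration.integrable_sum) (use i in auto)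
qed

end

section \<open>Recursions of the potentials in expectation\<close>

context two_direction
begin

abbreviation EB :: "('m \<Rightarrow> 'a) \<Rightarrow> ('m \<Rightarrow> 'a) \<Rightarrow> real" where
  "EB X Y \<equiv> expectation (\<lambda>\<omega>. bregman F gF (X \<omega>) (Y \<omega>))"

lemma continuous_on_F: "continuous_on UNIV F"
  by (rule continuous_at_imp_continuous_on) (use grad_F has_derivative_continuous in blast)

text \<open>The divergence lies between 0 and a quadratic, so square integrability of the two points
  suffices.\<close>

lemma integrable_bregman:
  assumes X: "L2 J X" and Y: "L2 J Y"
  shows "integrable M (\<lambda>\<omega>. bregman F gF (X \<omega>) (Y \<omega>))"
proof (rule Bochner_Integration.integrable_bound)
  show "integrable M (\<lambda>\<omega>. L / 2 * (norm (X \<omega> - Y \<omega>))\<^sup>2)"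
    using L2D(4)[OF L2_diff[OF X Y]] by simp
  have [measurable]: "F \<in> borel_measurable borel"
    by (rule borel_measurable_continuous_onI[OF continuous_on_F])
  have [measurable]: "X \<in> borel_measurable M" "Y \<in> borel_measurable M" "(\<lambda>\<omega>. gF (Y \<omega>)) \<in> borel_measurable M"
    using L2D(3)[OF X] L2D(3)[OF Y] L2D(3)[OF L2_gF[OF Y]] by auto
  show "(\<lambda>\<omega>. bregman F gF (X \<omega>) (Y \<omega>)) \<in> borel_measurable M"
    unfolding bregman_def by measurable
  show "AE \<omega> in M. norm (bregman F gF (X \<omega>) (Y \<omega>)) \<le> norm (L / 2 * (norm (X \<omega> - Y \<omega>))\<^sup>2)"
    using bregman_F_nonneg bregman_F_le L_nonneg by simp
qed

text \<open>\<open>F\<close> is an affine function plus its divergence from 0; both parts are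
  integrable at a square-integrable point.\<close>

lemma integrable_F:
  assumes X: "L2 J X"
  shows "integrable M (\<lambda>\<omega>. F (X \<omega>))" "(\<lambda>\<omega>. F (X \<omega>)) \<in> borel_measurable (hist J)"
proof -
  have c: "L2 J (\<lambda>_. c)" for c :: 'a by (rule L2_const[OF L2D(1)[OF X]])
  have e: "F x = F 0 + gF 0 \<bullet> x + bregman F gF x 0" for x by (simp add: bregman_def)
  show "integrable M (\<lambda>\<omega>. F (X \<omega>))"
    using integrable_bregman[OF X c] L2_integrable_inner[OF c X, of "gF 0"]
    by (subst e) simp
  show "(\<lambda>\<omega>. F (X \<omega>)) \<in> borel_measurable (hist J)"
    by (rule measurable_compose[OF L2D(2)[OF X] borel_measurable_continuous_onI[OF continuous_on_F]])
qed

lemma EB_nonneg: "EB X Y \<ge> 0"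
  by (intro Bochner_Integration.integral_nonneg bregman_F_nonneg)

lemma EB_le:
  assumes X: "L2 J X" and Y: "L2 J Y"
  shows "EB X Y \<le> L / 2 * msq (\<lambda>\<omega>. X \<omega> - Y \<omega>)"
proof -
  have "EB X Y \<le> expectation (\<lambda>\<omega>. L / 2 * (norm (X \<omega> - Y \<omega>))\<^sup>2)"
    using L2D(4)[OF L2_diff[OF X Y]] by (intro integral_mono integrable_bregman[OF X Y] bregman_F_le) simp
  thus ?thesis by simp
qed

lemma msq_gF_le:
  assumes X: "L2 J X" and Y: "L2 J Y"
  shows "msq (\<lambda>\<omega>. gF (X \<omega>) - gF (Y \<omega>)) \<le> 2 * L * EB X Y"
proof -
  have "msq (\<lambda>\<omega>. gF (X \<omega>) - gF (Y \<omega>)) \<le> expectation (\<lambda>\<omega>. 2 * L * bregman F gF (X \<omega>) (Y \<omega>))"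
    by (intro integral_mono gF_diff_le L2D(4)[OF L2_diff[OF L2_gF[OF X] L2_gF[OF Y]]]
        integrable_mult_right integrable_bregman[OF X Y])
  thus ?thesis by simp
qed

lemma avg_msq_g_le:
  assumes X: "L2 J X" and Y: "L2 J Y"
  shows "(1 / real n) * (\<Sum>i<n. msq (\<lambda>\<omega>. g i (X \<omega>) - g i (Y \<omega>))) \<le> 2 * Lmax * EB X Y"
proof -
  have d: "L2 J (\<lambda>\<omega>. g i (X \<omega>) - g i (Y \<omega>))" if "i < n" for i
    using that by (intro L2_diff L2_g X Y)
  have "(1 / real n) * (\<Sum>i<n. msq (\<lambda>\<omega>. g i (X \<omega>) - g i (Y \<omega>)))
      = expectation (\<lambda>\<omega>. (1 / real n) * (\<Sum>i<n. (norm (g i (X \<omega>) - g i (Y \<omega>)))\<^sup>2))"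
    by (rule expectation_avg_msq(1)[symmetric]) (rule d)
  also have "\<dots> \<le> expectation (\<lambda>\<omega>. 2 * Lmax * bregman F gF (X \<omega>) (Y \<omega>))"
  proof (intro integral_mono avg_g_diff_le)
    show "integrable M (\<lambda>\<omega>. (1 / real n) * (\<Sum>i<n. (norm (g i (X \<omega>) - g i (Y \<omega>)))\<^sup>2))"
      by (rule expectation_avg_msq(2)) (rule d)
    show "integrable M (\<lambda>\<omega>. 2 * Lmax * bregman F gF (X \<omega>) (Y \<omega>))"
      by (intro integrable_mult_right integrable_bregman[OF X Y])
  qed
  finally show ?thesis by simp
qed

text \<open>The letters correspond to the real variables of \<open>lyapunov_step\<close>, with
  \<open>eX\<close> for \<open>fx\<close>, \<open>eN\<close> for \<open>Nv\<close> and
  \<open>eB\<close> for \<open>B1\<close>. \<open>eB\<close> and \<open>eG\<close> measure the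
  gradient change from z to the candidate x, whether or not the coin accepts it.\<close>

definition eF :: "nat \<Rightarrow> real" where "eF t = expectation (\<lambda>\<omega>. F (zt t \<omega>) - F xstar)"
definition eH :: "nat \<Rightarrow> real" where "eH t = (1 / real n) * (\<Sum>i<n. msq (\<lambda>\<omega>. ht t i \<omega> - g i (zt t \<omega>)))"
definition eW :: "nat \<Rightarrow> real" where "eW t = msq (\<lambda>\<omega>. wt t \<omega> - ut t \<omega>)"
definition eK :: "nat \<Rightarrow> real" where "eK t = msq (\<lambda>\<omega>. kt t \<omega> - gF (zt t \<omega>))"
definition eN :: "nat \<Rightarrow> real" where "eN t = msq (\<lambda>\<omega>. vt t \<omega> - gF (zt t \<omega>))"
definition eU :: "nat \<Rightarrow> real" where "eU t = msq (\<lambda>\<omega>. ut t \<omega> - xstar)"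
definition eX :: "nat \<Rightarrow> real" where "eX t = expectation (\<lambda>\<omega>. F (xn t \<omega>) - F xstar)"
definition eD :: "nat \<Rightarrow> real" where "eD t = EB (zt t) (yt t)"
definition eV :: "nat \<Rightarrow> real" where "eV t = msq (\<lambda>\<omega>. un t \<omega> - ut t \<omega>)"
definition eQ :: "nat \<Rightarrow> real" where "eQ t = msq (\<lambda>\<omega>. un t \<omega> - wt t \<omega>)"
definition eB :: "nat \<Rightarrow> real" where "eB t = msq (\<lambda>\<omega>. gF (xn t \<omega>) - gF (zt t \<omega>))"
definition eG :: "nat \<Rightarrow> real" where "eG t = (1 / real n) * (\<Sum>i<n. msq (\<lambda>\<omega>. g i (xn t \<omega>) - g i (zt t \<omega>)))"
definition eZ :: "nat \<Rightarrow> real" where "eZ t = (1 / real n) * (\<Sum>i<n. msq (dZ t i))"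

lemma distribute_weights:
  fixes a b c x y z :: real
  shows "c * (a * x + b * y + z) = c * a * x + c * b * y + c * z" "c * (a * x + z) = c * a * x + c * z"
  by (simp_all add: algebra_simps)

lemma sum_linear_combination:
  fixes x y :: "nat \<Rightarrow> real"
  shows "c * (\<Sum>i\<in>I. a * x i + b * y i) = a * (c * (\<Sum>i\<in>I. x i)) + b * (c * (\<Sum>i\<in>I. y i))"
  by (simp add: sum.distrib sum_distrib_left distrib_left mult_ac)

lemma avg_mono: "(\<And>i. i < n \<Longrightarrow> x i \<le> y i) \<Longrightarrow> (1 / real n) * (\<Sum>i<n. x i) \<le> (1 / real n) * (\<Sum>i<n. y i)"
  by (intro mult_left_mono sum_mono) auto

lemma xn_minus_yt: "xn t \<omega> - yt t \<omega> = th t *\<^sub>R (un t \<omega> - wt t \<omega>)"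
  by (simp add: xn_def yt_def algebra_simps)

lemma EB_xn_le: "EB (xn t) (yt t) \<le> L / 2 * (th t)\<^sup>2 * eQ t"
  using EB_le[OF L2_xn[OF state_L2] L2_past(1)[OF L2_yt[OF state_L2]], of t]
  unfolding xn_minus_yt msq_scaleR eQ_def by simp

lemma eQ_le: "eQ t \<le> 2 * eV t + 2 * eW t"
  using msq_triangle[OF L2_un[OF state_L2] L2_past(1)[OF L2_ut[OF state_L2]] L2_past(1)[OF L2_wt[OF state_L2]], of 1 t]
  by (simp add: eQ_def eV_def eW_def)

lemma eB_le: "eB t \<le> 2 * L\<^sup>2 * (th t)\<^sup>2 * eQ t + 4 * L * eD t"
proof -
  note x = L2_xn[OF state_L2, of t] and y = L2_past(1)[OF L2_yt[OF state_L2], of t]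
    and z = L2_past(1)[OF L2_zt[OF state_L2], of t]
  have "eB t \<le> 2 * msq (\<lambda>\<omega>. gF (xn t \<omega>) - gF (yt t \<omega>)) + 2 * msq (\<lambda>\<omega>. gF (zt t \<omega>) - gF (yt t \<omega>))"
    using msq_triangle[OF L2_gF[OF x] L2_gF[OF y] L2_gF[OF z], of 1] by (simp add: eB_def)
  moreover have "msq (\<lambda>\<omega>. gF (zt t \<omega>) - gF (yt t \<omega>)) \<le> 2 * L * eD t"
    unfolding eD_def by (rule msq_gF_le[OF z y])
  moreover have "msq (\<lambda>\<omega>. gF (xn t \<omega>) - gF (yt t \<omega>)) \<le> 2 * L * (L / 2 * (th t)\<^sup>2 * eQ t)"
    using msq_gF_le[OF x y] EB_xn_le[of t] L_nonneg
    by (meson mult_left_mono mult_nonneg_nonneg order_trans zero_le_numeral)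
  ultimately show ?thesis by (simp add: power2_eq_square)
qed

lemma eG_le: "eG t \<le> 2 * Lmax * L * (th t)\<^sup>2 * eQ t + 4 * Lmax * eD t"
proof -
  note x = L2_xn[OF state_L2, of t] and y = L2_past(1)[OF L2_yt[OF state_L2], of t]
    and z = L2_past(1)[OF L2_zt[OF state_L2], of t]
  have "eG t \<le> (1 / real n) * (\<Sum>i<n. 2 * msq (\<lambda>\<omega>. g i (xn t \<omega>) - g i (yt t \<omega>)) + 2 * msq (\<lambda>\<omega>. g i (zt t \<omega>) - g i (yt t \<omega>)))"
    unfolding eG_def
    by (rule avg_mono) (use msq_triangle[OF L2_g[OF _ x] L2_g[OF _ y] L2_g[OF _ z], of _ _ _ 1] in simp)
  also have "\<dots> = 2 * ((1 / real n) * (\<Sum>i<n. msq (\<lambda>\<omega>. g i (xn t \<omega>) - g i (yt t \<omega>))))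
      + 2 * ((1 / real n) * (\<Sum>i<n. msq (\<lambda>\<omega>. g i (zt t \<omega>) - g i (yt t \<omega>))))"
    by (rule sum_linear_combination)
  finally have "eG t \<le> 2 * (2 * Lmax * EB (xn t) (yt t)) + 2 * (2 * Lmax * eD t)"
    using avg_msq_g_le[OF x y] avg_msq_g_le[OF z y] unfolding eD_def by linarith
  moreover have "Lmax * EB (xn t) (yt t) \<le> Lmax * (L / 2 * (th t)\<^sup>2 * eQ t)"
    by (intro mult_left_mono EB_xn_le Lmax_nonneg)
  ultimately show ?thesis by simp
qed

text \<open>Independence of the workers contributes the factor 1 / n. The compressed vector is split
  at z into the shift error and a gradient difference, and the latter is controlled by the
  divergence.\<close>

lemma xi_le: "msq (xi t) \<le> 2 * omega / real n * eH t + 4 * omega * Lmax / real n * eD t"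
proof -
  note y = L2_yt[OF state_L2, of t] and z = L2_zt[OF state_L2, of t] and h = L2_ht[OF state_L2, of _ t]
  have "(1 / real n) * (\<Sum>i<n. msq (dY t i))
      \<le> (1 / real n) * (\<Sum>i<n. 2 * msq (\<lambda>\<omega>. g i (zt t \<omega>) - g i (yt t \<omega>)) + 2 * msq (\<lambda>\<omega>. ht t i \<omega> - g i (zt t \<omega>)))"
  proof (rule avg_mono)
    fix i assume i: "i < n"
    show "msq (dY t i) \<le> 2 * msq (\<lambda>\<omega>. g i (zt t \<omega>) - g i (yt t \<omega>)) + 2 * msq (\<lambda>\<omega>. ht t i \<omega> - g i (zt t \<omega>))"
      using msq_triangle[OF L2_g[OF i y] L2_g[OF i z] h[OF i], of 1]
      by (simp add: dY_def msq_commute[of "\<lambda>\<omega>. g i (yt t \<omega>)"])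
  qed
  also have "\<dots> = 2 * ((1 / real n) * (\<Sum>i<n. msq (\<lambda>\<omega>. g i (zt t \<omega>) - g i (yt t \<omega>)))) + 2 * eH t"
    unfolding eH_def by (rule sum_linear_combination)
  finally have le: "(1 / real n) * (\<Sum>i<n. msq (dY t i)) \<le> 4 * Lmax * eD t + 2 * eH t"
    using avg_msq_g_le[OF z y] unfolding eD_def by linarith
  have "msq (xi t) \<le> omega / real n * ((1 / real n) * (\<Sum>i<n. msq (dY t i)))"
    using msq_xi[OF state_L2, of t] by (simp add: power2_eq_square)
  also have "\<dots> \<le> omega / real n * (4 * Lmax * eD t + 2 * eH t)"
    using le omega_nonneg by (intro mult_left_mono) auto
  finally show ?thesis by (simp add: algebra_simps add_divide_distrib)
qed

lemma eF_Suc: "eF (Suc t) = p * eX t + (1 - p) * eF t"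
proof -
  have "eF (Suc t) = expectation (\<lambda>\<omega>. if coin t \<omega> then F (xn t \<omega>) - F xstar else F (zt t \<omega>) - F xstar)"
    unfolding eF_def zt_Suc by (intro Bochner_Integration.integral_cong) auto
  also have "\<dots> = p * eX t + (1 - p) * eF t"
    unfolding eF_def eX_def
    using integrable_F[OF L2_past(2)[OF L2_xn[OF state_L2]], of t]
      integrable_F[OF L2_past(6)[OF L2_zt[OF state_L2]], of t] coin_law[of t]
    by (intro fresh_coin(2)[OF _ _ _ _ past_subset(3) rel_srcs_mem(4) fresh(3) source_C]) auto
  finally show ?thesis .
qed

lemma eX_le: "eX t \<le> (1 - th t) * (eF t - eD t)
   + th t * (A t / 2 * eU t - (A t + mu) / 2 * eU (Suc t) - A t / 2 * eV t)
   + th t * msq (xi t) / (A t + mu) + L / 2 * (th t)\<^sup>2 * eQ t"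
proof -
  note y = L2_past(1)[OF L2_yt[OF state_L2], of t] and z = L2_past(1)[OF L2_zt[OF state_L2], of t]
    and u = L2_past(1)[OF L2_ut[OF state_L2], of t] and w = L2_past(1)[OF L2_wt[OF state_L2], of t]
    and un = L2_un[OF state_L2, of t] and x = L2_xn[OF state_L2, of t] and xi = L2_xi[OF state_L2, of t]
  have c: "L2 (pastY t) (\<lambda>_. xstar)" "L2 (past t) (\<lambda>_. xstar)" by (intro L2_const past_subset)+
  let ?R = "\<lambda>\<omega>. (1 - th t) * ((F (zt t \<omega>) - F xstar) - bregman F gF (zt t \<omega>) (yt t \<omega>))
      + th t * (A t / 2 * (norm (ut t \<omega> - xstar))\<^sup>2 - (A t + mu) / 2 * (norm (un t \<omega> - xstar))\<^sup>2
          - A t / 2 * (norm (un t \<omega> - ut t \<omega>))\<^sup>2)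
      - th t * (xi t \<omega> \<bullet> (un t \<omega> - xstar)) + L / 2 * (th t)\<^sup>2 * (norm (un t \<omega> - wt t \<omega>))\<^sup>2"
  have le: "F (xn t \<omega>) - F xstar \<le> ?R \<omega>" for \<omega>
  proof (rule accelerated_descent[OF strong bregman_F_le])
    show "un t \<omega> = (1 / (A t + mu)) *\<^sub>R (A t *\<^sub>R ut t \<omega> + mu *\<^sub>R yt t \<omega> - (gF (yt t \<omega>) + xi t \<omega>))"
      by (simp add: un_def ubar_def algebra_simps)
  qed (use th[of t] mu_nonneg A_mu_pos yt_def xn_def in auto)
  note i = integrable_F(1)[OF z] integrable_bregman[OF z y] L2D(4)[OF L2_diff[OF u c(1)]]
    L2D(4)[OF L2_diff[OF un c(1)]] L2D(4)[OF L2_diff[OF un u]]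
    L2_integrable_inner[OF xi L2_diff[OF un c(1)]] L2D(4)[OF L2_diff[OF un w]]
  have "eX t \<le> expectation ?R"
    unfolding eX_def using integrable_F(1)[OF x] i by (intro integral_mono le) simp_all
  also have "\<dots> = (1 - th t) * (eF t - eD t)
     + th t * (A t / 2 * eU t - (A t + mu) / 2 * eU (Suc t) - A t / 2 * eV t)
     - th t * expectation (\<lambda>\<omega>. xi t \<omega> \<bullet> (un t \<omega> - xstar)) + L / 2 * (th t)\<^sup>2 * eQ t"
    using i unfolding eF_def eD_def eU_def eV_def eQ_def ut_Suc
    by (simp add: prob_space)
  \<comment> \<open>The noise is correlated with the new iterate, but only through the explicit
    multiple of itself: \<open>ubar\<close> is known before the seeds and orthogonal to the noise.
    What remains is the variance divided by A + mu.\<close>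
  also have "expectation (\<lambda>\<omega>. xi t \<omega> \<bullet> (un t \<omega> - xstar)) = - (msq (xi t) / (A t + mu))"
  proof -
    have e: "xi t \<omega> \<bullet> (un t \<omega> - xstar) = xi t \<omega> \<bullet> (ubar t \<omega> - xstar) - (norm (xi t \<omega>))\<^sup>2 / (A t + mu)" for \<omega>
      by (simp add: un_def inner_diff_right power2_norm_eq_inner)
    have ub: "L2 (past t) (\<lambda>\<omega>. ubar t \<omega> - xstar)" by (intro L2_diff L2_ubar[OF state_L2] c)
    show ?thesis unfolding e
      using L2_integrable_inner[OF xi ub] L2D(4)[OF xi] xi_orthogonal[OF state_L2 ub] by simp
  qed
  finally show ?thesis by simp
qed

lemma eW_Suc_le: "eW (Suc t) \<le> (1 - alpha / 2) * eW t
   + 2 / alpha / (A t + mu)\<^sup>2 * (2 * eK t + 4 * L * eD t) + msq (xi t) / (A t + mu)\<^sup>2"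
proof -
  define c where "c = A t + mu"
  note y = L2_yt[OF state_L2, of t] and z = L2_zt[OF state_L2, of t] and k = L2_kt[OF state_L2, of t]
    and u = L2_ut[OF state_L2, of t] and w = L2_wt[OF state_L2, of t] and xi = L2_xi[OF state_L2, of t]
    and ub = L2_ubar[OF state_L2, of t] and q = L2_qt[OF state_L2, of t]
  have c: "c > 0" "0 \<le> A t" "A t \<le> c" using A_mu_pos[of t] A_pos[of t] mu_nonneg by (auto simp: c_def)
  have s: "un t \<omega> - qt t \<omega> = (ubar t \<omega> - qt t \<omega>) + (- (1 / c)) *\<^sub>R xi t \<omega>" for \<omega>
    by (simp add: un_def c_def)
  have uq: "L2 (pastY t) (\<lambda>\<omega>. ubar t \<omega> - qt t \<omega>)" by (intro L2_past(1) L2_diff ub q)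
  \<comment> \<open>By orthogonality the variance is added with factor 1, without the loss of order
    1 / alpha that Young's inequality would cause.\<close>
  have "expectation (\<lambda>\<omega>. (ubar t \<omega> - qt t \<omega>) \<bullet> ((- (1 / c)) *\<^sub>R xi t \<omega>)) = 0"
    using xi_orthogonal[OF state_L2 L2_diff[OF ub q]] by (simp add: inner_commute)
  hence 1: "msq (\<lambda>\<omega>. un t \<omega> - qt t \<omega>) = msq (\<lambda>\<omega>. ubar t \<omega> - qt t \<omega>) + msq (xi t) / c\<^sup>2"
    unfolding s msq_add[OF uq L2_scaleR[OF xi]] msq_scaleR by (simp add: power_divide)
  \<comment> \<open>The two prox maps share their coefficients and the point y, so y drops out. The
    distance u - w is multiplied by A / (A + mu) \<le> 1, and the rest is the error of k as an
    estimate of the gradient at y.\<close>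
  have e: "ubar t \<omega> - qt t \<omega> = (1 / c) *\<^sub>R (A t *\<^sub>R (ut t \<omega> - wt t \<omega>) + (kt t \<omega> - gF (yt t \<omega>)))" for \<omega>
    by (simp add: ubar_def qt_def c_def algebra_simps flip: scaleR_add_right scaleR_diff_right)
  have ky: "msq (\<lambda>\<omega>. kt t \<omega> - gF (yt t \<omega>)) \<le> 2 * eK t + 4 * L * eD t"
    using msq_triangle[OF k L2_gF[OF z] L2_gF[OF y], of 1] msq_gF_le[OF z y]
    unfolding eK_def eD_def by (simp add: msq_commute[of "\<lambda>\<omega>. gF (yt t \<omega>)"])
  have "msq (\<lambda>\<omega>. ubar t \<omega> - qt t \<omega>)
      \<le> (1 / c)\<^sup>2 * ((1 + alpha / 2) * msq (\<lambda>\<omega>. A t *\<^sub>R (ut t \<omega> - wt t \<omega>))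
         + (1 + 1 / (alpha / 2)) * msq (\<lambda>\<omega>. kt t \<omega> - gF (yt t \<omega>)))"
    unfolding e msq_scaleR[of "1 / c"] using alpha
    by (intro mult_left_mono msq_add_le[OF L2_scaleR[OF L2_diff[OF u w]] L2_diff[OF k L2_gF[OF y]]]) auto
  also have "\<dots> \<le> (1 + alpha / 2) * eW t + (1 + 2 / alpha) * ((2 * eK t + 4 * L * eD t) / c\<^sup>2)"
  proof -
    have "(1 / c)\<^sup>2 * ((1 + alpha / 2) * msq (\<lambda>\<omega>. A t *\<^sub>R (ut t \<omega> - wt t \<omega>))
         + (1 + 1 / (alpha / 2)) * msq (\<lambda>\<omega>. kt t \<omega> - gF (yt t \<omega>)))
      = (A t / c)\<^sup>2 * ((1 + alpha / 2) * eW t) + (1 + 2 / alpha) * (msq (\<lambda>\<omega>. kt t \<omega> - gF (yt t \<omega>)) / c\<^sup>2)"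
      unfolding msq_scaleR eW_def by (simp add: msq_commute[of "wt t"] power_divide distrib_left)
    moreover have "(A t / c)\<^sup>2 * ((1 + alpha / 2) * eW t) \<le> 1 * ((1 + alpha / 2) * eW t)"
      using c alpha by (intro mult_right_mono power_le_one) (auto simp: eW_def)
    moreover have "(1 + 2 / alpha) * (msq (\<lambda>\<omega>. kt t \<omega> - gF (yt t \<omega>)) / c\<^sup>2)
        \<le> (1 + 2 / alpha) * ((2 * eK t + 4 * L * eD t) / c\<^sup>2)"
      using ky alpha by (intro mult_left_mono divide_right_mono) auto
    ultimately show ?thesis by linarith
  qed
  finally have 2: "msq (\<lambda>\<omega>. ubar t \<omega> - qt t \<omega>)
      \<le> (1 + alpha / 2) * eW t + (1 + 2 / alpha) * ((2 * eK t + 4 * L * eD t) / c\<^sup>2)" .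
  define R where "R = (2 * eK t + 4 * L * eD t) / c\<^sup>2"
  have R: "R \<ge> 0" unfolding R_def using EB_nonneg L_nonneg by (simp add: eK_def eD_def)
  have xi0: "msq (xi t) / c\<^sup>2 \<ge> 0" by simp
  have W: "eW t \<ge> 0" by (simp add: eW_def)
  have "eW (Suc t) \<le> (1 - alpha) * msq (\<lambda>\<omega>. un t \<omega> - qt t \<omega>)"
    unfolding eW_def by (rule msq_wt_Suc[OF state_L2])
  also have "\<dots> \<le> (1 - alpha) * ((1 + alpha / 2) * eW t + (1 + 2 / alpha) * R + msq (xi t) / c\<^sup>2)"
    using 1 2 alpha unfolding R_def by (intro mult_left_mono) auto
  also have "\<dots> = ((1 - alpha) * (1 + alpha / 2)) * eW t + ((1 - alpha) * (1 + 2 / alpha)) * R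
      + (1 - alpha) * (msq (xi t) / c\<^sup>2)"
    by (simp only: distribute_weights)
  \<comment> \<open>(1 - alpha)(1 + alpha/2) is at most 1 - alpha/2, and (1 - alpha)(1 + 2/alpha) is
    at most 2/alpha.\<close>
  also have "\<dots> \<le> (1 - alpha / 2) * eW t + 2 / alpha * R + 1 * (msq (xi t) / c\<^sup>2)"
    using alpha R xi0 W by (intro add_mono mult_right_mono) (auto simp: field_simps)
  finally show ?thesis unfolding R_def c_def by simp
qed

lemma eN_jump:
  assumes "s > 0"
  shows "msq (\<lambda>\<omega>. vt t \<omega> - gF (xn t \<omega>)) \<le> (1 + s) * eN t + (1 + 1 / s) * eB t"
  unfolding eN_def eB_def
  by (intro msq_triangle[where J = "pastY t"] L2_past(1) L2_vt[OF state_L2] L2_gF L2_zt[OF state_L2] L2_xn[OF state_L2] assms)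

text \<open>On heads, k takes over the old estimate v while z moves to the candidate x. The new
  error is therefore the error of v at the old z plus one gradient jump.\<close>

lemma eK_Suc_le: "eK (Suc t) \<le> (1 - p) * eK t + p * (2 * eN t + 2 * eB t)"
proof -
  have e: "kt (Suc t) \<omega> - gF (zt (Suc t) \<omega>)
      = (if coin t \<omega> then vt t \<omega> - gF (xn t \<omega>) else kt t \<omega> - gF (zt t \<omega>))" for \<omega>
    by (simp add: kt_Suc zt_Suc)
  have "eK (Suc t) = p * msq (\<lambda>\<omega>. vt t \<omega> - gF (xn t \<omega>)) + (1 - p) * eK t"
    unfolding eK_def e using coin_law[of t]
    by (intro msq_coin[where J = "pastP t" and j = "SrcC t"] L2_diff L2_gF L2_past(6) L2_vt[OF state_L2] L2_kt[OF state_L2]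
        L2_zt[OF state_L2] L2_past(2) L2_xn[OF state_L2] rel_srcs_mem fresh source_C) auto
  moreover have "p * msq (\<lambda>\<omega>. vt t \<omega> - gF (xn t \<omega>)) \<le> p * (2 * eN t + 2 * eB t)"
    using eN_jump[of 1 t] p by (intro mult_left_mono) auto
  ultimately show ?thesis by linarith
qed

lemma eZ_eq: "eZ t = p * ((1 / real n) * (\<Sum>i<n. msq (\<lambda>\<omega>. ht t i \<omega> - g i (xn t \<omega>)))) + (1 - p) * eH t"
proof -
  have "msq (dZ t i) = p * msq (\<lambda>\<omega>. ht t i \<omega> - g i (xn t \<omega>)) + (1 - p) * msq (\<lambda>\<omega>. ht t i \<omega> - g i (zt t \<omega>))"
    if i: "i < n" for i
  proof -
    have e: "ht t i \<omega> - g i (zt (Suc t) \<omega>)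
        = (if coin t \<omega> then ht t i \<omega> - g i (xn t \<omega>) else ht t i \<omega> - g i (zt t \<omega>))" for \<omega>
      by (simp add: zt_Suc)
    have "msq (dZ t i) = msq (\<lambda>\<omega>. ht t i \<omega> - g i (zt (Suc t) \<omega>))"
      unfolding dZ_def by (rule msq_commute)
    also have "\<dots> = p * msq (\<lambda>\<omega>. ht t i \<omega> - g i (xn t \<omega>)) + (1 - p) * msq (\<lambda>\<omega>. ht t i \<omega> - g i (zt t \<omega>))"
      unfolding e using coin_law[of t]
      by (intro msq_coin[where J = "pastP t" and j = "SrcC t"] L2_diff L2_g[OF i] L2_past(6) L2_ht[OF state_L2 i]
        L2_zt[OF state_L2] L2_past(2) L2_xn[OF state_L2] rel_srcs_mem fresh source_C) auto
    finally show ?thesis .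
  qed
  hence "(\<Sum>i<n. msq (dZ t i)) = (\<Sum>i<n. p * msq (\<lambda>\<omega>. ht t i \<omega> - g i (xn t \<omega>))
      + (1 - p) * msq (\<lambda>\<omega>. ht t i \<omega> - g i (zt t \<omega>)))"
    by (intro sum.cong) auto
  thus ?thesis unfolding eZ_def eH_def by (simp only: sum_linear_combination)
qed

text \<open>Only the heads branch is expanded, so the growth factor is 1 + p s and not 1 + s. The
  shift recursion takes s = beta / (2 p), the noise bound for v takes s = 1.\<close>

lemma eZ_le:
  assumes s: "s > 0"
  shows "eZ t \<le> (1 + p * s) * eH t + p * (1 + 1 / s) * eG t"
proof -
  have "(1 / real n) * (\<Sum>i<n. msq (\<lambda>\<omega>. ht t i \<omega> - g i (xn t \<omega>)))
      \<le> (1 / real n) * (\<Sum>i<n. (1 + s) * msq (\<lambda>\<omega>. ht t i \<omega> - g i (zt t \<omega>)) + (1 + 1 / s) * msq (\<lambda>\<omega>. g i (xn t \<omega>) - g i (zt t \<omega>)))"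
    by (intro avg_mono msq_triangle[where J = "pastY t"] L2_past(1) L2_ht[OF state_L2] L2_g L2_zt[OF state_L2] L2_xn[OF state_L2] s)
  also have "\<dots> = (1 + s) * eH t + (1 + 1 / s) * eG t"
    unfolding eH_def eG_def by (rule sum_linear_combination)
  finally have "eZ t \<le> p * ((1 + s) * eH t + (1 + 1 / s) * eG t) + (1 - p) * eH t"
    unfolding eZ_eq using p by (intro add_right_mono mult_left_mono) auto
  thus ?thesis by (simp add: algebra_simps)
qed

lemma nonneg: "eH t \<ge> 0" "eW t \<ge> 0" "eK t \<ge> 0" "eN t \<ge> 0" "eV t \<ge> 0" "eQ t \<ge> 0" "eB t \<ge> 0" "eG t \<ge> 0"
    "eD t \<ge> 0" "eZ t \<ge> 0"
  using EB_nonneg by (auto simp: eH_def eW_def eK_def eN_def eV_def eQ_def eB_def eG_def eZ_def eD_def intro!: divide_nonneg_nonneg sum_nonneg)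

lemma eH_Suc_le: "eH (Suc t) \<le> (1 - beta / 2) * eH t + p * (1 + 2 * p / beta) * eG t"
proof -
  \<comment> \<open>This bound on \<open>beta\<close> balances bias and noise: (1 - beta)^2 + beta^2
    omega = 1 - 2 beta + beta^2 (1 + omega), which is then at most 1 - beta.\<close>
  have b: "beta * (1 + omega) \<le> 1"
    using beta omega_nonneg by (simp add: field_simps)
  have "eH (Suc t) \<le> (1 / real n) * (\<Sum>i<n. (1 - beta) * msq (dZ t i))"
    unfolding eH_def
  proof (rule avg_mono)
    fix i assume i: "i < n"
    note dZ = L2_dZ[OF state_L2 i, of t] and NZ = L2_NZ[OF state_L2 i, of t]
    have e: "ht (Suc t) i \<omega> - g i (zt (Suc t) \<omega>) = (- (1 - beta)) *\<^sub>R dZ t i \<omega> + beta *\<^sub>R NZ t i \<omega>" for \<omega>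
      by (simp add: ht_Suc dZ_def algebra_simps)
    have "expectation (\<lambda>\<omega>. dZ t i \<omega> \<bullet> NZ t i \<omega>) = 0"
      using NZ_orthogonal[OF state_L2 i dZ] by (simp add: inner_commute)
    hence "msq (\<lambda>\<omega>. ht (Suc t) i \<omega> - g i (zt (Suc t) \<omega>)) = (1 - beta)\<^sup>2 * msq (dZ t i) + beta\<^sup>2 * msq (NZ t i)"
      unfolding e msq_add[OF L2_scaleR[OF dZ] L2_scaleR[OF NZ]] msq_scaleR
      by (simp add: power2_commute[of beta 1])
    also have "\<dots> \<le> (1 - beta)\<^sup>2 * msq (dZ t i) + beta\<^sup>2 * (omega * msq (dZ t i))"
      by (intro add_left_mono mult_left_mono msq_NZ[OF state_L2 i]) auto
    also have "\<dots> = (1 - 2 * beta + beta * (beta * (1 + omega))) * msq (dZ t i)"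
      by (simp add: power2_eq_square algebra_simps)
    also have "\<dots> \<le> (1 - beta) * msq (dZ t i)"
      using mult_left_mono[OF b, of beta] beta by (intro mult_right_mono) auto
    finally show "msq (\<lambda>\<omega>. ht (Suc t) i \<omega> - g i (zt (Suc t) \<omega>)) \<le> (1 - beta) * msq (dZ t i)" .
  qed
  also have "\<dots> = (1 - beta) * eZ t" by (simp add: eZ_def sum_distrib_left)
  also have "\<dots> \<le> (1 - beta) * ((1 + p * (beta / (2 * p))) * eH t + p * (1 + 1 / (beta / (2 * p))) * eG t)"
    using beta beta_le1 p by (intro mult_left_mono eZ_le) auto
  also have "\<dots> = ((1 - beta) * (1 + beta / 2)) * eH t + (1 - beta) * (p * (1 + 2 * p / beta) * eG t)"
    using p by (simp add: distrib_left)
  also have "\<dots> \<le> (1 - beta / 2) * eH t + 1 * (p * (1 + 2 * p / beta) * eG t)"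
    using beta p nonneg by (intro add_mono mult_right_mono) (auto simp: field_simps)
  finally show ?thesis by simp
qed

lemma eN_Suc_le: "eN (Suc t) \<le> (1 - tau / 2) * eN t + p * (1 + 2 * p / tau) * eB t
   + tau\<^sup>2 * omega / real n * (2 * eH t + 2 * p * eG t)"
proof -
  note z' = L2_zt_Suc[OF state_L2, of t] and v = L2_past(4)[OF L2_vt[OF state_L2], of t]
    and ze = L2_zeta[OF state_L2, of t]
  have vz: "L2 (pastC t) (\<lambda>\<omega>. vt t \<omega> - gF (zt (Suc t) \<omega>))" by (intro L2_diff v L2_gF z')
  have e: "vt (Suc t) \<omega> - gF (zt (Suc t) \<omega>) = (1 - tau) *\<^sub>R (vt t \<omega> - gF (zt (Suc t) \<omega>)) + tau *\<^sub>R zeta t \<omega>" for \<omega>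
    by (simp add: vt_Suc algebra_simps)
  have "expectation (\<lambda>\<omega>. ((1 - tau) *\<^sub>R (vt t \<omega> - gF (zt (Suc t) \<omega>))) \<bullet> (tau *\<^sub>R zeta t \<omega>)) = 0"
    using zeta_orthogonal[OF state_L2 vz] by (simp add: inner_commute)
  hence 1: "eN (Suc t) = (1 - tau)\<^sup>2 * msq (\<lambda>\<omega>. vt t \<omega> - gF (zt (Suc t) \<omega>)) + tau\<^sup>2 * msq (zeta t)"
    unfolding eN_def e msq_add[OF L2_scaleR[OF vz] L2_scaleR[OF ze]] msq_scaleR by simp
  have c: "vt t \<omega> - gF (zt (Suc t) \<omega>) = (if coin t \<omega> then vt t \<omega> - gF (xn t \<omega>) else vt t \<omega> - gF (zt t \<omega>))" for \<omega>
    by (simp add: zt_Suc)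
  have "msq (\<lambda>\<omega>. vt t \<omega> - gF (zt (Suc t) \<omega>)) = p * msq (\<lambda>\<omega>. vt t \<omega> - gF (xn t \<omega>)) + (1 - p) * eN t"
    unfolding eN_def c using coin_law[of t]
    by (intro msq_coin[where J = "pastP t" and j = "SrcC t"] L2_diff L2_gF L2_past(6) L2_vt[OF state_L2]
        L2_zt[OF state_L2] L2_past(2) L2_xn[OF state_L2] rel_srcs_mem fresh source_C) auto
  also have "\<dots> \<le> p * ((1 + tau / (2 * p)) * eN t + (1 + 1 / (tau / (2 * p))) * eB t) + (1 - p) * eN t"
    using p tau by (intro add_right_mono mult_left_mono eN_jump) auto
  also have "\<dots> = (1 + tau / 2) * eN t + p * (1 + 2 * p / tau) * eB t"
    using p tau by (simp add: field_simps)
  finally have 2: "msq (\<lambda>\<omega>. vt t \<omega> - gF (zt (Suc t) \<omega>)) \<le> (1 + tau / 2) * eN t + p * (1 + 2 * p / tau) * eB t" .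
  have "msq (zeta t) \<le> omega / real n * eZ t"
    using msq_zeta[OF state_L2, of t] by (simp add: eZ_def power2_eq_square)
  \<comment> \<open>No contraction has to survive in the noise term, so s = 1 is enough; it keeps
    the factor p in front of \<open>eG\<close>.\<close>
  also have "\<dots> \<le> omega / real n * ((1 + p * 1) * eH t + p * (1 + 1 / 1) * eG t)"
    using omega_nonneg by (intro mult_left_mono eZ_le) auto
  also have "\<dots> \<le> omega / real n * (2 * eH t + 2 * p * eG t)"
    using omega_nonneg p nonneg[of t] by (intro mult_left_mono add_mono mult_right_mono) auto
  finally have 3: "tau\<^sup>2 * msq (zeta t) \<le> tau\<^sup>2 * omega / real n * (2 * eH t + 2 * p * eG t)"
    using mult_left_mono[of _ _ "tau\<^sup>2"] by fastforce
  have t1: "(1 - tau)\<^sup>2 \<le> 1 - tau" "(1 - tau)\<^sup>2 \<le> 1"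
    using tau by (auto simp: power2_eq_square mult_left_le_one_le mult_le_one)
  have "(1 - tau)\<^sup>2 * (1 + tau / 2) \<le> (1 - tau) * (1 + tau / 2)"
    using t1 tau by (intro mult_right_mono) auto
  also have "\<dots> \<le> 1 - tau / 2" using tau by (simp add: field_simps)
  finally have t2: "(1 - tau)\<^sup>2 * (1 + tau / 2) \<le> 1 - tau / 2" .
  have "(1 - tau)\<^sup>2 * msq (\<lambda>\<omega>. vt t \<omega> - gF (zt (Suc t) \<omega>))
      \<le> (1 - tau)\<^sup>2 * ((1 + tau / 2) * eN t + p * (1 + 2 * p / tau) * eB t)"
    by (rule mult_left_mono[OF 2]) simp
  also have "\<dots> = ((1 - tau)\<^sup>2 * (1 + tau / 2)) * eN t + (1 - tau)\<^sup>2 * (p * (1 + 2 * p / tau) * eB t)"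
    by (simp only: distribute_weights)
  also have "\<dots> \<le> (1 - tau / 2) * eN t + 1 * (p * (1 + 2 * p / tau) * eB t)"
    using t1 t2 p tau nonneg[of t] by (intro add_mono mult_right_mono) auto
  finally show ?thesis using 1 3 by simp
qed

text \<open>The one-step bound is multiplied by the new Gamma. \<open>G_Suc_mult\<close> then
  produces the old Gamma and gamma, and \<open>A_mult\<close> turns gamma times the two prox
  coefficients into Lbar + Gamma mu with the old and the new Gamma.\<close>

lemma lyapunov_decrease:
  "G (Suc t) * (eF (Suc t) + sc.kappa * eH (Suc t) + sc.nu (th (Suc t)) * eW (Suc t)
      + sc.rho * eK (Suc t) + sc.lam * eN (Suc t)) + (Lbar + G (Suc t) * mu) / 2 * eU (Suc t)
   \<le> G t * (eF t + sc.kappa * eH t + sc.nu (th t) * eW t + sc.rho * eK t + sc.lam * eN t)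
      + (Lbar + G t * mu) / 2 * eU t" (is "_ * ?P' + _ \<le> _ * ?P + _")
proof -
  have "?P' + p * th t * ((A t + mu) / 2) * eU (Suc t) \<le> (1 - p * th t) * ?P + p * th t * (A t / 2) * eU t"
    by (rule sc.lyapunov_step[OF mu_nonneg th(1,2) less_imp_le[OF th(1)] th_antimono th(3,4,5) A_ge
        nonneg(9,1,2,3,4,5,6) msq_nonneg nonneg(2) eF_Suc eX_le xi_le eQ_le eW_Suc_le eK_Suc_le eB_le
        eN_Suc_le eH_Suc_le eG_le])
  hence "G (Suc t) * (?P' + p * th t * ((A t + mu) / 2) * eU (Suc t))
      \<le> G (Suc t) * ((1 - p * th t) * ?P + p * th t * (A t / 2) * eU t)"
    using G_pos[of "Suc t"] by (intro mult_left_mono) auto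
  moreover have "G (Suc t) * (?P' + p * th t * ((A t + mu) / 2) * eU (Suc t))
      = G (Suc t) * ?P' + (G (Suc t) * (p * th t)) * (A t + mu) / 2 * eU (Suc t)"
    by (simp add: distrib_left)
  moreover have "G (Suc t) * ((1 - p * th t) * ?P + p * th t * (A t / 2) * eU t)
      = (G (Suc t) * (1 - p * th t)) * ?P + (G (Suc t) * (p * th t)) * A t / 2 * eU t"
    by (simp only: distrib_left) simp
  ultimately show ?thesis unfolding G_Suc_mult A_mult by simp
qed

text \<open>The statement takes the expectation of an average, the recursions the average of
  expectations.\<close>

lemma eH_eq: "eH t = expectation (\<lambda>\<omega>. (1 / real n) * (\<Sum>i<n. (norm (ht t i \<omega> - g i (zt t \<omega>)))\<^sup>2))"
  unfolding eH_def
  by (rule expectation_avg_msq(1)[where J = "past t", symmetric]) (intro L2_diff L2_ht[OF state_L2] L2_g L2_zt[OF state_L2])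

end

theorem theorem6:
  fixes n :: nat
    and fs :: "nat \<Rightarrow> 'a::euclidean_space \<Rightarrow> real" and g :: "nat \<Rightarrow> 'a \<Rightarrow> 'a"
    and Li :: "nat \<Rightarrow> real" and Lmax Lbar thmin Lhat L mu omega alpha p tau beta Gam0 :: real
    and xstar x0 k0 v0 :: 'a and h0 :: "nat \<Rightarrow> 'a"
    and M :: "'m measure"
    and PY PZ :: "nat \<Rightarrow> 's measure" and PP :: "'s measure"
    and CY CZ :: "nat \<Rightarrow> 's \<Rightarrow> 'a \<Rightarrow> 'a" and CP :: "'s \<Rightarrow> 'a \<Rightarrow> 'a"
    and sy sz :: "nat \<Rightarrow> nat \<Rightarrow> 'm \<Rightarrow> 's" and sP :: "nat \<Rightarrow> 'm \<Rightarrow> 's"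
    and coin :: "nat \<Rightarrow> 'm \<Rightarrow> bool"
  defines "F \<equiv> (\<lambda>x. (1 / real n) * (\<Sum>i<n. fs i x))"
    and "gF \<equiv> (\<lambda>x. (1 / real n) *\<^sub>R (\<Sum>i<n. g i x))"
    and "Gm \<equiv> gam_seq Lbar mu p thmin Gam0"
    and "S \<equiv> alg_run n g CY CZ CP Lbar mu p tau beta thmin Gam0 x0 h0 k0 v0 sy sz sP coin"
  assumes Lmax_def: "Lmax = Max (Li ` {..<n})"
    and Lbar_def: "Lbar = 660508 * Max {L / alpha, L * p / (alpha * tau),
                 sqrt (L * Lmax) * p * sqrt (omega * tau) / (alpha * beta * sqrt (real n)),
                 sqrt (L * Lmax) * sqrt p * sqrt (omega * tau) / (alpha * sqrt beta * sqrt (real n)),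
                 Lmax * omega * p\<^sup>2 / (beta\<^sup>2 * real n),
                 Lmax * omega / real n}"
    and thmin_def: "thmin = 1 / 4 * Min {1, alpha / p, tau / p, beta / p}"
    and n_pos: "n \<ge> 1"
    \<comment> \<open>Assumption 1\<close>
    and grad: "\<forall>i<n. \<forall>x. (fs i has_derivative (\<lambda>h. g i x \<bullet> h)) (at x)"
    and smooth_i: "\<forall>i<n. \<forall>x y. norm (g i x - g i y) \<le> Li i * norm (x - y)"
    and Lhat_pos: "Lhat > 0"
    and Lhat: "\<forall>x y. (1 / real n) * (\<Sum>i<n. (norm (g i x - g i y))\<^sup>2) \<le> Lhat\<^sup>2 * (norm (x - y))\<^sup>2"
    \<comment> \<open>Assumption 2\<close>
    and smooth: "\<forall>x y. norm (gF x - gF y) \<le> L * norm (x - y)"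
    \<comment> \<open>Assumption 3\<close>
    and convex_i: "\<forall>i<n. convex_on UNIV (fs i)"
    and mu_nonneg: "mu \<ge> 0"
    and strong: "strongly_convex_grad F gF mu"
    and minimizer: "\<forall>x. F xstar \<le> F x"
    \<comment> \<open>compressors and parameters\<close>
    and omega_nonneg: "omega \<ge> 0"
    and CY_U: "\<forall>i<n. unbiased_compressor (PY i) (CY i) omega"
    and CZ_U: "\<forall>i<n. unbiased_compressor (PZ i) (CZ i) omega"
    and alpha: "0 < alpha" "alpha \<le> 1"
    and CP_B: "biased_compressor PP CP alpha"
    and p: "0 < p" "p \<le> 1"
    and Gam0: "Gam0 \<ge> 1"
    and tau: "0 < tau" "tau \<le> 1"
    and beta: "0 < beta" "beta \<le> 1 / (omega + 1)"
    and Lbar_pos: "Lbar > 0"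
    \<comment> \<open>Randomness (Assumption 4): fresh independent seeds and coins\<close>
    and M: "prob_space M"
    and sy_law: "\<forall>t. \<forall>i<n. sy t i \<in> measurable M (PY i) \<and> distr M (PY i) (sy t i) = PY i"
    and sz_law: "\<forall>t. \<forall>i<n. sz t i \<in> measurable M (PZ i) \<and> distr M (PZ i) (sz t i) = PZ i"
    and sP_law: "\<forall>t. sP t \<in> measurable M PP \<and> distr M PP (sP t) = PP"
    and coin_law: "\<forall>t. coin t \<in> measurable M (count_space UNIV) \<and>
                        measure M {\<omega> \<in> space M. coin t \<omega>} = p"
    and indep: "prob_space.indep_sets M (src_events M PY PZ PP sy sz sP coin) (rel_srcs n)"
  shows "\<exists>kappa rho lam. kappa \<ge> 0 \<and> rho \<ge> 0 \<and> lam \<ge> 0 \<and>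
           (\<exists>nu :: nat \<Rightarrow> real. (\<forall>t. nu t \<ge> 0) \<and>
             (let Psi = (\<lambda>t.
                  (\<integral>\<omega>. F (st_z (S t \<omega>)) - F xstar \<partial>M)
                + kappa * (\<integral>\<omega>. (1 / real n) * (\<Sum>i<n. (norm (st_h (S t \<omega>) i - g i (st_z (S t \<omega>))))\<^sup>2) \<partial>M)
                + nu t * (\<integral>\<omega>. (norm (st_w (S t \<omega>) - st_u (S t \<omega>)))\<^sup>2 \<partial>M)
                + rho * (\<integral>\<omega>. (norm (st_k (S t \<omega>) - gF (st_z (S t \<omega>))))\<^sup>2 \<partial>M)
                + lam * (\<integral>\<omega>. (norm (st_v (S t \<omega>) - gF (st_z (S t \<omega>))))\<^sup>2 \<partial>M))
              in \<forall>t. Gm (Suc t) * Psi (Suc t)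
                     + (Lbar + Gm (Suc t) * mu) / 2 * (\<integral>\<omega>. (norm (st_u (S (Suc t) \<omega>) - xstar))\<^sup>2 \<partial>M)
                   \<le> Gm t * Psi t
                     + (Lbar + Gm t * mu) / 2 * (\<integral>\<omega>. (norm (st_u (S t \<omega>) - xstar))\<^sup>2 \<partial>M)))"
proof -
  interpret two_direction n fs g Li Lmax Lbar thmin L mu omega alpha p tau beta Gam0 xstar x0 k0 v0 h0 M
    PY PZ PP CY CZ CP sy sz sP coin F gF
  proof (rule two_direction.intro)
    show "F = (\<lambda>x. (1 / real n) * (\<Sum>i<n. fs i x))" "gF = (\<lambda>x. (1 / real n) *\<^sub>R (\<Sum>i<n. g i x))"
      by (simp_all only: F_def gF_def)
    show "\<And>i x. i < n \<Longrightarrow> (fs i has_derivative (\<lambda>h. g i x \<bullet> h)) (at x)" using grad by blast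
    show "\<And>i x y. i < n \<Longrightarrow> norm (g i x - g i y) \<le> Li i * norm (x - y)" using smooth_i by blast
    show "\<And>x y. norm (gF x - gF y) \<le> L * norm (x - y)" using smooth by blast
    show "\<And>i. i < n \<Longrightarrow> convex_on UNIV (fs i)" using convex_i by blast
    show "\<And>i. i < n \<Longrightarrow> unbiased_compressor (PY i) (CY i) omega" using CY_U by blast
    show "\<And>i. i < n \<Longrightarrow> unbiased_compressor (PZ i) (CZ i) omega" using CZ_U by blast
    show "\<And>t i. i < n \<Longrightarrow> sy t i \<in> measurable M (PY i) \<and> distr M (PY i) (sy t i) = PY i" using sy_law by blast
    show "\<And>t i. i < n \<Longrightarrow> sz t i \<in> measurable M (PZ i) \<and> distr M (PZ i) (sz t i) = PZ i" using sz_law by blast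
    show "\<And>t. sP t \<in> measurable M PP \<and> distr M PP (sP t) = PP" using sP_law by blast
    show "\<And>t. coin t \<in> measurable M (count_space UNIV) \<and> measure M {\<omega> \<in> space M. coin t \<omega>} = p" using coin_law by blast
  qed (fact Lmax_def Lbar_def thmin_def n_pos mu_nonneg strong omega_nonneg alpha CP_B p Gam0 tau beta Lbar_pos M indep)+
  have S: "S = St" by (simp add: S_def St_def)
  have Gm: "Gm = G" by (simp add: Gm_def G_def fun_eq_iff)
  \<comment> \<open>The weight of |w - u|^2 at time t uses \<open>th t\<close>, which is theta with
    index t + 1, the step about to be taken.\<close>
  show ?thesis
    using lyapunov_decrease sc.weights_nonneg
    unfolding S Gm Let_def eF_def eW_def eK_def eN_def eU_def eH_eq state_defs
    by (intro exI[of _ sc.kappa] exI[of _ sc.rho] exI[of _ sc.lam] exI[of _ "\<lambda>t. sc.nu (th t)"] conjI allI) auto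
qed

end
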